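(* Assume $0<\inf_{n\in\mathbb{Z}}s_l[D_n]\le\sup_{n\in\mathbb{Z}}s_1[D_n]<\infty$ and let $r\in\{1,\dots,l\}$. With $$\mathcal{S}_r:=\Big\{x\in\mathbb{R}:\ \liminf_{L\to\infty}\frac1L\sum_{n=1}^{L}\big(s_{l-r+1}[\phi_n(x)]^2+s_{l-r+1}[\psi_n(x)]^2\big)<\infty\Big\}$$ and $\mathcal{S}_{l+1}:=\emptyset$, the restriction of the absolutely continuous spectrum of $H^\phi_+$ to $\mathcal{S}_r\setminus\mathcal{S}_{r+1}$ has multiplicity at most $r$; that is, $N_{H^\phi_+}(x)\le r$ for Lebesgue-a.e. $x\in\mathcal{S}_r\setminus\mathcal{S}_{r+1}$.
   Context: Fix $l\in\mathbb{N}$. Let $(D_n)_{n\in\mathbb{Z}}$, $(V_n)_{n\in\mathbb{Z}}$ be sequences of real symmetric $l\times l$ matrices with every $D_n$ invertible. For $z\in\mathbb{C}$ the eigenvalue equation is $D_{n-1}\mathbf{u}_{n-1}+D_n\mathbf{u}_{n+1}+V_n\mathbf{u}_n=z\mathbf{u}_n$; a sequence of $l\times l$ matrices is a (matrix) solution if each column is a solution. The Dirichlet solution $\phi(z)$ and Neumann solution $\psi(z)$ are the matrix solutions for $n\ge1$ with $\phi_0=0,\ \phi_1=\mathbb{I}$ and $\psi_0=\mathbb{I},\ \psi_1=0$. The half-line Dirichlet operator $H^\phi_+$ acts on $\ell^2(\mathbb{N};\mathbb{C}^l)$ by $(H^\phi_+\mathbf{u})_n=D_{n-1}\mathbf{u}_{n-1}+D_n\mathbf{u}_{n+1}+V_n\mathbf{u}_n$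 for $n\ge1$, with $\mathbf{u}_0=0$. $s_1[A]\ge\dots\ge s_l[A]$ denote singular values. Multiplicity: for a self-adjoint operator $T$ on a separable Hilbert space, the absolutely continuous part of $T$ is unitarily equivalent to multiplication by the variable on $\bigoplus_j L^2(\mathbb{R},\chi_{A_j}\,d\kappa)$ with Borel sets $A_1\supseteq A_2\supseteq\cdots$ ($\kappa$ = Lebesgue measure); the multiplicity function is $N_T(x):=\#\{j: x\in A_j\}$ (well defined up to $\kappa$-null sets). *)

theory Defs
  imports "HOL-Analysis.Analysis" "HOL-Computational_Algebra.Polynomial"
begin

definition charpoly :: "real^'l^'l \<Rightarrow> real poly" where
  "charpoly A = det (\<chi> i j. (if i = j then [:0, 1:] else 0) - [:A $ i $ j:])"

definition gram_eigs_desc :: "real^'l^'l \<Rightarrow> real list" where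
  "gram_eigs_desc A = rev (sorted_list_of_multiset (proots (charpoly (transpose A ** A))))"

definition sv :: "nat \<Rightarrow> real^'l^'l \<Rightarrow> real" where
  "sv k A = sqrt (gram_eigs_desc A ! (k - 1))"

definition sym_mat :: "real^'l^'l \<Rightarrow> bool" where
  "sym_mat A \<longleftrightarrow> transpose A = A"

text \<open>solseq D V x a b n: the matrix solution with value a at 0 and b at 1 of
  D(n-1) u(n-1) + D(n) u(n+1) + V(n) u(n) = x u(n), n >= 1.\<close>
fun solseq :: "(int \<Rightarrow> real^'l^'l) \<Rightarrow> (int \<Rightarrow> real^'l^'l) \<Rightarrow> real
    \<Rightarrow> real^'l^'l \<Rightarrow> real^'l^'l \<Rightarrow> nat \<Rightarrow> real^'l^'l" where
  "solseq D V x a b 0 = a"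
| "solseq D V x a b (Suc 0) = b"
| "solseq D V x a b (Suc (Suc n)) =
     matrix_inv (D (int (Suc n))) **
       ((x *\<^sub>R mat 1 - V (int (Suc n))) ** solseq D V x a b (Suc n)
        - D (int n) ** solseq D V x a b n)"

definition dirichlet_sol where "dirichlet_sol D V x = solseq D V x 0 (mat 1)"
definition neumann_sol where "neumann_sol D V x = solseq D V x (mat 1) 0"

definition Sset :: "(int \<Rightarrow> real^'l^'l) \<Rightarrow> (int \<Rightarrow> real^'l^'l) \<Rightarrow> nat \<Rightarrow> real set" where
  "Sset D V r = (if r \<le> CARD('l) then
     {x. liminf (\<lambda>L::nat. ereal (1 / real L *
          (\<Sum>n = 1..L. (sv (CARD('l) - r + 1) (dirichlet_sol D V x n))\<^sup>2
                      + (sv (CARD('l) - r + 1) (neumann_sol D V x n))\<^sup>2))) < \<infinity>}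
     else {})"

text \<open>Sequences u :: nat => complex^'l; index 0 is the Dirichlet boundary (u 0 = 0),
  the Hilbert space is indexed by n >= 1.\<close>
definition cmv :: "real^'l^'l \<Rightarrow> complex^'l \<Rightarrow> complex^'l" where
  "cmv A v = (\<chi> i. \<Sum>j\<in>UNIV. complex_of_real (A $ i $ j) * v $ j)"

definition ell2 :: "(nat \<Rightarrow> complex^'l) set" where
  "ell2 = {u. u 0 = 0 \<and> summable (\<lambda>n. (norm (u n))\<^sup>2)}"

definition l2norm2 :: "(nat \<Rightarrow> complex^'l) \<Rightarrow> real" where
  "l2norm2 u = (\<Sum>n. (norm (u n))\<^sup>2)"

definition Hdir :: "(int \<Rightarrow> real^'l^'l) \<Rightarrow> (int \<Rightarrow> real^'l^'l)
    \<Rightarrow> (nat \<Rightarrow> complex^'l) \<Rightarrow> (nat \<Rightarrow> complex^'l)" where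
  "Hdir D V u n = (if n = 0 then 0 else
      cmv (D (int n - 1)) (u (n - 1)) + cmv (D (int n)) (u (Suc n)) + cmv (V (int n)) (u n))"

text \<open>Maximal (self-adjoint) domain.\<close>
definition Hdir_dom :: "(int \<Rightarrow> real^'l^'l) \<Rightarrow> (int \<Rightarrow> real^'l^'l) \<Rightarrow> (nat \<Rightarrow> complex^'l) set" where
  "Hdir_dom D V = {u \<in> ell2. Hdir D V u \<in> ell2}"

text \<open>Elements of (direct sum_j L^2(R, chi_{A_j} d kappa)) (+) (direct sum_k L^2(R, nu_k)),
  represented by pairs of families of functions (up to a.e. equality).\<close>
type_synonym dsel = "(nat \<Rightarrow> real \<Rightarrow> complex) \<times> (nat \<Rightarrow> real \<Rightarrow> complex)"

definition ds_norm2 :: "(nat \<Rightarrow> real set) \<Rightarrow> (nat \<Rightarrow> real measure) \<Rightarrow> dsel \<Rightarrow> ennreal" where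
  "ds_norm2 A \<nu> F =
     (\<Sum>j. \<integral>\<^sup>+ x. indicator (A j) x * ennreal ((cmod (fst F j x))\<^sup>2) \<partial>lborel)
   + (\<Sum>k. \<integral>\<^sup>+ x. ennreal ((cmod (snd F k x))\<^sup>2) \<partial>(\<nu> k))"

definition ds_space :: "(nat \<Rightarrow> real set) \<Rightarrow> (nat \<Rightarrow> real measure) \<Rightarrow> dsel set" where
  "ds_space A \<nu> = {F. (\<forall>j. fst F j \<in> borel_measurable lborel)
                    \<and> (\<forall>k. snd F k \<in> borel_measurable (\<nu> k))
                    \<and> ds_norm2 A \<nu> F < \<infinity>}"

definition ds_eq :: "(nat \<Rightarrow> real set) \<Rightarrow> (nat \<Rightarrow> real measure) \<Rightarrow> dsel \<Rightarrow> dsel \<Rightarrow> bool" where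
  "ds_eq A \<nu> F G \<longleftrightarrow> (\<forall>j. AE x in lborel. x \<in> A j \<longrightarrow> fst F j x = fst G j x)
                   \<and> (\<forall>k. AE x in \<nu> k. snd F k x = snd G k x)"

definition ds_lin :: "complex \<Rightarrow> dsel \<Rightarrow> dsel \<Rightarrow> dsel" where
  "ds_lin c F G = ((\<lambda>j x. c * fst F j x + fst G j x), (\<lambda>k x. c * snd F k x + snd G k x))"

definition mult_x :: "dsel \<Rightarrow> dsel" where
  "mult_x F = ((\<lambda>j x. complex_of_real x * fst F j x), (\<lambda>k x. complex_of_real x * snd F k x))"

text \<open>U is a unitary map from l^2(N;C^l) onto the direct sum above which carries the
  operator (Dom, T) to multiplication by the variable; the nu_k are singular w.r.t.
  Lebesgue measure, so the first summand is exactly the image of the absolutely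
  continuous subspace, and T_ac is unitarily equivalent to multiplication by the variable
  on direct sum_j L^2(R, chi_{A_j} d kappa), with A_0 >= A_1 >= ... Borel.\<close>
definition ac_sing_rep :: "(nat \<Rightarrow> complex^'l) set \<Rightarrow> ((nat \<Rightarrow> complex^'l) \<Rightarrow> (nat \<Rightarrow> complex^'l))
    \<Rightarrow> (nat \<Rightarrow> real set) \<Rightarrow> (nat \<Rightarrow> real measure) \<Rightarrow> ((nat \<Rightarrow> complex^'l) \<Rightarrow> dsel) \<Rightarrow> bool" where
  "ac_sing_rep Dom T A \<nu> U \<longleftrightarrow>
     (\<forall>j. A j \<in> sets borel \<and> A (Suc j) \<subseteq> A j)
   \<and> (\<forall>k. sets (\<nu> k) = sets borel \<and> (\<exists>N \<in> null_sets lborel. emeasure (\<nu> k) (UNIV - N) = 0))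
   \<and> (\<forall>u\<in>ell2. U u \<in> ds_space A \<nu> \<and> ds_norm2 A \<nu> (U u) = ennreal (l2norm2 u))
   \<and> (\<forall>u\<in>ell2. \<forall>v\<in>ell2. \<forall>c. ds_eq A \<nu> (U (\<lambda>n. c *s u n + v n)) (ds_lin c (U u) (U v)))
   \<and> (\<forall>F\<in>ds_space A \<nu>. \<exists>u\<in>ell2. ds_eq A \<nu> (U u) F)
   \<and> (\<forall>u\<in>ell2. u \<in> Dom \<longleftrightarrow> ds_norm2 A \<nu> (mult_x (U u)) < \<infinity>)
   \<and> (\<forall>u\<in>Dom. ds_eq A \<nu> (U (T u)) (mult_x (U u)))"

end

(*
  If U diagonalises H, write w_j(x) for the vector of the j-th absolutely continuous components of
  U applied to the site-1 unit vectors; the components at site n are phi_n(x) w_j(x), so the w_j(x),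
  j < N(x), are linearly independent because the unit vectors are total.  Let M(z) be the site-1
  block of (H - z)^-1 and D0 the matrix D(0).  The diagonal block of (H - z)^-1 at site n is
  phi_n M phi_n^T - phi_n D0^-1 psi_n^T, and that of the operator with boundary condition u(1) = 0
  is psi_n D0^-1 phi_n^T - psi_n D0^-1 M^-1 D0^-1 psi_n^T.  Their diagonal entries are Herglotz
  functions F with Im F(i) <= 1, so for the Cauchy distribution on the real line the mean of Im F
  over the preimages of circles about 0 under the Cayley transform is at most 1.  Fatou's lemma
  turns this into a finite lower limit, almost everywhere, of the averages of
  tr phi_n Q phi_n^T + tr psi_n Q' psi_n^T, where Q = Im M(x+i0) and Q' = Im(-D0^-1 M(x+i0)^-1 D0^-1).
  Both forms have rank at least N(x), since Q dominates pi * sum_j w_j w_j^*, and a form of rank k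
  controls the square of the (l-k+1)-st singular value.  Hence x lies in S_N(x).

  The boundary values are needed only along one sequence of radii tending to 1.  The logarithm of a
  Herglotz function has bounded imaginary part, hence is in the Hardy space H^2, and there
  convergence along a subsequence is Parseval's identity.  The same argument for -M^-1 gives the
  invertibility of M(x+i0).
*)
theory Submission
  imports Defs "HOL-Complex_Analysis.Complex_Analysis"
begin

section \<open>The Cauchy distribution on the line\<close>

text \<open>The bound is proved in contrapositive form: almost every x in \<open>A (k - 1)\<close>
  lies in \<open>Sset D V k\<close>; with k = r + 1, a point outside \<open>Sset D V (r + 1)\<close>
  is outside \<open>A r\<close>. The obstacle is that \<open>Sset\<close> speaks of averages over n
  at a fixed x, while spectral theory controls each n after integration over x. Mean values give
  integral bounds uniform in n, and since \<open>Sset\<close> asks for a lower limit, Fatou's lemma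
  can be used twice, over the radii and then over L, without exchanging limits. Symmetry of H, the
  resolvent and its bounds are all read off from the diagonalisation U, so no boundary terms at
  infinity arise. Two boundary conditions occur because passing to u(1) = 0 exchanges the roles of
  phi and psi. At a real point both solutions are real, so the mixed terms phi_n D0^-1 psi_n^T have
  no imaginary part. The Cauchy distribution is the image of normalised arc length under the Cayley
  transform and has the null sets of Lebesgue measure. The point i is special because it corresponds
  to the centre of the disc, where mean values are taken.\<close>

definition cauchyM :: "real measure" where
  "cauchyM = density lborel (\<lambda>x. ennreal (1 / (pi * (1 + x\<^sup>2))))"

text \<open>The Cayley transform, from the line onto the unit circle without 1. It turns integrals
  over circles about 0 into integrals over the line.\<close>

definition circ :: "real \<Rightarrow> complex" where
  "circ x = (complex_of_real x - \<i>) / (complex_of_real x + \<i>)"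

lemma one_plus_sq_pos: "1 + (x::real)\<^sup>2 > 0"
  by (simp add: add_pos_nonneg)

lemma of_real_plus_i_nz: "complex_of_real x + \<i> \<noteq> 0" "complex_of_real x - \<i> \<noteq> 0"
  by (auto simp: complex_eq_iff)

lemma norm_circ [simp]: "cmod (circ x) = 1"
proof -
  have "cmod (complex_of_real x - \<i>) = cmod (complex_of_real x + \<i>)" by (simp add: cmod_def)
  then show ?thesis using of_real_plus_i_nz[of x] by (simp add: circ_def norm_divide)
qed

lemma continuous_circ: "continuous_on A circ"
  unfolding circ_def by (intro continuous_intros) (auto simp: of_real_plus_i_nz)

lemma measurable_circ [measurable]: "circ \<in> borel_measurable borel"
  by (intro borel_measurable_continuous_onI continuous_circ)

lemma sets_cauchyM [measurable_cong, simp]: "sets cauchyM = sets borel"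
  by (simp add: cauchyM_def)

lemma space_cauchyM [simp]: "space cauchyM = UNIV"
  by (simp add: cauchyM_def)

lemma nn_integral_cauchyM:
  assumes [measurable]: "f \<in> borel_measurable borel"
  shows "(\<integral>\<^sup>+x. f x \<partial>cauchyM) = (\<integral>\<^sup>+x. ennreal (1 / (pi * (1 + x\<^sup>2))) * f x \<partial>lborel)"
  unfolding cauchyM_def by (subst nn_integral_density) auto

lemma AE_cauchyM_iff: "(AE x in cauchyM. P x) \<longleftrightarrow> (AE x in lborel. P x)"
proof -
  have "(AE x in cauchyM. P x) \<longleftrightarrow> (AE x in lborel. 0 < ennreal (1 / (pi * (1 + x\<^sup>2))) \<longrightarrow> P x)"
    unfolding cauchyM_def by (rule AE_density) auto
  moreover have "0 < ennreal (1 / (pi * (1 + x\<^sup>2)))" for x :: real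
    using one_plus_sq_pos[of x] by simp
  ultimately show ?thesis by simp
qed

lemma cauchy_density_integral:
  shows "set_integrable lborel UNIV (\<lambda>x::real. 1 / (1 + x\<^sup>2))"
    and "(LBINT x. 1 / (1 + x\<^sup>2)) = pi"
proof -
  have L: "((arctan \<circ> real_of_ereal) \<longlongrightarrow> - (pi/2)) (at_right (-\<infinity>))"
    unfolding ereal_tendsto_simps by (rule tendsto_arctan_at_bot)
  have R: "((arctan \<circ> real_of_ereal) \<longlongrightarrow> pi/2) (at_left \<infinity>)"
    unfolding ereal_tendsto_simps by (rule tendsto_arctan_at_top)
  have c: "isCont (\<lambda>x. 1 / (1 + x\<^sup>2)) x" for x :: real
    by (intro continuous_intros) (use one_plus_sq_pos[of x] in auto)
  have D: "DERIV arctan x :> 1 / (1 + x\<^sup>2)" for x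
    using DERIV_arctan[of x] by (simp add: inverse_eq_divide)
  note * = interval_integral_FTC_nonneg[of "-\<infinity>" \<infinity> arctan "\<lambda>x. 1 / (1 + x\<^sup>2)", OF _ D c _ L R]
  show "set_integrable lborel UNIV (\<lambda>x::real. 1 / (1 + x\<^sup>2))"
    using *(1) by (simp add: add_nonneg_nonneg)
  show "(LBINT x. 1 / (1 + x\<^sup>2)) = pi"
    using *(2) by (simp add: add_nonneg_nonneg interval_lebesgue_integral_def set_lebesgue_integral_def)
qed

lemma emeasure_cauchyM: "emeasure cauchyM UNIV = 1"
proof -
  have "emeasure cauchyM UNIV = (\<integral>\<^sup>+x. ennreal (1 / (pi * (1 + x\<^sup>2))) \<partial>lborel)"
    unfolding cauchyM_def by (subst emeasure_density) auto
  also have "\<dots> = ennreal (LBINT x. 1 / (pi * (1 + x\<^sup>2)))"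
  proof (rule nn_integral_eq_integral)
    have "integrable lborel (\<lambda>x::real. (1 / pi) * (1 / (1 + x\<^sup>2)))"
      using cauchy_density_integral(1) unfolding set_integrable_def
      by (intro integrable_mult_right) simp
    then show "integrable lborel (\<lambda>x::real. 1 / (pi * (1 + x\<^sup>2)))" by simp
    show "AE x in lborel. 0 \<le> 1 / (pi * (1 + x\<^sup>2))" by (simp add: add_nonneg_nonneg)
  qed
  also have "(LBINT x. 1 / (pi * (1 + x\<^sup>2))) = (LBINT x. (1 / pi) * (1 / (1 + x\<^sup>2)))" by simp
  also have "\<dots> = 1" using cauchy_density_integral(2) by (subst integral_mult_right_zero) auto
  finally show ?thesis by simp
qed

lemma finite_measure_cauchyM: "finite_measure cauchyM"
  by (rule finite_measureI) (simp add: emeasure_cauchyM)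

lemma measure_cauchyM [simp]: "measure cauchyM UNIV = 1"
  by (simp add: measure_def emeasure_cauchyM)

lemma integrable_cauchyM_bounded:
  fixes f :: "real \<Rightarrow> 'a::{banach, second_countable_topology}"
  assumes "f \<in> borel_measurable borel" "\<And>x. norm (f x) \<le> B"
  shows "integrable cauchyM f"
  by (rule finite_measure.integrable_const_bound[OF finite_measure_cauchyM, of _ B])
     (use assms in auto)

text \<open>The integrand circ^n / (1 + x^2) equals circ^(n-1) / (x + i)^2, whose primitive is
  circ^n / (2 i n). The primitive has the same limit at both ends of the line, because circ tends to
  1 there.\<close>

lemma integral_circ_power:
  assumes "n > 0"
  shows "(LINT x|cauchyM. circ x ^ n) = 0"
proof -
  define f where "f = (\<lambda>x::real. (1 / (1 + x\<^sup>2)) *\<^sub>R circ x ^ n)"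
  define F where "F = (\<lambda>x::real. circ x ^ n / (2 * \<i> * of_nat n))"
  have int: "set_integrable lborel UNIV f"
  proof -
    have "integrable lborel (\<lambda>x::real. 1 / (1 + x\<^sup>2))"
      using cauchy_density_integral(1) by (simp add: set_integrable_def)
    then have "integrable lborel f"
      by (rule Bochner_Integration.integrable_bound)
         (auto simp: f_def norm_power norm_mult)
    then show ?thesis by (simp add: set_integrable_def)
  qed
  have lim1: "((\<lambda>x. (x - \<i>) / (x + \<i>)) \<longlongrightarrow> 1) at_infinity"
  proof -
    have "filterlim (\<lambda>x::complex. x + \<i>) at_infinity at_infinity"
      by (rule tendsto_add_filterlim_at_infinity'[OF filterlim_ident tendsto_const])
    then have "((\<lambda>x::complex. 1 - 2 * \<i> / (x + \<i>)) \<longlongrightarrow> 1 - 0) at_infinity"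
      by (intro tendsto_diff tendsto_const tendsto_divide_0[OF tendsto_const])
    moreover have "eventually (\<lambda>x::complex. 1 - 2 * \<i> / (x + \<i>) = (x - \<i>) / (x + \<i>)) at_infinity"
      by (rule eventually_mono[OF eventually_not_equal_at_infinity[of "-\<i>"]])
         (auto simp: field_simps add_eq_0_iff2)
    ultimately show ?thesis by (simp add: tendsto_cong)
  qed
  have "filterlim complex_of_real at_infinity at_top" "filterlim complex_of_real at_infinity at_bot"
    using filterlim_at_infinity_imp_norm_at_top[OF filterlim_at_bot_imp_at_infinity[OF filterlim_ident]]
    by (auto simp: filterlim_at_infinity_conv_norm_at_top filterlim_abs_real)
  then have limc: "(circ \<longlongrightarrow> 1) at_top" "(circ \<longlongrightarrow> 1) at_bot"
    unfolding circ_def by (auto intro: filterlim_compose[OF lim1])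
  have A: "((F \<circ> real_of_ereal) \<longlongrightarrow> 1 ^ n / (2 * \<i> * of_nat n)) (at_right (-\<infinity>))"
    unfolding ereal_tendsto_simps unfolding F_def by (intro tendsto_intros limc) (use assms in auto)
  have B: "((F \<circ> real_of_ereal) \<longlongrightarrow> 1 ^ n / (2 * \<i> * of_nat n)) (at_left \<infinity>)"
    unfolding ereal_tendsto_simps unfolding F_def by (intro tendsto_intros limc) (use assms in auto)
  have dc: "((\<lambda>z. (z - \<i>) / (z + \<i>)) has_field_derivative (2 * \<i> / (complex_of_real x + \<i>)\<^sup>2)) (at (complex_of_real x))" for x
    by (rule derivative_eq_intros refl | simp add: of_real_plus_i_nz)+
       (auto simp: of_real_plus_i_nz field_simps power2_eq_square)
  have D: "(F has_vector_derivative f x) (at x)" for x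
  proof -
    have "((\<lambda>z. ((z - \<i>) / (z + \<i>)) ^ n / (2 * \<i> * of_nat n)) has_field_derivative
           (of_nat n * (circ x ^ (n - 1)) * (2 * \<i> / (complex_of_real x + \<i>)\<^sup>2)) / (2 * \<i> * of_nat n)) (at (complex_of_real x))"
      using DERIV_cdivide[OF DERIV_power[OF dc[of x], of n], of "2 * \<i> * of_nat n"]
      by (simp add: circ_def mult_ac)
    from has_vector_derivative_real_field[OF this]
    have "(F has_vector_derivative (of_nat n * (circ x ^ (n - 1)) * (2 * \<i> / (complex_of_real x + \<i>)\<^sup>2)) / (2 * \<i> * of_nat n)) (at x)"
      by (simp add: F_def circ_def)
    also have "(of_nat n * (circ x ^ (n - 1)) * (2 * \<i> / (complex_of_real x + \<i>)\<^sup>2)) / (2 * \<i> * of_nat n)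
      = circ x ^ (n - 1) / (complex_of_real x + \<i>)\<^sup>2"
      using assms by (simp add: field_simps)
    also have "\<dots> = f x"
    proof -
      have "circ x ^ n = circ x ^ (n - 1) * circ x"
        using assms by (metis power_minus_mult)
      moreover have "complex_of_real (1 / (1 + x\<^sup>2)) = 1 / ((complex_of_real x + \<i>) * (complex_of_real x - \<i>))"
        by (simp add: algebra_simps power2_eq_square)
      ultimately show ?thesis
        using of_real_plus_i_nz[of x] by (simp add: f_def scaleR_conv_of_real circ_def power2_eq_square)
    qed
    finally show ?thesis .
  qed
  have c: "isCont f x" for x
    unfolding f_def using one_plus_sq_pos[of x] continuous_circ[of UNIV]
    by (intro continuous_intros) (auto simp: continuous_on_eq_continuous_at)
  have "(LBINT x=-\<infinity>..\<infinity>. f x) = 0"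
    using interval_integral_FTC_integrable[of "-\<infinity>" \<infinity> F f, OF _ D c _ A B] int by simp
  then have "(LBINT x. f x) = 0"
    by (simp add: interval_lebesgue_integral_def set_lebesgue_integral_def)
  moreover have "(LINT x|cauchyM. circ x ^ n) = (LBINT x. (1 / pi) *\<^sub>R f x)"
    unfolding cauchyM_def
    by (subst integral_density) (auto simp: f_def intro!: add_nonneg_nonneg)
  ultimately show ?thesis by simp
qed

lemma integral_circ_orthonormal:
  "(LINT x|cauchyM. circ x ^ m * cnj (circ x ^ n)) = (if m = n then 1 else 0)"
proof -
  have u: "circ x * cnj (circ x) = 1" for x by (simp add: complex_norm_square[symmetric])
  have *: "circ x ^ (n + d) * cnj (circ x ^ n) = circ x ^ d" for x n d
  proof -
    have "circ x ^ (n + d) * cnj (circ x ^ n) = (circ x * cnj (circ x)) ^ n * circ x ^ d"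
      by (simp add: power_add power_mult_distrib)
    then show ?thesis by (simp add: u)
  qed
  show ?thesis
  proof (cases m n rule: linorder_cases)
    case less
    then obtain d where d: "n = m + d" "d > 0" using less_imp_add_positive by blast
    have "circ x ^ m * cnj (circ x ^ n) = cnj (circ x ^ d)" for x
      using arg_cong[OF *[of x m d], of cnj] d by (simp add: mult.commute)
    then have "(LINT x|cauchyM. circ x ^ m * cnj (circ x ^ n)) = (LINT x|cauchyM. cnj (circ x ^ d))"
      by simp
    also have "\<dots> = cnj (LINT x|cauchyM. circ x ^ d)"
      by (rule Bochner_Integration.integral_cnj)
    finally have "(LINT x|cauchyM. circ x ^ m * cnj (circ x ^ n)) = cnj (LINT x|cauchyM. circ x ^ d)" .
    then show ?thesis using d less integral_circ_power by simp
  next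
    case equal
    have "circ x ^ n * cnj (circ x ^ n) = 1" for x using *[of x n 0] by simp
    then show ?thesis using equal by simp
  next
    case greater
    then obtain d where d: "m = n + d" "d > 0" using less_imp_add_positive by blast
    then show ?thesis using * integral_circ_power greater by simp
  qed
qed

section \<open>Boundary values in the disc\<close>

lemma measurable_cnj [measurable]: "cnj \<in> borel_measurable borel"
  by (intro borel_measurable_continuous_onI continuous_intros)

text \<open>Inverse of the Cayley transform, from the disc onto the upper half-plane. Since
  \<open>cay (circ x)\<close> is x, the points \<open>zpt \<rho> x\<close> below approach x as the
  radius tends to 1.\<close>

definition cay :: "complex \<Rightarrow> complex" where
  "cay w = \<i> * (1 + w) / (1 - w)"

definition zpt :: "real \<Rightarrow> real \<Rightarrow> complex" where
  "zpt \<rho> x = cay (of_real \<rho> * circ x)"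

lemma cay_0 [simp]: "cay 0 = \<i>"
  by (simp add: cay_def)

lemma Im_cay: "w \<noteq> 1 \<Longrightarrow> Im (cay w) = (1 - (cmod w)\<^sup>2) / (cmod (1 - w))\<^sup>2"
  unfolding cay_def
  by (simp add: Im_divide' complex_norm_square[symmetric] cmod_power2)
     (simp add: power2_eq_square algebra_simps)

lemma Im_cay_pos: "cmod w < 1 \<Longrightarrow> Im (cay w) > 0"
  by (subst Im_cay) (auto simp: abs_square_less_1 intro!: divide_pos_pos)

lemma norm_rho_circ: "\<bar>\<rho>\<bar> < 1 \<Longrightarrow> cmod (of_real \<rho> * circ x) < 1"
  by (simp add: norm_mult)

lemma Im_zpt_pos: "\<bar>\<rho>\<bar> < 1 \<Longrightarrow> Im (zpt \<rho> x) > 0"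
  unfolding zpt_def by (intro Im_cay_pos norm_rho_circ)

lemma holomorphic_cay: "cay holomorphic_on ball 0 1"
  unfolding cay_def by (intro holomorphic_intros) auto

section \<open>Power series on circles: mean values and Parseval's identity\<close>

lemma disc_power_series:
  assumes "g holomorphic_on ball 0 1"
  shows "\<exists>a. (\<forall>w. cmod w < 1 \<longrightarrow> (\<lambda>n. a n * w ^ n) sums g w) \<and>
    (\<forall>r. \<bar>r\<bar> < 1 \<longrightarrow> summable (\<lambda>n. cmod (a n) * \<bar>r\<bar> ^ n))"
proof -
  define a where "a = (\<lambda>n. (deriv ^^ n) g 0 / fact n)"
  have s: "(\<lambda>n. a n * w ^ n) sums g w" if "cmod w < 1" for w
    using holomorphic_power_series[OF assms, of w] that by (simp add: a_def)
  moreover have "summable (\<lambda>n. cmod (a n) * \<bar>r\<bar> ^ n)" if r: "\<bar>r\<bar> < 1" for r :: real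
  proof -
    obtain R where R: "\<bar>r\<bar> < R" "R < 1" using r dense by blast
    have "summable (\<lambda>n. a n * of_real R ^ n)"
      using s[of "of_real R"] R by (auto simp: sums_iff)
    from powser_insidea[OF this, of "of_real r"] R show ?thesis
      by (simp add: norm_mult norm_power)
  qed
  ultimately show ?thesis by blast
qed

text \<open>The majorant |a_n| |rho|^n B is summable and free of x, so the series may be integrated
  term by term. The choices of h are 1 for mean values, conjugate powers for Taylor coefficients,
  and the conjugate of g itself for Parseval.\<close>

lemma integral_disc_series:
  assumes s: "\<And>w. cmod w < 1 \<Longrightarrow> (\<lambda>n. a n * w ^ n) sums g w"
    and ab: "\<And>r. \<bar>r\<bar> < 1 \<Longrightarrow> summable (\<lambda>n. cmod (a n) * \<bar>r\<bar> ^ n)"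
    and r: "\<bar>\<rho>\<bar> < 1" and [measurable]: "h \<in> borel_measurable borel" and h: "\<And>x. cmod (h x) \<le> B"
  shows "(\<lambda>n. a n * of_real \<rho> ^ n * (LINT x|cauchyM. circ x ^ n * h x)) sums
           (LINT x|cauchyM. g (of_real \<rho> * circ x) * h x)"
proof -
  define f where "f = (\<lambda>n x. a n * of_real \<rho> ^ n * (circ x ^ n * h x))"
  have B: "B \<ge> 0" using h[of 0] norm_ge_zero order_trans by blast
  have fb: "cmod (f n x) \<le> cmod (a n) * \<bar>\<rho>\<bar> ^ n * B" for n x
    unfolding f_def using h[of x] by (simp add: norm_mult norm_power mult_left_mono)
  have f_meas [measurable]: "f n \<in> borel_measurable borel" for n
    unfolding f_def by measurable
  have f_int: "integrable cauchyM (f n)" for n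
    by (rule integrable_cauchyM_bounded[OF f_meas fb])
  have sumB: "summable (\<lambda>n. cmod (a n) * \<bar>\<rho>\<bar> ^ n * B)"
    by (intro summable_mult2 ab r)
  have "(\<lambda>n. LINT x|cauchyM. f n x) sums (LINT x|cauchyM. (\<Sum>n. f n x))"
  proof (rule sums_integral[OF f_int])
    show "AE x in cauchyM. summable (\<lambda>i. cmod (f i x))"
      by (rule AE_I2, rule summable_comparison_test_ev[OF _ sumB]) (use fb in auto)
    have "(LINT x|cauchyM. cmod (f i x)) \<le> (LINT x|cauchyM. cmod (a i) * \<bar>\<rho>\<bar> ^ i * B)" for i
      by (intro integral_mono integrable_norm f_int fb finite_measure.integrable_const finite_measure_cauchyM)
    then show "summable (\<lambda>i. LINT x|cauchyM. cmod (f i x))"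
      by (intro summable_comparison_test_ev[OF _ sumB] always_eventually)
         (auto simp: integral_nonneg_AE)
  qed
  moreover have "(\<Sum>n. f n x) = g (of_real \<rho> * circ x) * h x" for x
    using sums_mult2[OF s[OF norm_rho_circ[OF r, of x]], of "h x"]
    by (simp add: f_def sums_iff power_mult_distrib mult_ac)
  ultimately show ?thesis by (simp add: f_def)
qed

lemma disc_measurable:
  assumes "g holomorphic_on ball 0 1" "\<bar>\<rho>\<bar> < 1"
  shows "(\<lambda>x. g (of_real \<rho> * circ x)) \<in> borel_measurable borel"
proof (rule borel_measurable_continuous_onI, rule continuous_on_compose2[OF holomorphic_on_imp_continuous_on[OF assms(1)]])
  show "continuous_on UNIV (\<lambda>x. of_real \<rho> * circ x)"
    by (intro continuous_intros continuous_circ)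
qed (use norm_rho_circ[OF assms(2)] in auto)

lemma disc_bounded:
  assumes "g holomorphic_on ball 0 1" "\<bar>\<rho>\<bar> < 1"
  shows "\<exists>B. \<forall>x. cmod (g (of_real \<rho> * circ x)) \<le> B"
proof -
  have "continuous_on (cball 0 \<bar>\<rho>\<bar>) g"
    by (rule continuous_on_subset[OF holomorphic_on_imp_continuous_on[OF assms(1)]]) (use assms in auto)
  then have "bounded (g ` cball 0 \<bar>\<rho>\<bar>)"
    by (intro compact_imp_bounded compact_continuous_image) auto
  then obtain B where "\<forall>w\<in>cball 0 \<bar>\<rho>\<bar>. cmod (g w) \<le> B"
    unfolding bounded_iff by blast
  then show ?thesis by (intro exI[of _ B]) (simp add: norm_mult)
qed

lemma disc_integrable:
  assumes "g holomorphic_on ball 0 1" "\<bar>\<rho>\<bar> < 1"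
  shows "integrable cauchyM (\<lambda>x. g (of_real \<rho> * circ x))"
proof -
  obtain B where "\<And>x. cmod (g (of_real \<rho> * circ x)) \<le> B" using disc_bounded[OF assms] by metis
  then show ?thesis by (rule integrable_cauchyM_bounded[OF disc_measurable[OF assms]])
qed

lemma disc_mean_value:
  assumes "g holomorphic_on ball 0 1" "\<bar>\<rho>\<bar> < 1"
  shows "(LINT x|cauchyM. g (of_real \<rho> * circ x)) = g 0"
proof -
  obtain a where a: "\<And>w. cmod w < 1 \<Longrightarrow> (\<lambda>n. a n * w ^ n) sums g w"
    "\<And>r. \<bar>r\<bar> < 1 \<Longrightarrow> summable (\<lambda>n. cmod (a n) * \<bar>r\<bar> ^ n)" using disc_power_series[OF assms(1)] by metis
  have "(\<lambda>n. a n * of_real \<rho> ^ n * (LINT x|cauchyM. circ x ^ n * 1)) sums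
           (LINT x|cauchyM. g (of_real \<rho> * circ x) * 1)"
    by (rule integral_disc_series[OF a assms(2), where B = 1]) auto
  moreover have "(LINT x|cauchyM. circ x ^ n * 1) = (if n = 0 then 1 else 0)" for n
    using integral_circ_power[of n] by auto
    ultimately have "(\<lambda>n. a n * of_real \<rho> ^ n * (if n = 0 then 1 else 0)) sums (LINT x|cauchyM. g (of_real \<rho> * circ x))"
      by simp
    moreover have "(\<lambda>n. a n * of_real \<rho> ^ n * (if n = 0 then 1 else 0)) = (\<lambda>n. if n = 0 then a 0 else 0)"
      by auto
    ultimately have "(\<lambda>n. if n = 0 then a 0 else 0) sums (LINT x|cauchyM. g (of_real \<rho> * circ x))" by metis
  moreover have "(\<lambda>n. if n = 0 then a 0 else 0) sums a 0"
    using sums_single[of 0 "\<lambda>_. a 0"] by (simp add: eq_commute)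
  moreover have "a 0 = g 0" using a(1)[of 0] powser_sums_zero_iff[of a "g 0"] by simp
  ultimately show ?thesis using sums_unique2 by metis
qed

text \<open>Orthonormality extracts the Taylor coefficients of the factor at radius rho'; then the
  series of the factor at radius rho is integrated term by term. Two radii are allowed because the
  distance between two circles contains their mixed product.\<close>

lemma disc_parseval:
  assumes s: "\<And>w. cmod w < 1 \<Longrightarrow> (\<lambda>n. a n * w ^ n) sums g w"
    and ab: "\<And>r. \<bar>r\<bar> < 1 \<Longrightarrow> summable (\<lambda>n. cmod (a n) * \<bar>r\<bar> ^ n)"
    and g: "g holomorphic_on ball 0 1"
    and r: "\<bar>\<rho>\<bar> < 1" "\<bar>\<rho>'\<bar> < 1"
  shows "(\<lambda>n. of_real ((cmod (a n))\<^sup>2 * (\<rho> * \<rho>') ^ n)) sums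
     (LINT x|cauchyM. g (of_real \<rho> * circ x) * cnj (g (of_real \<rho>' * circ x)))"
proof -
  have coeff: "(LINT x|cauchyM. g (of_real \<rho>' * circ x) * cnj (circ x ^ n)) = a n * of_real \<rho>' ^ n" for n
  proof -
    have "(\<lambda>m. a m * of_real \<rho>' ^ m * (LINT x|cauchyM. circ x ^ m * cnj (circ x ^ n))) sums
           (LINT x|cauchyM. g (of_real \<rho>' * circ x) * cnj (circ x ^ n))"
      by (rule integral_disc_series[OF s ab r(2), where B = 1]) (auto simp: norm_power norm_mult simp del: complex_cnj_power)
    then have "(\<lambda>m. if m = n then a m * of_real \<rho>' ^ m else 0) sums
           (LINT x|cauchyM. g (of_real \<rho>' * circ x) * cnj (circ x ^ n))"
      unfolding integral_circ_orthonormal by (simp add: if_distrib cong: if_cong)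
    then show ?thesis
      using sums_single[of n "\<lambda>m. a m * of_real \<rho>' ^ m"] sums_unique2 by blast
  qed
  obtain B where B: "\<And>x. cmod (g (of_real \<rho>' * circ x)) \<le> B" using disc_bounded[OF g r(2)] by metis
  have [measurable]: "(\<lambda>x. g (of_real \<rho>' * circ x)) \<in> borel_measurable borel"
    by (rule disc_measurable[OF g r(2)])
  have "(\<lambda>n. a n * of_real \<rho> ^ n * (LINT x|cauchyM. circ x ^ n * cnj (g (of_real \<rho>' * circ x)))) sums
           (LINT x|cauchyM. g (of_real \<rho> * circ x) * cnj (g (of_real \<rho>' * circ x)))"
    by (rule integral_disc_series[OF s ab r(1), where B = B]) (use B in auto)
  moreover have "(LINT x|cauchyM. circ x ^ n * cnj (g (of_real \<rho>' * circ x))) = cnj (a n) * of_real \<rho>' ^ n" for n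
  proof -
    have "(LINT x|cauchyM. circ x ^ n * cnj (g (of_real \<rho>' * circ x)))
        = (LINT x|cauchyM. cnj (g (of_real \<rho>' * circ x) * cnj (circ x ^ n)))"
      by (simp add: mult.commute)
    also have "\<dots> = cnj (a n * of_real \<rho>' ^ n)"
      unfolding Bochner_Integration.integral_cnj coeff ..
    finally show ?thesis by simp
  qed
  moreover have "a n * of_real \<rho> ^ n * (cnj (a n) * of_real \<rho>' ^ n) = of_real ((cmod (a n))\<^sup>2 * (\<rho> * \<rho>') ^ n)" for n
    using complex_norm_square[of "a n"] by (simp add: power_mult_distrib mult_ac)
  ultimately show ?thesis by simp
qed

lemma cmod_diff_square: "(cmod (u - v))\<^sup>2 = (cmod u)\<^sup>2 + (cmod v)\<^sup>2 - 2 * Re (u * cnj v)"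
  unfolding cmod_power2 by (simp add: power2_eq_square algebra_simps)

text \<open>With J(s) = sum |a_n|^2 s^n the squared distance is J(rho^2) + J(rho'^2) - 2 J(rho
  rho'). J is increasing and bounded by C, so all three values are close to its supremum S once the
  arguments are at least s0.\<close>

lemma hardy_cauchy:
  assumes g: "g holomorphic_on ball 0 1"
    and C: "\<And>\<rho>. 0 \<le> \<rho> \<Longrightarrow> \<rho> < 1 \<Longrightarrow> (LINT x|cauchyM. (cmod (g (of_real \<rho> * circ x)))\<^sup>2) \<le> C"
    and \<epsilon>: "\<epsilon> > 0"
  shows "\<exists>R. 0 \<le> R \<and> R < 1 \<and> (\<forall>\<rho> \<rho>'. R \<le> \<rho> \<and> \<rho> < 1 \<and> R \<le> \<rho>' \<and> \<rho>' < 1 \<longrightarrow>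
     (LINT x|cauchyM. (cmod (g (of_real \<rho> * circ x) - g (of_real \<rho>' * circ x)))\<^sup>2) \<le> \<epsilon>)"
proof -
  obtain a where a: "\<And>w. cmod w < 1 \<Longrightarrow> (\<lambda>n. a n * w ^ n) sums g w"
    "\<And>r. \<bar>r\<bar> < 1 \<Longrightarrow> summable (\<lambda>n. cmod (a n) * \<bar>r\<bar> ^ n)" using disc_power_series[OF g] by metis
  define J where "J = (\<lambda>s. \<Sum>n. (cmod (a n))\<^sup>2 * s ^ n)"
  have P: "(\<lambda>n. (cmod (a n))\<^sup>2 * (\<rho> * \<rho>') ^ n) sums J (\<rho> * \<rho>')"
    "(LINT x|cauchyM. g (of_real \<rho> * circ x) * cnj (g (of_real \<rho>' * circ x))) = of_real (J (\<rho> * \<rho>'))"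
    if "\<bar>\<rho>\<bar> < 1" "\<bar>\<rho>'\<bar> < 1" for \<rho> \<rho>'
  proof -
    note * = disc_parseval[OF a g that]
    have "summable (\<lambda>n. (cmod (a n))\<^sup>2 * (\<rho> * \<rho>') ^ n)"
      using sums_summable[OF *] by (simp only: summable_of_real_iff)
    then show "(\<lambda>n. (cmod (a n))\<^sup>2 * (\<rho> * \<rho>') ^ n) sums J (\<rho> * \<rho>')"
      unfolding J_def by (rule summable_sums)
    from sums_of_real[OF this] * 
    show "(LINT x|cauchyM. g (of_real \<rho> * circ x) * cnj (g (of_real \<rho>' * circ x))) = of_real (J (\<rho> * \<rho>'))"
      using sums_unique2 by blast
  qed
  have N: "(LINT x|cauchyM. (cmod (g (of_real \<rho> * circ x)))\<^sup>2) = J (\<rho> * \<rho>)" if "\<bar>\<rho>\<bar> < 1" for \<rho>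
  proof -
    have "of_real (LINT x|cauchyM. (cmod (g (of_real \<rho> * circ x)))\<^sup>2) = complex_of_real (J (\<rho> * \<rho>))"
      using P(2)[OF that that] by (simp flip: integral_complex_of_real complex_norm_square)
    then show ?thesis by (simp only: of_real_eq_iff)
  qed
  have Jsum: "(\<lambda>n. (cmod (a n))\<^sup>2 * s ^ n) sums J s" if "0 \<le> s" "s < 1" for s
    using P(1)[of "sqrt s" "sqrt s"] that by simp
  have JC: "J s \<le> C" if "0 \<le> s" "s < 1" for s
    using N[of "sqrt s"] C[of "sqrt s"] that by simp
  have Jmono: "J s \<le> J t" if "0 \<le> s" "s \<le> t" "t < 1" for s t
    by (rule sums_le[OF _ Jsum Jsum]) (use that in \<open>auto intro!: mult_left_mono power_mono\<close>)
  define S where "S = (SUP s\<in>{0..<1}. J s)"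
  have bdd: "bdd_above (J ` {0..<1})" using JC by (intro bdd_aboveI[of _ C]) auto
  \<comment> \<open>The slack epsilon/2 is doubled by the factor of the mixed term: the distance is
    at most 2 S - 2 (S - epsilon/2) = epsilon.\<close>
  have "S - \<epsilon> / 2 < S" using \<epsilon> by simp
  then obtain s0 where s0: "0 \<le> s0" "s0 < 1" "S - \<epsilon> / 2 < J s0"
    unfolding S_def by (subst (asm) less_cSUP_iff[OF _ bdd]) auto
  have JS: "J s \<le> S" if "0 \<le> s" "s < 1" for s
    unfolding S_def by (rule cSUP_upper[OF _ bdd]) (use that in auto)
  show ?thesis
  \<comment> \<open>Radii above sqrt s0 have pairwise products of at least s0.\<close>
  proof (intro exI[of _ "sqrt s0"] conjI allI impI; (elim conjE)?)
    fix \<rho> \<rho>' assume r: "sqrt s0 \<le> \<rho>" "\<rho> < 1" "sqrt s0 \<le> \<rho>'" "\<rho>' < 1"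
    have r0: "0 \<le> \<rho>" "0 \<le> \<rho>'" using r s0 by (meson real_sqrt_ge_zero order_trans)+
    have ab: "\<bar>\<rho>\<bar> < 1" "\<bar>\<rho>'\<bar> < 1" using r r0 by auto
    have s0le: "s0 \<le> \<rho> * \<rho>'"
      using mult_mono[OF r(1,3)] s0 r0 by simp
    have lt1: "\<rho> * \<rho>' < 1" "\<rho> * \<rho> < 1" "\<rho>' * \<rho>' < 1"
      using mult_strict_mono'[of \<rho> 1 \<rho>' 1] mult_strict_mono'[of \<rho> 1 \<rho> 1] mult_strict_mono'[of \<rho>' 1 \<rho>' 1] r r0 by simp_all
    define u where "u = (\<lambda>x. g (of_real \<rho> * circ x))"
    define v where "v = (\<lambda>x. g (of_real \<rho>' * circ x))"
    have um [measurable]: "u \<in> borel_measurable borel" and vm [measurable]: "v \<in> borel_measurable borel"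
      unfolding u_def v_def by (rule disc_measurable[OF g ab(1)] disc_measurable[OF g ab(2)])+
    obtain B1 where B1: "\<And>x. cmod (u x) \<le> B1" using disc_bounded[OF g ab(1)] unfolding u_def by metis
    obtain B2 where B2: "\<And>x. cmod (v x) \<le> B2" using disc_bounded[OF g ab(2)] unfolding v_def by metis
    have i1: "integrable cauchyM (\<lambda>x. (cmod (u x))\<^sup>2)"
      by (rule integrable_cauchyM_bounded[where B = "B1\<^sup>2"]) (auto intro!: power_mono B1)
    have i2: "integrable cauchyM (\<lambda>x. (cmod (v x))\<^sup>2)"
      by (rule integrable_cauchyM_bounded[where B = "B2\<^sup>2"]) (auto intro!: power_mono B2)
    have B1': "0 \<le> B1" using B1[of 0] norm_ge_zero order_trans by blast
    have i3: "integrable cauchyM (\<lambda>x. u x * cnj (v x))"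
      by (rule integrable_cauchyM_bounded[where B = "B1 * B2"])
         (auto intro!: mult_mono B1 B2 B1' simp: norm_mult)
    have "(LINT x|cauchyM. (cmod (u x - v x))\<^sup>2)
        = (LINT x|cauchyM. (cmod (u x))\<^sup>2) + (LINT x|cauchyM. (cmod (v x))\<^sup>2) - 2 * (LINT x|cauchyM. Re (u x * cnj (v x)))"
      unfolding cmod_diff_square
      using Bochner_Integration.integral_diff[OF Bochner_Integration.integrable_add[OF i1 i2] integrable_mult_right[OF integrable_Re[OF i3], of 2]]
        Bochner_Integration.integral_add[OF i1 i2]
      by (simp del: times_complex.sel)
    also have "\<dots> = J (\<rho> * \<rho>) + J (\<rho>' * \<rho>') - 2 * J (\<rho> * \<rho>')"
      using N[OF ab(1)] N[OF ab(2)] P(2)[OF ab] integral_Re[OF i3] unfolding u_def v_def by simp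
    also have "\<dots> \<le> S + S - 2 * (S - \<epsilon> / 2)"
      using JS[of "\<rho> * \<rho>"] JS[of "\<rho>' * \<rho>'"] s0(3) Jmono[OF s0(1) s0le lt1(1)] lt1 r0
      by simp
    finally show "(LINT x|cauchyM. (cmod (g (of_real \<rho> * circ x) - g (of_real \<rho>' * circ x)))\<^sup>2) \<le> \<epsilon>"
      unfolding u_def v_def by simp
  qed (use s0 in auto)
qed

section \<open>Almost everywhere convergence along one sequence of radii\<close>

lemma convergent_if_summable_diff:
  fixes f :: "nat \<Rightarrow> 'a::banach"
  assumes "summable (\<lambda>k. norm (f (Suc k) - f k))"
  shows "convergent f"
proof -
  have "convergent (\<lambda>n. \<Sum>k<n. f (Suc k) - f k)"
    using summable_norm_cancel[OF assms] by (simp add: summable_iff_convergent)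
  then have "convergent (\<lambda>n. (f n - f 0) + f 0)"
    unfolding sum_lessThan_telescope by (intro convergent_add convergent_const)
  then show ?thesis by simp
qed

text \<open>The weights 2^k leave the integrals of 2^k |f(k+1) - f(k)|^2 below 2^-k, hence summable.
  Almost everywhere these terms are therefore bounded in k, so the increments decay like 2^(-k/2)
  and are summable.\<close>

lemma AE_convergent_if_fast_L2_cauchy:
  fixes f :: "nat \<Rightarrow> real \<Rightarrow> complex"
  assumes [measurable]: "\<And>k. f k \<in> borel_measurable borel"
    and int: "\<And>k. integrable cauchyM (\<lambda>x. (cmod (f (Suc k) x - f k x))\<^sup>2)"
    and le: "\<And>k. (LINT x|cauchyM. (cmod (f (Suc k) x - f k x))\<^sup>2) \<le> (1/4) ^ k"
  shows "AE x in cauchyM. convergent (\<lambda>k. f k x)"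
proof -
  define d where "d = (\<lambda>k x. (cmod (f (Suc k) x - f k x))\<^sup>2)"
  have dm [measurable]: "d k \<in> borel_measurable borel" for k unfolding d_def by measurable
  have "(\<integral>\<^sup>+x. (\<Sum>k. ennreal (2 ^ k * d k x)) \<partial>cauchyM) = (\<Sum>k. \<integral>\<^sup>+x. ennreal (2 ^ k * d k x) \<partial>cauchyM)"
    by (rule nn_integral_suminf) auto
  also have "\<dots> \<le> (\<Sum>k. ennreal ((1/2) ^ k))"
  proof (rule suminf_le)
    fix k
    have "(\<integral>\<^sup>+x. ennreal (2 ^ k * d k x) \<partial>cauchyM) = ennreal (LINT x|cauchyM. 2 ^ k * d k x)"
      using int[of k] by (intro nn_integral_eq_integral) (auto simp: d_def)
    also have "\<dots> = ennreal (2 ^ k * (LINT x|cauchyM. d k x))" by simp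
    also have "\<dots> \<le> ennreal (2 ^ k * (1/4) ^ k)"
      using le[of k] by (intro ennreal_leI mult_left_mono) (auto simp: d_def)
    also have "2 ^ k * (1/4) ^ k = ((1/2) ^ k :: real)"
      by (simp flip: power_mult_distrib)
    finally show "(\<integral>\<^sup>+x. ennreal (2 ^ k * d k x) \<partial>cauchyM) \<le> ennreal ((1/2) ^ k)" .
  qed auto
  also have "\<dots> = ennreal (\<Sum>k. (1/2) ^ k)"
    by (rule suminf_ennreal2) auto
  also have "\<dots> < \<infinity>" by simp
  finally have "AE x in cauchyM. (\<Sum>k. ennreal (2 ^ k * d k x)) \<noteq> \<infinity>"
    by (intro nn_integral_PInf_AE) auto
  then show ?thesis
  proof (rule AE_mp, intro AE_I2 impI)
    fix x assume "(\<Sum>k. ennreal (2 ^ k * d k x)) \<noteq> \<infinity>"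
    then have "summable (\<lambda>k. 2 ^ k * d k x)"
      by (intro summable_suminf_not_top) (auto simp: d_def)
    then have "(\<lambda>k. 2 ^ k * d k x) \<longlonglongrightarrow> 0" by (rule summable_LIMSEQ_zero)
    then have "Bseq (\<lambda>k. 2 ^ k * d k x)" by (intro convergent_imp_Bseq convergentI)
    then obtain K where K: "K > 0" "\<And>k. norm (2 ^ k * d k x) \<le> K" by (auto elim!: BseqE)
    have "norm (f (Suc k) x - f k x) \<le> sqrt K * (sqrt (1/2)) ^ k" for k
    proof -
      have "(norm (f (Suc k) x - f k x))\<^sup>2 \<le> K * (1/2) ^ k"
        using K(2)[of k] by (simp add: d_def field_simps)
      also have "\<dots> = (sqrt K * (sqrt (1/2)) ^ k)\<^sup>2"
      proof -
        have "(sqrt (1/2) ^ k)\<^sup>2 = ((sqrt (1/2))\<^sup>2) ^ k" unfolding power_mult[symmetric] by (subst mult.commute) (rule refl)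
        moreover have "(sqrt (1/2))\<^sup>2 = (1/2::real)" "(sqrt K)\<^sup>2 = K" using K(1) by simp_all
        ultimately show ?thesis by (simp only: power_mult_distrib)
      qed
      finally show ?thesis using K(1) by (simp add: power2_le_iff_abs_le)
    qed
    note le = this
    have "summable (\<lambda>k. sqrt K * (sqrt (1/2)) ^ k)"
      by (intro summable_mult summable_geometric) (simp add: real_sqrt_lt_1_iff)
    then have "summable (\<lambda>k. norm (f (Suc k) x - f k x))"
      by (rule summable_comparison_test'[where N = 0]) (simp only: real_norm_def abs_norm_cancel le)
    then show "convergent (\<lambda>k. f k x)" by (rule convergent_if_summable_diff)
  qed
qed

lemma hardy_boundary_values:
  assumes I: "finite I" and g: "\<And>i. i \<in> I \<Longrightarrow> g i holomorphic_on ball 0 1"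
    and C: "\<And>i \<rho>. i \<in> I \<Longrightarrow> 0 \<le> \<rho> \<Longrightarrow> \<rho> < 1 \<Longrightarrow> (LINT x|cauchyM. (cmod (g i (of_real \<rho> * circ x)))\<^sup>2) \<le> C i"
  shows "\<exists>\<rho> :: nat \<Rightarrow> real. (\<forall>k. 0 < \<rho> k \<and> \<rho> k < 1) \<and> \<rho> \<longlonglongrightarrow> 1 \<and>
    (AE x in cauchyM. \<forall>i\<in>I. convergent (\<lambda>k. g i (of_real (\<rho> k) * circ x)))"
proof -
  define Q where "Q = (\<lambda>i (k::nat) R. 0 \<le> R \<and> R < 1 \<and> (\<forall>\<rho> \<rho>'. R \<le> \<rho> \<and> \<rho> < 1 \<and> R \<le> \<rho>' \<and> \<rho>' < 1 \<longrightarrow>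
     (LINT x|cauchyM. (cmod (g i (of_real \<rho> * circ x) - g i (of_real \<rho>' * circ x)))\<^sup>2) \<le> (1/4) ^ k))"
  have "\<exists>R. Q i k R" if "i \<in> I" for i k
    unfolding Q_def using hardy_cauchy[of "g i" "C i" "(1/4) ^ k", OF g[OF that] C[OF that]] by simp
  then obtain R where R: "\<And>i k. i \<in> I \<Longrightarrow> Q i k (R i k)" by metis
  \<comment> \<open>The maximum over i and over all j <= k puts \<open>R i k\<close> below both
    radii compared at step k, those with index k and k + 1, for every member of the family. The
    entry 1 - 1/(k + 2) keeps the radii positive and drives them to 1.\<close>
  define \<rho> where "\<rho> = (\<lambda>k::nat. Max (insert (1 - 1 / (real k + 2)) ((\<lambda>(i, j). R i j) ` (I \<times> {..k}))))"
  have fin: "finite (insert (1 - 1 / (real k + 2)) ((\<lambda>(i, j). R i j) ` (I \<times> {..k})))" for k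
    using I by auto
  have ge: "1 - 1 / (real k + 2) \<le> \<rho> k" for k unfolding \<rho>_def using fin by (intro Max_ge) auto
  have geR: "R i j \<le> \<rho> k" if "i \<in> I" "j \<le> k" for i j k
    unfolding \<rho>_def using fin that by (intro Max_ge) (auto intro!: rev_image_eqI[of "(i, j)"])
  have lt: "\<rho> k < 1" for k
    unfolding \<rho>_def by (subst Max_less_iff[OF fin]) (use R in \<open>auto simp: Q_def\<close>)
  have pos: "0 < \<rho> k" for k
    by (rule less_le_trans[OF _ ge]) (simp add: field_simps)
  have lim: "\<rho> \<longlonglongrightarrow> 1"
  proof (rule tendsto_sandwich[OF _ _ _ tendsto_const])
    have "(\<lambda>n. 1 / (real n + 2)) \<longlonglongrightarrow> 0" 
      by (intro tendsto_divide_0[OF tendsto_const] filterlim_at_top_imp_at_infinity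
          filterlim_tendsto_add_at_top[OF tendsto_const, of _ _ 2, simplified add.commute] filterlim_real_sequentially)
    then show "(\<lambda>n. 1 - 1 / (real n + 2)) \<longlonglongrightarrow> 1"
      using tendsto_diff[OF tendsto_const[of 1]] by fastforce
  qed (use ge lt in \<open>auto intro!: always_eventually less_imp_le\<close>)
  have "AE x in cauchyM. convergent (\<lambda>k. g i (of_real (\<rho> k) * circ x))" if i: "i \<in> I" for i
  proof (rule AE_convergent_if_fast_L2_cauchy)
    have ab: "\<bar>\<rho> k\<bar> < 1" for k using pos[of k] lt[of k] by simp
    have [measurable]: "(\<lambda>x. g i (complex_of_real (\<rho> k) * circ x)) \<in> borel_measurable borel" for k
      by (rule disc_measurable[OF g[OF i] ab])
    show "(\<lambda>x. g i (complex_of_real (\<rho> k) * circ x)) \<in> borel_measurable borel" for k by measurable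
    show "(LINT x|cauchyM. (cmod (g i (of_real (\<rho> (Suc k)) * circ x) - g i (of_real (\<rho> k) * circ x)))\<^sup>2) \<le> (1/4) ^ k" for k
      using R[OF i, of k] geR[OF i, of k k] geR[OF i, of k "Suc k"] lt unfolding Q_def by auto
    show "integrable cauchyM (\<lambda>x. (cmod (g i (of_real (\<rho> (Suc k)) * circ x) - g i (of_real (\<rho> k) * circ x)))\<^sup>2)" for k
    proof -
      obtain B1 B2 where B: "\<forall>x. cmod (g i (of_real (\<rho> (Suc k)) * circ x)) \<le> B1" "\<forall>x. cmod (g i (of_real (\<rho> k) * circ x)) \<le> B2"
        using disc_bounded[OF g[OF i] ab] by metis
      show ?thesis
      proof (rule integrable_cauchyM_bounded)
        fix x show "norm ((cmod (g i (of_real (\<rho> (Suc k)) * circ x) - g i (of_real (\<rho> k) * circ x)))\<^sup>2) \<le> (B1 + B2)\<^sup>2"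
          using norm_triangle_ineq4[of "g i (of_real (\<rho> (Suc k)) * circ x)" "g i (of_real (\<rho> k) * circ x)"]
            B(1)[rule_format, of x] B(2)[rule_format, of x] by (auto intro!: power_mono)
      qed measurable
    qed
  qed
  then show ?thesis
    using pos lt lim I by (intro exI[of _ \<rho>] conjI) (auto intro!: AE_finite_allI)
qed

section \<open>Herglotz functions in the upper half-plane\<close>

lemma cay_holomorphic_compose:
  assumes "F holomorphic_on {z. Im z > 0}"
  shows "(\<lambda>w. F (cay w)) holomorphic_on ball 0 1"
proof -
  have "cay ` ball 0 1 \<subseteq> {z. Im z > 0}" using Im_cay_pos by auto
  from holomorphic_on_compose_gen[OF holomorphic_cay assms this] show ?thesis by (simp add: o_def)
qed

text \<open>For the logarithm g one has |g|^2 = Re (g^2) + 2 (Im g)^2. The mean of Re (g^2) over a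
  circle is its value at the centre, and |Im g| <= pi, which bounds the L^2 norms on all circles.
  Exponentiating the limits returns to F.\<close>

lemma herglotz_boundary_values:
  assumes I: "finite I" and F: "\<And>i. i \<in> I \<Longrightarrow> F i holomorphic_on {z. Im z > 0}"
    and pos: "\<And>i z. i \<in> I \<Longrightarrow> Im z > 0 \<Longrightarrow> Im (F i z) > 0"
  shows "\<exists>\<rho> :: nat \<Rightarrow> real. (\<forall>k. 0 < \<rho> k \<and> \<rho> k < 1) \<and> \<rho> \<longlonglongrightarrow> 1 \<and>
    (AE x in lborel. \<forall>i\<in>I. convergent (\<lambda>k. F i (zpt (\<rho> k) x)))"
proof -
  define g where "g = (\<lambda>i w. Ln (F i (cay w)))"
  have hol: "g i holomorphic_on ball 0 1" if "i \<in> I" for i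
    unfolding g_def
  proof (rule holomorphic_on_Ln'[OF _ cay_holomorphic_compose[OF F[OF that]]])
    fix w :: complex assume "w \<in> ball 0 1"
    then show "F i (cay w) \<notin> \<real>\<^sub>\<le>\<^sub>0"
      using pos[OF that Im_cay_pos[of w]] by (auto simp: complex_nonpos_Reals_iff)
  qed
  have Imle: "\<bar>Im (g i w)\<bar> \<le> pi" if "i \<in> I" "cmod w < 1" for i w
  proof -
    have "F i (cay w) \<noteq> 0" using pos[OF that(1) Im_cay_pos[OF that(2)]] by auto
    then show ?thesis
      using mpi_less_Im_Ln Im_Ln_le_pi by (auto simp: g_def abs_le_iff less_imp_le)
         (metis less_eq_real_def minus_le_iff mpi_less_Im_Ln)
  qed
  have bd: "(LINT x|cauchyM. (cmod (g i (of_real \<rho> * circ x)))\<^sup>2) \<le> Re ((g i 0)\<^sup>2) + 2 * pi\<^sup>2"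
    if i: "i \<in> I" and r: "0 \<le> \<rho>" "\<rho> < 1" for i \<rho>
  proof -
    have ab: "\<bar>\<rho>\<bar> < 1" using r by simp
    have hol2: "(\<lambda>w. (g i w)\<^sup>2) holomorphic_on ball 0 1" by (intro holomorphic_intros hol i)
    have i1: "integrable cauchyM (\<lambda>x. (g i (of_real \<rho> * circ x))\<^sup>2)"
      by (rule disc_integrable[OF hol2 ab])
    have "(LINT x|cauchyM. (cmod (g i (of_real \<rho> * circ x)))\<^sup>2)
       \<le> (LINT x|cauchyM. Re ((g i (of_real \<rho> * circ x))\<^sup>2) + 2 * pi\<^sup>2)"
    proof (rule integral_mono)
      show "integrable cauchyM (\<lambda>x. (cmod (g i (of_real \<rho> * circ x)))\<^sup>2)"
        using integrable_norm[OF i1] by (simp add: norm_power)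
      show "integrable cauchyM (\<lambda>x. Re ((g i (of_real \<rho> * circ x))\<^sup>2) + 2 * pi\<^sup>2)"
        by (intro Bochner_Integration.integrable_add integrable_Re i1 finite_measure.integrable_const finite_measure_cauchyM)
      fix x
      have "(Im (g i (of_real \<rho> * circ x)))\<^sup>2 \<le> pi\<^sup>2"
        using Imle[OF i norm_rho_circ[OF ab, of x]] by (intro abs_le_square_iff[THEN iffD1]) auto
      then show "(cmod (g i (of_real \<rho> * circ x)))\<^sup>2 \<le> Re ((g i (of_real \<rho> * circ x))\<^sup>2) + 2 * pi\<^sup>2"
        unfolding cmod_power2 by (simp add: power2_eq_square)
    qed
    also have "\<dots> = (LINT x|cauchyM. Re ((g i (of_real \<rho> * circ x))\<^sup>2)) + 2 * pi\<^sup>2"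
      using integrable_Re[OF i1] finite_measure.integrable_const[OF finite_measure_cauchyM]
      by (subst Bochner_Integration.integral_add) auto
    also have "(LINT x|cauchyM. Re ((g i (of_real \<rho> * circ x))\<^sup>2)) = Re ((g i 0)\<^sup>2)"
      unfolding integral_Re[OF i1] disc_mean_value[OF hol2 ab] ..
    finally show ?thesis .
  qed
  obtain \<rho> :: "nat \<Rightarrow> real" where \<rho>: "\<forall>k. 0 < \<rho> k \<and> \<rho> k < 1" "\<rho> \<longlonglongrightarrow> 1"
    "AE x in cauchyM. \<forall>i\<in>I. convergent (\<lambda>k. g i (of_real (\<rho> k) * circ x))"
    using hardy_boundary_values[of I g, OF I hol bd] by blast
  have "convergent (\<lambda>k. F i (zpt (\<rho> k) x))" if c: "convergent (\<lambda>k. g i (of_real (\<rho> k) * circ x))" and i: "i \<in> I" for i x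
  proof -
    obtain L where "(\<lambda>k. g i (of_real (\<rho> k) * circ x)) \<longlonglongrightarrow> L" using c by (auto simp: convergent_def)
    then have "(\<lambda>k. exp (g i (of_real (\<rho> k) * circ x))) \<longlonglongrightarrow> exp L" by (rule tendsto_exp)
    moreover have "exp (g i (of_real (\<rho> k) * circ x)) = F i (zpt (\<rho> k) x)" for k
    proof -
      have "cmod (of_real (\<rho> k) * circ x) < 1" using norm_rho_circ[of "\<rho> k" x] \<rho>(1)[rule_format, of k] by linarith
      then have "F i (zpt (\<rho> k) x) \<noteq> 0"
        using pos[OF i Im_cay_pos, of "of_real (\<rho> k) * circ x"] unfolding zpt_def by auto
      then show ?thesis by (simp add: g_def zpt_def exp_Ln)
    qed
    ultimately show ?thesis by (auto simp: convergent_def)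
  qed
  note conv = this
  have "AE x in cauchyM. \<forall>i\<in>I. convergent (\<lambda>k. F i (zpt (\<rho> k) x))"
    by (rule AE_mp[OF \<rho>(3)], intro AE_I2 impI ballI) (blast intro: conv)
  then show ?thesis using \<rho> by (auto simp: AE_cauchyM_iff)
qed

lemma measurable_zpt:
  assumes "F holomorphic_on {z. Im z > 0}" "\<bar>\<rho>\<bar> < 1"
  shows "(\<lambda>x. F (zpt \<rho> x)) \<in> borel_measurable borel"
  using disc_measurable[OF cay_holomorphic_compose[OF assms(1)] assms(2)] by (simp add: zpt_def)

lemma herglotz_mean_value:
  assumes F: "F holomorphic_on {z. Im z > 0}" and pos: "\<And>z. Im z > 0 \<Longrightarrow> Im (F z) \<ge> 0"
    and r: "\<bar>\<rho>\<bar> < 1"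
  shows "(\<integral>\<^sup>+x. ennreal (Im (F (zpt \<rho> x))) \<partial>cauchyM) = ennreal (Im (F \<i>))"
proof -
  note h = cay_holomorphic_compose[OF F]
  have i: "integrable cauchyM (\<lambda>x. F (zpt \<rho> x))"
    using disc_integrable[OF h r] by (simp add: zpt_def)
  have "(\<integral>\<^sup>+x. ennreal (Im (F (zpt \<rho> x))) \<partial>cauchyM) = ennreal (LINT x|cauchyM. Im (F (zpt \<rho> x)))"
    by (intro nn_integral_eq_integral integrable_Im i) (use pos Im_zpt_pos[OF r] in auto)
  also have "(LINT x|cauchyM. Im (F (zpt \<rho> x))) = Im (F \<i>)"
    using integral_Im[OF i] disc_mean_value[OF h r] by (simp add: zpt_def)
  finally show ?thesis .
qed

section \<open>Poisson integrals\<close>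

text \<open>The Poisson kernel in disc coordinates, stripped of a factor: for s = rsig rho, (1 +
  x^2) kap s x t is Im (1 / (t - zpt rho x)). Without the factor it is symmetric in x and t, which
  allows integration in either variable.\<close>

definition kap :: "real \<Rightarrow> real \<Rightarrow> real \<Rightarrow> real" where
  "kap s x t = s / ((t - x)\<^sup>2 + s\<^sup>2 * (1 + t * x)\<^sup>2)"

text \<open>This is the imaginary part of \<open>zpt \<rho> 0\<close>, a height that tends to 0 with
  1 - rho.\<close>

definition rsig :: "real \<Rightarrow> real" where "rsig \<rho> = (1 - \<rho>) / (1 + \<rho>)"

lemma kap_sym: "kap s x t = kap s t x"
  by (simp add: kap_def power2_commute mult.commute)

lemma rsig_pos: "0 < \<rho> \<Longrightarrow> \<rho> < 1 \<Longrightarrow> 0 < rsig \<rho>"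
  by (simp add: rsig_def)

lemma kap_nonneg: "0 \<le> s \<Longrightarrow> 0 \<le> kap s x t"
  by (simp add: kap_def)

lemma zpt_eq:
  assumes "0 < \<rho>"
  shows "zpt \<rho> x = (of_real x + \<i> * of_real (rsig \<rho>)) / (1 - \<i> * of_real (rsig \<rho>) * of_real x)"
proof -
  have nz: "complex_of_real x + \<i> \<noteq> 0" by (rule of_real_plus_i_nz)
  have r1: "complex_of_real (1 + \<rho>) \<noteq> 0" using assms by (simp only: of_real_eq_0_iff)
  define S where "S = complex_of_real (rsig \<rho>)"
  have S: "complex_of_real (1 + \<rho>) * S = complex_of_real (1 - \<rho>)"
    unfolding S_def of_real_mult[symmetric] using assms by (simp add: rsig_def)
  have "zpt \<rho> x = \<i> * ((of_real x + \<i>) + of_real \<rho> * (of_real x - \<i>)) / ((of_real x + \<i>) - of_real \<rho> * (of_real x - \<i>))"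
    unfolding zpt_def cay_def circ_def using nz by (simp add: divide_simps)
  also have "(of_real x + \<i>) + of_real \<rho> * (of_real x - \<i>) = complex_of_real (1 + \<rho>) * (of_real x + \<i> * S)"
    unfolding distrib_left mult.left_commute[of _ \<i>] S by (simp add: algebra_simps)
  also have "(of_real x + \<i>) - of_real \<rho> * (of_real x - \<i>) = complex_of_real (1 + \<rho>) * (\<i> * (1 - \<i> * S * of_real x))"
  proof -
    have "complex_of_real (1 + \<rho>) * (\<i> * (1 - \<i> * S * of_real x)) = complex_of_real (1 + \<rho>) * \<i> + (complex_of_real (1 + \<rho>) * S) * of_real x"
      by (simp add: algebra_simps)
    then show ?thesis unfolding S by (simp add: algebra_simps)
  qed
  finally show ?thesis using r1 unfolding S_def by (simp add: mult.assoc del: of_real_add)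
qed

lemma Im_inverse_diff_zpt:
  assumes "0 < \<rho>" "\<rho> < 1"
  shows "Im (1 / (of_real t - zpt \<rho> x)) = (1 + x\<^sup>2) * kap (rsig \<rho>) x t"
proof -
  define s where "s = rsig \<rho>"
  have s: "s > 0" unfolding s_def using assms by (rule rsig_pos)
  have n1: "1 - \<i> * of_real s * of_real x \<noteq> 0" by (simp add: complex_eq_iff)
  have "of_real t - zpt \<rho> x = Complex (t - x) (- s * (1 + t * x)) / (1 - \<i> * of_real s * of_real x)"
    unfolding zpt_eq[OF assms(1)] s_def[symmetric] using n1 
    by (simp add: divide_simps) (simp add: complex_eq_iff algebra_simps)
  then have "1 / (of_real t - zpt \<rho> x) = (1 - \<i> * of_real s * of_real x) / Complex (t - x) (- s * (1 + t * x))"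
    by simp
  also have "Im \<dots> = (s * (1 + t * x) - s * x * (t - x)) / ((t - x)\<^sup>2 + (s * (1 + t * x))\<^sup>2)"
    by (simp add: Im_divide algebra_simps power2_eq_square)
  also have "s * (1 + t * x) - s * x * (t - x) = (1 + x\<^sup>2) * s" by (simp add: algebra_simps power2_eq_square)
  finally show ?thesis unfolding s_def by (simp add: kap_def power_mult_distrib)
qed

lemma kap_measurable [measurable]:
  assumes [measurable]: "f \<in> borel_measurable M" "g \<in> borel_measurable M"
  shows "(\<lambda>x. kap s (f x) (g x)) \<in> borel_measurable M"
  unfolding kap_def by measurable

text \<open>For fixed t this is the mean value property of z to 1 / (t - z), with value Im (1 / (t -
  i)) at the centre.\<close>

lemma kap_total:
  assumes "0 < \<rho>" "\<rho> < 1"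
  shows "(\<integral>\<^sup>+x. ennreal ((1 + x\<^sup>2) * kap (rsig \<rho>) x t) \<partial>cauchyM) = ennreal (1 / (1 + t\<^sup>2))"
proof -
  have nz: "of_real t - z \<noteq> 0" if "Im z > 0" for z using that by (auto simp: complex_eq_iff)
  have "(\<integral>\<^sup>+x. ennreal (Im (1 / (of_real t - zpt \<rho> x))) \<partial>cauchyM) = ennreal (Im (1 / (of_real t - \<i>)))"
  proof (rule herglotz_mean_value)
    show "(\<lambda>z. 1 / (of_real t - z)) holomorphic_on {z. 0 < Im z}"
      by (intro holomorphic_intros) (use nz in auto)
    show "0 \<le> Im (1 / (complex_of_real t - z))" if "0 < Im z" for z
      using that by (simp add: Im_divide)
  qed (use assms in auto)
  then show ?thesis
    unfolding Im_inverse_diff_zpt[OF assms] by (simp add: Im_divide add.commute)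
qed

text \<open>Away from t the kernel is of order s uniformly in x, even for large x, because the
  factor 1 + x^2 is dominated by a multiple of (t - x)^2 plus a constant.\<close>

lemma kap_tail_bound:
  assumes "0 < s" "0 < \<delta>" "\<delta> \<le> \<bar>x - t\<bar>"
  shows "(1 + x\<^sup>2) * kap s x t \<le> s * (2 + (1 + 2 * t\<^sup>2) / \<delta>\<^sup>2)"
proof -
  have d2: "\<delta>\<^sup>2 \<le> (t - x)\<^sup>2" using assms by (intro abs_le_square_iff[THEN iffD1]) auto
  have pos: "0 < (t - x)\<^sup>2" using d2 assms by (meson less_le_trans zero_less_power)
  have "kap s x t \<le> s / (t - x)\<^sup>2"
    unfolding kap_def using assms pos by (intro divide_left_mono) (auto intro!: mult_pos_pos add_pos_nonneg)
  then have "(1 + x\<^sup>2) * kap s x t \<le> (1 + x\<^sup>2) * (s / (t - x)\<^sup>2)"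
    by (intro mult_left_mono) auto
  \<comment> \<open>The difference of the two sides is (x - 2 t)^2.\<close>
  also have "1 + x\<^sup>2 \<le> 2 * (t - x)\<^sup>2 + (1 + 2 * t\<^sup>2)"
    using sum_squares_ge_zero[of "x - 2 * t" 0] by (simp add: power2_eq_square algebra_simps)
  then have "(1 + x\<^sup>2) * (s / (t - x)\<^sup>2) \<le> (2 * (t - x)\<^sup>2 + (1 + 2 * t\<^sup>2)) * (s / (t - x)\<^sup>2)"
    using assms by (intro mult_right_mono) auto
  also have "\<dots> = s * (2 + (1 + 2 * t\<^sup>2) / (t - x)\<^sup>2)"
    using pos by (simp add: field_simps)
  also have "\<dots> \<le> s * (2 + (1 + 2 * t\<^sup>2) / \<delta>\<^sup>2)"
    using assms pos d2 by (intro mult_left_mono add_left_mono divide_left_mono) auto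
  finally show ?thesis .
qed

lemma rsig_tendsto:
  assumes "\<rho> \<longlonglongrightarrow> 1" shows "(\<lambda>k. rsig (\<rho> k)) \<longlonglongrightarrow> 0"
proof -
  have "(\<lambda>k. (1 - \<rho> k) / (1 + \<rho> k)) \<longlonglongrightarrow> (1 - 1) / (1 + 1)" by (intro tendsto_intros assms) auto
  then show ?thesis by (simp add: rsig_def)
qed

text \<open>The total mass is 1 / (1 + t^2) by \<open>kap_total\<close>, and the part outside a ball
  about t is at most a constant times \<open>rsig (\<rho> k)\<close>, which vanishes in the
  limit.\<close>

lemma kap_liminf_open:
  assumes \<rho>: "\<And>k. 0 < \<rho> k \<and> \<rho> k < 1" "\<rho> \<longlonglongrightarrow> 1" and U: "open U" "t \<in> U"
  shows "ennreal (1 / (1 + t\<^sup>2)) \<le> liminf (\<lambda>k. \<integral>\<^sup>+x. ennreal ((1 + x\<^sup>2) * kap (rsig (\<rho> k)) x t) * indicator U x \<partial>cauchyM)"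
proof -
  obtain \<delta> where \<delta>: "\<delta> > 0" "ball t \<delta> \<subseteq> U" using U open_contains_ball by blast
  have Um [measurable]: "U \<in> sets borel" using U by simp
  define B where "B = 2 + (1 + 2 * t\<^sup>2) / \<delta>\<^sup>2"
  have B: "B \<ge> 0" unfolding B_def by simp
  have ge: "ennreal (1 / (1 + t\<^sup>2) - rsig (\<rho> k) * B) \<le> (\<integral>\<^sup>+x. ennreal ((1 + x\<^sup>2) * kap (rsig (\<rho> k)) x t) * indicator U x \<partial>cauchyM)"
    (is "_ \<le> ?I") for k
  proof -
    have s: "rsig (\<rho> k) > 0" using \<rho>(1) rsig_pos by blast
    have "ennreal (1 / (1 + t\<^sup>2)) = (\<integral>\<^sup>+x. ennreal ((1 + x\<^sup>2) * kap (rsig (\<rho> k)) x t) \<partial>cauchyM)"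
      using kap_total \<rho>(1) by simp
    also have "\<dots> \<le> (\<integral>\<^sup>+x. ennreal ((1 + x\<^sup>2) * kap (rsig (\<rho> k)) x t) * indicator U x + ennreal (rsig (\<rho> k) * B) \<partial>cauchyM)"
    proof (rule nn_integral_mono)
      fix x show "ennreal ((1 + x\<^sup>2) * kap (rsig (\<rho> k)) x t) \<le> ennreal ((1 + x\<^sup>2) * kap (rsig (\<rho> k)) x t) * indicator U x + ennreal (rsig (\<rho> k) * B)"
      proof (cases "x \<in> U")
        case False
        then have "\<delta> \<le> \<bar>x - t\<bar>" using \<delta> by (force simp: dist_real_def)
        from kap_tail_bound[OF s \<delta>(1) this] show ?thesis using False by (simp add: B_def ennreal_leI)
      qed simp
    qed
    also have "\<dots> = ?I + ennreal (rsig (\<rho> k) * B)"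
      by (subst nn_integral_add) (auto simp: emeasure_cauchyM)
    finally have "ennreal (1 / (1 + t\<^sup>2)) - ennreal (rsig (\<rho> k) * B) \<le> ?I"
      by (simp add: ennreal_minus_le_iff add.commute)
    then show ?thesis using s B by (simp add: ennreal_minus)
  qed
  have "(\<lambda>k. ennreal (1 / (1 + t\<^sup>2) - rsig (\<rho> k) * B)) \<longlonglongrightarrow> ennreal (1 / (1 + t\<^sup>2) - 0 * B)"
    by (intro tendsto_ennrealI tendsto_intros rsig_tendsto \<rho>(2))
  then have "ennreal (1 / (1 + t\<^sup>2)) = liminf (\<lambda>k. ennreal (1 / (1 + t\<^sup>2) - rsig (\<rho> k) * B))"
    by (simp add: lim_imp_Liminf)
  also have "\<dots> \<le> liminf (\<lambda>k. \<integral>\<^sup>+x. ennreal ((1 + x\<^sup>2) * kap (rsig (\<rho> k)) x t) * indicator U x \<partial>cauchyM)"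
    by (intro Liminf_mono always_eventually allI ge)
  finally show ?thesis .
qed

text \<open>Outer regularity of the measure with density q carries the inequality from open sets to
  E = {q < p}, where it forces the integral of p - q to vanish. The bound on q makes that measure
  finite, so the subtraction is legitimate.\<close>

lemma AE_le_if_open_integral_le:
  fixes p q :: "real \<Rightarrow> ennreal"
  assumes [measurable]: "p \<in> borel_measurable borel" "q \<in> borel_measurable borel"
    and qb: "\<And>x. q x \<le> ennreal m"
    and le: "\<And>U. open U \<Longrightarrow> (\<integral>\<^sup>+x. p x * indicator U x \<partial>cauchyM) \<le> (\<integral>\<^sup>+x. q x * indicator U x \<partial>cauchyM)"
  shows "AE x in cauchyM. p x \<le> q x"
proof -
  have fin: "(\<integral>\<^sup>+x. q x * indicator A x \<partial>cauchyM) < \<infinity>" for A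
  proof -
    have "(\<integral>\<^sup>+x. q x * indicator A x \<partial>cauchyM) \<le> (\<integral>\<^sup>+x. ennreal m \<partial>cauchyM)"
      by (rule nn_integral_mono) (auto simp: qb split: split_indicator)
    also have "\<dots> < \<infinity>" by (simp add: emeasure_cauchyM ennreal_mult_less_top)
    finally show ?thesis .
  qed
  have em: "emeasure (density cauchyM f) A = (\<integral>\<^sup>+x. f x * indicator A x \<partial>cauchyM)"
    if "f \<in> borel_measurable borel" "A \<in> sets borel" for f A
    using that by (subst emeasure_density) auto
  define E where "E = {x. q x < p x}"
  have [measurable]: "E \<in> sets borel" unfolding E_def by measurable
  have "emeasure (density cauchyM p) E \<le> emeasure (density cauchyM q) E"
  proof -
    have "emeasure (density cauchyM q) E = (INF U \<in> {U. E \<subseteq> U \<and> open U}. emeasure (density cauchyM q) U)"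
      by (rule outer_regular) (use fin[of UNIV] in \<open>auto simp: em\<close>)
    also have "\<dots> \<ge> emeasure (density cauchyM p) E"
    proof (rule INF_greatest)
      fix U assume "U \<in> {U. E \<subseteq> U \<and> open U}"
      then have U: "E \<subseteq> U" "open U" by auto
      have "emeasure (density cauchyM p) E \<le> emeasure (density cauchyM p) U"
        using U by (intro emeasure_mono) auto
      also have "\<dots> \<le> emeasure (density cauchyM q) U" using le[OF U(2)] U(2) by (simp add: em)
      finally show "emeasure (density cauchyM p) E \<le> emeasure (density cauchyM q) U" .
    qed
    finally show ?thesis .
  qed
  then have leE: "(\<integral>\<^sup>+x. p x * indicator E x \<partial>cauchyM) \<le> (\<integral>\<^sup>+x. q x * indicator E x \<partial>cauchyM)"
    by (simp add: em)
  have "(\<integral>\<^sup>+x. p x * indicator E x - q x * indicator E x \<partial>cauchyM) =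
      (\<integral>\<^sup>+x. p x * indicator E x \<partial>cauchyM) - (\<integral>\<^sup>+x. q x * indicator E x \<partial>cauchyM)"
    using fin[of E] by (intro nn_integral_diff) (auto simp: E_def split: split_indicator)
  also have "\<dots> = 0" using leE le_less_trans[OF leE fin[of E]] by (simp add: diff_eq_0_iff_ennreal)
  finally have "AE x in cauchyM. p x * indicator E x - q x * indicator E x = 0"
    by (subst (asm) nn_integral_0_iff_AE) auto
  then show ?thesis
  proof (rule AE_mp, intro AE_I2 impI)
    fix x assume *: "p x * indicator E x - q x * indicator E x = 0"
    show "p x \<le> q x"
    proof (rule ccontr)
      assume "\<not> p x \<le> q x"
      then have "x \<in> E" "q x < p x" by (auto simp: E_def)
      then have "p x - q x = 0" using * by simp
      moreover have "q x < top" using le_less_trans[OF qb[of x] ennreal_less_top] .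
      ultimately show False using \<open>q x < p x\<close> by (cases "p x = top") (auto simp: diff_eq_0_iff_ennreal less_top)
    qed
  qed
qed

text \<open>Only a lower bound for the boundary values of a Poisson integral is needed; reverse Fatou
  on open sets and outer regularity give it along any sequence of radii.\<close>

lemma poisson_boundary_ge:
  fixes p :: "real \<Rightarrow> real"
  assumes \<rho>: "\<And>k. 0 < \<rho> k \<and> \<rho> k < 1" "\<rho> \<longlonglongrightarrow> 1"
    and [measurable]: "p \<in> borel_measurable borel" and p: "\<And>x. 0 \<le> p x" "\<And>x. p x \<le> m"
  shows "AE x in cauchyM. ennreal (p x) \<le>
    limsup (\<lambda>k. \<integral>\<^sup>+t. ennreal (Im (1 / (of_real t - zpt (\<rho> k) x)) / pi * p t) \<partial>lborel)"
proof -
  define q where "q = (\<lambda>k x. \<integral>\<^sup>+t. ennreal ((1 + x\<^sup>2) * kap (rsig (\<rho> k)) x t / pi * p t) \<partial>lborel)"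
  have q_eq: "q k x = (\<integral>\<^sup>+t. ennreal (Im (1 / (of_real t - zpt (\<rho> k) x)) / pi * p t) \<partial>lborel)" for k x
    unfolding q_def using Im_inverse_diff_zpt \<rho>(1) by simp
  have s: "rsig (\<rho> k) > 0" for k using \<rho>(1) rsig_pos by blast
  have kn: "0 \<le> kap (rsig (\<rho> k)) x t" for k x t using s[of k] by (simp add: kap_nonneg)
  have m: "0 \<le> m" using p order_trans by blast
  have qm [measurable]: "q k \<in> borel_measurable borel" for k
    unfolding q_def by measurable
  \<comment> \<open>Exchanging x and t in \<open>kap\<close> turns the integral over t into a total
    mass. The uniform bound m is the dominating function for reverse Fatou below.\<close>
  have q_le: "q k x \<le> ennreal m" for k x
  proof -
    have "q k x \<le> (\<integral>\<^sup>+t. ennreal (m * (1 + x\<^sup>2)) * (ennreal (1 / (pi * (1 + t\<^sup>2))) * ennreal ((1 + t\<^sup>2) * kap (rsig (\<rho> k)) t x)) \<partial>lborel)"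
      unfolding q_def
    proof (rule nn_integral_mono)
      fix t
      have "(1 + x\<^sup>2) * kap (rsig (\<rho> k)) x t / pi * p t \<le> (1 + x\<^sup>2) * kap (rsig (\<rho> k)) x t / pi * m"
        using p kn by (intro mult_left_mono) auto
      also have "\<dots> = (m * (1 + x\<^sup>2)) * ((1 / (pi * (1 + t\<^sup>2))) * ((1 + t\<^sup>2) * kap (rsig (\<rho> k)) t x))"
        using one_plus_sq_pos[of t] by (simp add: kap_sym[of _ x t])
      finally show "ennreal ((1 + x\<^sup>2) * kap (rsig (\<rho> k)) x t / pi * p t) \<le> ennreal (m * (1 + x\<^sup>2)) * (ennreal (1 / (pi * (1 + t\<^sup>2))) * ennreal ((1 + t\<^sup>2) * kap (rsig (\<rho> k)) t x))"
        using m kn[of k t x] by (simp add: ennreal_mult'[symmetric] ennreal_mult''[symmetric] ennreal_leI)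
    qed
    also have "\<dots> = ennreal (m * (1 + x\<^sup>2)) * (\<integral>\<^sup>+t. ennreal ((1 + t\<^sup>2) * kap (rsig (\<rho> k)) t x) \<partial>cauchyM)"
      by (subst nn_integral_cmult) (auto simp: nn_integral_cauchyM)
    also have "\<dots> = ennreal (m * (1 + x\<^sup>2)) * ennreal (1 / (1 + x\<^sup>2))"
      using kap_total \<rho>(1) by simp
    also have "\<dots> = ennreal m"
      using m one_plus_sq_pos[of x] by (simp flip: ennreal_mult'')
    finally show ?thesis .
  qed
  have "AE x in cauchyM. ennreal (p x) \<le> limsup (\<lambda>k. q k x)"
  proof (rule AE_le_if_open_integral_le[where m = m])
    show "limsup (\<lambda>k. q k x) \<le> ennreal m" for x
      by (rule Limsup_bounded) (simp add: q_le)
    fix U :: "real set" assume U: "open U"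
    have [measurable]: "U \<in> sets borel" using U by simp
    define I where "I = (\<lambda>k t. \<integral>\<^sup>+x. ennreal ((1 + x\<^sup>2) * kap (rsig (\<rho> k)) x t) * indicator U x \<partial>cauchyM)"
    interpret C: finite_measure cauchyM by (rule finite_measure_cauchyM)
    have Im [measurable]: "I k \<in> borel_measurable borel" for k
      unfolding I_def by measurable
    interpret LC: pair_sigma_finite lborel cauchyM ..
    have swap: "(\<integral>\<^sup>+x. q k x * indicator U x \<partial>cauchyM) = (\<integral>\<^sup>+t. ennreal (p t / pi) * I k t \<partial>lborel)" for k
    proof -
      have "(\<integral>\<^sup>+x. q k x * indicator U x \<partial>cauchyM) = (\<integral>\<^sup>+x. (\<integral>\<^sup>+t. ennreal ((1 + x\<^sup>2) * kap (rsig (\<rho> k)) x t / pi * p t) * indicator U x \<partial>lborel) \<partial>cauchyM)"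
        unfolding q_def by (intro nn_integral_cong nn_integral_multc[symmetric]) measurable
      also have "\<dots> = (\<integral>\<^sup>+t. (\<integral>\<^sup>+x. ennreal ((1 + x\<^sup>2) * kap (rsig (\<rho> k)) x t / pi * p t) * indicator U x \<partial>cauchyM) \<partial>lborel)"
        by (rule LC.Fubini') measurable
      also have "\<dots> = (\<integral>\<^sup>+t. ennreal (p t / pi) * I k t \<partial>lborel)"
      proof (rule nn_integral_cong)
        fix t
        have "(\<integral>\<^sup>+x. ennreal ((1 + x\<^sup>2) * kap (rsig (\<rho> k)) x t / pi * p t) * indicator U x \<partial>cauchyM)
           = (\<integral>\<^sup>+x. ennreal (p t / pi) * (ennreal ((1 + x\<^sup>2) * kap (rsig (\<rho> k)) x t) * indicator U x) \<partial>cauchyM)"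
          using p kn by (intro nn_integral_cong) (auto simp: ennreal_mult'[symmetric] mult_ac split: split_indicator)
        also have "\<dots> = ennreal (p t / pi) * I k t" unfolding I_def by (rule nn_integral_cmult) measurable
        finally show "(\<integral>\<^sup>+x. ennreal ((1 + x\<^sup>2) * kap (rsig (\<rho> k)) x t / pi * p t) * indicator U x \<partial>cauchyM) = ennreal (p t / pi) * I k t" .
      qed
      finally show ?thesis .
    qed
    \<comment> \<open>Fatou in t uses the concentration of the kernel on U; after Fubini, reverse
      Fatou in x moves the upper limit inside the integral.\<close>
    have "(\<integral>\<^sup>+x. ennreal (p x) * indicator U x \<partial>cauchyM) = (\<integral>\<^sup>+t. ennreal (p t / pi) * (ennreal (1 / (1 + t\<^sup>2)) * indicator U t) \<partial>lborel)"
      by (subst nn_integral_cauchyM, measurable, intro nn_integral_cong)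
         (use p in \<open>auto simp: ennreal_mult'[symmetric] mult_ac split: split_indicator\<close>)
    also have "\<dots> \<le> (\<integral>\<^sup>+t. liminf (\<lambda>k. ennreal (p t / pi) * I k t) \<partial>lborel)"
    proof (rule nn_integral_mono)
      fix t
      have "ennreal (1 / (1 + t\<^sup>2)) * indicator U t \<le> liminf (\<lambda>k. I k t)"
        using kap_liminf_open[OF \<rho> U, of t] unfolding I_def by (auto split: split_indicator)
      then have "ennreal (p t / pi) * (ennreal (1 / (1 + t\<^sup>2)) * indicator U t) \<le> ennreal (p t / pi) * liminf (\<lambda>k. I k t)"
        by (rule mult_left_mono) simp
      also have "\<dots> = liminf (\<lambda>k. ennreal (p t / pi) * I k t)"
        by (rule Liminf_compose_continuous_mono[symmetric])
           (auto intro!: monoI mult_left_mono ennreal_continuous_on_cmult continuous_on_id)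
      finally show "ennreal (p t / pi) * (ennreal (1 / (1 + t\<^sup>2)) * indicator U t) \<le> liminf (\<lambda>k. ennreal (p t / pi) * I k t)" .
    qed
    also have "\<dots> \<le> liminf (\<lambda>k. \<integral>\<^sup>+t. ennreal (p t / pi) * I k t \<partial>lborel)"
      by (rule nn_integral_liminf) measurable
    also have "\<dots> = liminf (\<lambda>k. \<integral>\<^sup>+x. q k x * indicator U x \<partial>cauchyM)" by (simp add: swap)
    also have "\<dots> \<le> limsup (\<lambda>k. \<integral>\<^sup>+x. q k x * indicator U x \<partial>cauchyM)" by (rule Liminf_le_Limsup) simp
    also have "\<dots> \<le> (\<integral>\<^sup>+x. limsup (\<lambda>k. q k x * indicator U x) \<partial>cauchyM)"
      by (rule nn_integral_limsup[where w = "\<lambda>x. ennreal m"])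
         (auto simp: q_le emeasure_cauchyM split: split_indicator)
    also have "\<dots> = (\<integral>\<^sup>+x. limsup (\<lambda>k. q k x) * indicator U x \<partial>cauchyM)"
      by (intro nn_integral_cong) (auto simp: Limsup_const split: split_indicator)
    finally show "(\<integral>\<^sup>+x. ennreal (p x) * indicator U x \<partial>cauchyM) \<le> (\<integral>\<^sup>+x. limsup (\<lambda>k. q k x) * indicator U x \<partial>cauchyM)" .
  qed measurable
  then show ?thesis unfolding q_eq .
qed

section \<open>Singular values\<close>

lemma linear_coeff_zero:
  fixes b c :: real
  assumes "\<And>t. 2 * t * b + t\<^sup>2 * c \<le> 0"
  shows "b = 0"
proof (rule ccontr)
  assume b: "b \<noteq> 0"
  \<comment> \<open>At t = b / M the linear term is 2 b^2 / M, and the quadratic one takes away at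
    most b^2 / M.\<close>
  define M where "M = \<bar>c\<bar> + 1"
  have M: "M > 0" "- c \<le> M" unfolding M_def by auto
  have "2 * (b / M) * b + (b / M)\<^sup>2 * c \<le> 0" by (rule assms)
  moreover have "2 * (b / M) * b + (b / M)\<^sup>2 * c \<ge> 2 * (b / M) * b - (b / M)\<^sup>2 * M"
    using mult_left_mono[OF M(2), of "(b / M)\<^sup>2"] by (simp add: algebra_simps)
  moreover have "2 * (b / M) * b - (b / M)\<^sup>2 * M = b\<^sup>2 / M"
    using M by (simp add: field_simps power2_eq_square)
  moreover have "b\<^sup>2 / M > 0" using b M by simp
  ultimately show False by linarith
qed

text \<open>A maximiser x of the quadratic form on the unit sphere of S has vanishing first
  variation, so f x is orthogonal to every vector of S that is orthogonal to x.\<close>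

lemma selfadjoint_eigenvector:
  fixes f :: "'a::euclidean_space \<Rightarrow> 'a"
  assumes lin: "linear f" and sa: "\<And>x y. f x \<bullet> y = x \<bullet> f y"
    and S: "subspace S" "\<And>x. x \<in> S \<Longrightarrow> f x \<in> S" "S \<noteq> {0}"
  shows "\<exists>x\<in>S. norm x = 1 \<and> (\<exists>\<mu>. f x = \<mu> *\<^sub>R x)"
proof -
  have cf: "continuous_on A f" for A using lin by (rule linear_continuous_on_compose[OF continuous_on_id, simplified])
  have comp: "compact (sphere 0 1 \<inter> S)" by (intro compact_Int_closed compact_sphere closed_subspace S)
  obtain y where y: "y \<in> S" "y \<noteq> 0" using S subspace_0 by blast
  have ne: "sphere 0 1 \<inter> S \<noteq> {}"
  proof -
    have "(1 / norm y) *\<^sub>R y \<in> sphere 0 1 \<inter> S"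
      using y subspace_scale[OF S(1) y(1), of "1 / norm y"] by simp
    then show ?thesis by blast
  qed
  obtain x where x: "x \<in> sphere 0 1 \<inter> S" and max: "\<And>y. y \<in> sphere 0 1 \<inter> S \<Longrightarrow> y \<bullet> f y \<le> x \<bullet> f x"
    using continuous_attains_sup[OF comp ne, of "\<lambda>x. x \<bullet> f x"] cf by (force intro: continuous_intros)
  define l where "l = x \<bullet> f x"
  have xx: "x \<bullet> x = 1" "x \<in> S" using x by (auto simp: dot_square_norm)
  have bound: "v \<bullet> f v \<le> l * (v \<bullet> v)" if v: "v \<in> S" for v
  proof (cases "v = 0")
    case True then show ?thesis using linear_0[OF lin] by simp
  next
    case False
    define u where "u = (1 / norm v) *\<^sub>R v"
    have "u \<in> sphere 0 1 \<inter> S" using False v subspace_scale[OF S(1)] by (auto simp: u_def)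
    then have "u \<bullet> f u \<le> l" using max by (simp add: l_def)
    moreover have "u \<bullet> f u = (v \<bullet> f v) / (norm v)\<^sup>2"
      by (simp add: u_def linear_scale[OF lin] power2_eq_square)
    ultimately show ?thesis using False by (simp add: dot_square_norm field_simps)
  qed
  have orth: "f x \<bullet> y = 0" if y: "y \<in> S" "x \<bullet> y = 0" for y
  proof (rule linear_coeff_zero)
    fix t
    have "(x + t *\<^sub>R y) \<bullet> f (x + t *\<^sub>R y) \<le> l * ((x + t *\<^sub>R y) \<bullet> (x + t *\<^sub>R y))"
      using xx y by (intro bound subspace_add subspace_scale S)
    moreover have "(x + t *\<^sub>R y) \<bullet> f (x + t *\<^sub>R y) = l + 2 * t * (f x \<bullet> y) + t\<^sup>2 * (y \<bullet> f y)"
      using sa[of x y] by (simp add: linear_add[OF lin] linear_scale[OF lin] inner_add l_def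
          power2_eq_square algebra_simps inner_commute)
    moreover have "(x + t *\<^sub>R y) \<bullet> (x + t *\<^sub>R y) = 1 + t\<^sup>2 * (y \<bullet> y)"
      using xx y by (simp add: inner_add inner_commute power2_eq_square algebra_simps)
    ultimately have "l + 2 * t * (f x \<bullet> y) + t\<^sup>2 * (y \<bullet> f y) \<le> l * (1 + t\<^sup>2 * (y \<bullet> y))"
      by (simp only:)
    then show "2 * t * (f x \<bullet> y) + t\<^sup>2 * (y \<bullet> f y - l * (y \<bullet> y)) \<le> 0"
      by (simp add: algebra_simps)
  qed
  \<comment> \<open>d lies in S and is orthogonal to x by the choice of l. Hence it is orthogonal to
    f x as well, and so to itself.\<close>
  define d where "d = f x - l *\<^sub>R x"
  have dS: "d \<in> S" unfolding d_def using xx S by (intro subspace_diff subspace_scale) auto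
  have xd: "x \<bullet> d = 0" unfolding d_def using xx by (simp add: inner_diff l_def)
  have "d \<bullet> d = f x \<bullet> d - l * (x \<bullet> d)" unfolding d_def by (simp add: inner_diff algebra_simps)
  then have "d = 0" using orth[OF dS xd] xd by simp
  then show ?thesis using x xx unfolding d_def by auto
qed

text \<open>Induction on the dimension: the complement of an eigenvector inside S is again invariant
  under f and strictly smaller.\<close>

lemma selfadjoint_eigenbasis_subspace:
  fixes f :: "'a::euclidean_space \<Rightarrow> 'a"
  assumes lin: "linear f" and sa: "\<And>x y. f x \<bullet> y = x \<bullet> f y"
  shows "subspace S \<Longrightarrow> (\<And>x. x \<in> S \<Longrightarrow> f x \<in> S) \<Longrightarrow>
    \<exists>B\<subseteq>S. pairwise orthogonal B \<and> (\<forall>x\<in>B. norm x = 1 \<and> (\<exists>\<mu>. f x = \<mu> *\<^sub>R x)) \<and> S \<subseteq> span B"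
proof (induction "dim S" arbitrary: S rule: less_induct)
  case less
  show ?case
  proof (cases "S = {0}")
    case True then show ?thesis by (intro exI[of _ "{}"]) auto
  next
    case False
    obtain x \<mu> where x: "x \<in> S" "norm x = 1" "f x = \<mu> *\<^sub>R x"
      using selfadjoint_eigenvector[OF lin sa less(2,3) False] by auto
    have xx: "x \<bullet> x = 1" using x by (simp add: dot_square_norm)
    define S' where "S' = {y \<in> S. x \<bullet> y = 0}"
    have sub: "subspace S'" using less(2) unfolding S'_def subspace_def by (auto simp: inner_add)
    have inv: "f y \<in> S'" if "y \<in> S'" for y
      using that less(3) sa[of x y] x by (auto simp: S'_def)
    have "x \<notin> span S'" using sub xx by (auto simp: S'_def span_eq_iff[THEN iffD2])
    moreover have "x \<in> span S" using x by (simp add: span_base)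
    moreover have "span S' \<subseteq> span S" by (rule span_mono) (auto simp: S'_def)
    ultimately have "dim S' < dim S" by (intro dim_psubset) auto
    from less(1)[OF this sub inv] obtain B where B: "B \<subseteq> S'" "pairwise orthogonal B"
      "\<forall>x\<in>B. norm x = 1 \<and> (\<exists>\<mu>. f x = \<mu> *\<^sub>R x)" "S' \<subseteq> span B" by auto
    have "S \<subseteq> span (insert x B)"
    proof
      fix y assume y: "y \<in> S"
      have "y - (x \<bullet> y) *\<^sub>R x \<in> S'"
        using y x xx less(2) by (auto simp: S'_def inner_diff intro!: subspace_diff subspace_scale)
      then have "y - (x \<bullet> y) *\<^sub>R x \<in> span B" using B by auto
      then show "y \<in> span (insert x B)" by (auto simp: span_insert)
    qed
    moreover have "pairwise orthogonal (insert x B)"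
      using B by (auto simp: pairwise_insert S'_def orthogonal_def inner_commute)
    ultimately show ?thesis
      using x B by (intro exI[of _ "insert x B"]) (auto simp: S'_def)
  qed
qed

lemma symmetric_matrix_eigenbasis:
  fixes G :: "real^'n^'n"
  assumes "transpose G = G"
  shows "\<exists>(e :: 'n \<Rightarrow> real^'n) \<mu>. (\<forall>i j. e i \<bullet> e j = (if i = j then 1 else 0)) \<and> (\<forall>i. G *v e i = \<mu> i *\<^sub>R e i)"
proof -
  have sa: "(G *v x) \<bullet> y = x \<bullet> (G *v y)" for x y
    by (metis assms dot_lmul_matrix vector_transpose_matrix)
  obtain B where B: "pairwise orthogonal B" "\<forall>x\<in>B. norm x = 1 \<and> (\<exists>\<mu>. G *v x = \<mu> *\<^sub>R x)" "UNIV \<subseteq> span B"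
    using selfadjoint_eigenbasis_subspace[OF matrix_vector_mul_linear[of G] sa, of UNIV] by auto
  have ind: "independent B" using B by (intro pairwise_orthogonal_independent) auto
  have card: "card B = CARD('n)"
    using basis_card_eq_dim[OF _ B(3) ind] by simp
  obtain e :: "'n \<Rightarrow> real^'n" where e: "bij_betw e UNIV B"
    using finite_same_card_bij[of "UNIV :: 'n set" B] card independent_imp_finite[OF ind] by auto
  then have eB: "e i \<in> B" and inj: "inj e" for i by (auto simp: bij_betw_def)
  have "e i \<bullet> e j = (if i = j then 1 else 0)" for i j
  proof (cases "i = j")
    case True then show ?thesis using B(2) eB[of j] by (simp add: dot_square_norm)
  next
    case False
    then show ?thesis using B(1) eB inj_eq[OF inj] by (auto simp: pairwise_def orthogonal_def)
  qed
  moreover have "\<forall>i. \<exists>m. G *v e i = m *\<^sub>R e i" using B(2) eB by blast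
  then obtain \<mu> where "\<forall>i. G *v e i = \<mu> i *\<^sub>R e i" by metis
  ultimately show ?thesis by blast
qed

lemma orthonormal_expansion:
  fixes e :: "'n \<Rightarrow> real^'n"
  assumes "\<forall>i j. e i \<bullet> e j = (if i = j then 1 else 0)"
  shows "x = (\<Sum>j\<in>UNIV. (e j \<bullet> x) *\<^sub>R e j)"
proof -
  define d where "d = x - (\<Sum>j\<in>UNIV. (e j \<bullet> x) *\<^sub>R e j)"
  have inj: "inj e" using assms by (auto simp: inj_def) (metis zero_neq_one)
  have nz: "0 \<notin> range e"
  proof
    assume "0 \<in> range e"
    then obtain i where "e i = 0" by (metis imageE)
    then show False using assms[rule_format, of i i] by simp
  qed
  have "independent (range e)"
    by (rule pairwise_orthogonal_independent)
       (use assms nz in \<open>auto simp: pairwise_def orthogonal_def\<close>)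
  then have "span (range e) = UNIV"
    using card_image[OF inj] by (metis dim_eq_card dim_eq_full DIM_cart DIM_real mult.right_neutral)
  then have "d \<in> span (range e)" by simp
  moreover have "orthogonal d y" if y: "y \<in> range e" for y
  proof -
    obtain i where i: "y = e i" using y by blast
    have "(\<Sum>j\<in>UNIV. (e j \<bullet> x) * (e j \<bullet> e i)) = e i \<bullet> x"
      by (subst assms[rule_format]) (simp add: if_distrib cong: if_cong)
    then show ?thesis
      unfolding d_def orthogonal_def i inner_diff_left inner_sum_left inner_scaleR_left
      by (simp add: inner_commute)
  qed
  ultimately have "orthogonal d d" by (rule orthogonal_to_span)
  then show ?thesis by (simp add: d_def orthogonal_def)
qed

text \<open>The constant polynomial matrix P of eigenvectors intertwines C = X I - G with a diagonal
  matrix, C P = P L. Its determinant is nonzero and cancels in the integral domain of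
  polynomials.\<close>

lemma charpoly_eigenbasis:
  fixes G :: "real^'n^'n" and e :: "'n \<Rightarrow> real^'n"
  assumes e: "\<forall>i j. e i \<bullet> e j = (if i = j then 1 else 0)" and G: "\<forall>i. G *v e i = \<mu> i *\<^sub>R e i"
  shows "charpoly G = (\<Prod>i\<in>UNIV. [:- \<mu> i, 1:])"
proof -
  define P :: "real poly^'n^'n" where "P = (\<chi> i j. [:e j $ i:])"
  define C :: "real poly^'n^'n" where "C = (\<chi> i j. (if i = j then [:0, 1:] else 0) - [:G $ i $ j:])"
  define L :: "real poly^'n^'n" where "L = (\<chi> i j. if i = j then [:- \<mu> i, 1:] else 0)"
  have "transpose P ** P = mat 1"
  proof -
    have "(\<Sum>k\<in>UNIV. [:e i $ k:] * [:e j $ k:]) = (if i = j then 1 else 0)" for i j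
    proof -
      have "(\<Sum>k\<in>UNIV. [:e i $ k:] * [:e j $ k:]) = [:\<Sum>k\<in>UNIV. e i $ k * e j $ k:]"
        by (simp add: sum_to_poly[symmetric] mult.commute)
      then show ?thesis using e[rule_format, of i j] by (simp add: inner_vec_def)
    qed
    then show ?thesis by (simp add: matrix_matrix_mult_def transpose_def P_def mat_def)
  qed
  then have "det (transpose P) * det P = 1" by (metis det_I det_mul)
  then have nz: "det P \<noteq> 0" by auto
  have "C ** P = P ** L"
  proof -
    have "(\<Sum>k\<in>UNIV. C $ i $ k * P $ k $ j) = (\<Sum>k\<in>UNIV. P $ i $ k * L $ k $ j)" for i j
    proof -
      have "(\<Sum>k\<in>UNIV. C $ i $ k * P $ k $ j) = (\<Sum>k\<in>UNIV. (if i = k then [:0, 1:] * P $ k $ j else 0) - [:G $ i $ k * e j $ k:])"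
        by (intro sum.cong) (auto simp: C_def P_def algebra_simps)
      also have "\<dots> = [:0, 1:] * P $ i $ j - [:\<Sum>k\<in>UNIV. G $ i $ k * e j $ k:]"
        by (simp add: sum_subtractf sum_to_poly)
      also have "(\<Sum>k\<in>UNIV. G $ i $ k * e j $ k) = \<mu> j * e j $ i"
        using arg_cong[OF G[rule_format, of j], of "\<lambda>v. v $ i"] by (simp add: matrix_vector_mult_def)
      also have "[:0, 1:] * P $ i $ j - [:\<mu> j * e j $ i:] = P $ i $ j * [:- \<mu> j, 1:]"
        by (simp add: P_def)
      also have "\<dots> = (\<Sum>k\<in>UNIV. P $ i $ k * L $ k $ j)"
        by (simp add: L_def if_distrib cong: if_cong)
      finally show ?thesis .
    qed
    then show ?thesis by (simp add: matrix_matrix_mult_def)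
  qed
  then have "det C * det P = det P * det L" by (metis det_mul)
  then have "det C = det L" using nz by simp
  also have "det L = (\<Prod>i\<in>UNIV. [:- \<mu> i, 1:])"
    by (subst det_diagonal) (auto simp: L_def)
  finally show ?thesis by (simp add: charpoly_def C_def)
qed


section \<open>Singular values and quadratic forms\<close>

lemma gram_eigs_desc_eq:
  fixes A :: "real^'n^'n" and e :: "'n \<Rightarrow> real^'n"
  assumes "\<forall>i j. e i \<bullet> e j = (if i = j then 1 else 0)" "\<forall>i. (transpose A ** A) *v e i = \<mu> i *\<^sub>R e i"
  shows "mset (gram_eigs_desc A) = image_mset \<mu> (mset_set UNIV)" "sorted (rev (gram_eigs_desc A))"
proof -
  have "proots (charpoly (transpose A ** A)) = (\<Sum>i\<in>UNIV. proots [:- \<mu> i, 1:])"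
    unfolding charpoly_eigenbasis[OF assms] by (rule proots_prod) auto
  also have "\<dots> = image_mset \<mu> (mset_set UNIV)"
  proof -
    have "(\<Sum>i\<in>I. proots [:- \<mu> i, 1:]) = image_mset \<mu> (mset_set I)" if "finite I" for I
      using that by (induction I rule: finite_induct) auto
    then show ?thesis by simp
  qed
  finally show "mset (gram_eigs_desc A) = image_mset \<mu> (mset_set UNIV)"
    by (simp add: gram_eigs_desc_def)
  show "sorted (rev (gram_eigs_desc A))" by (simp add: gram_eigs_desc_def)
qed

text \<open>One half of the min-max principle: T is spanned by the eigenvectors of the Gram matrix
  whose eigenvalue is at least the k-th largest. Ties can make its dimension exceed k.\<close>

lemma sv_subspace:
  fixes A :: "real^'n^'n"
  assumes k: "1 \<le> k" "k \<le> CARD('n)"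
  shows "\<exists>T. subspace T \<and> dim T \<ge> k \<and> (\<forall>b\<in>T. (sv k A)\<^sup>2 * (b \<bullet> b) \<le> (A *v b) \<bullet> (A *v b))"
proof -
  define G where "G = transpose A ** A"
  have "transpose G = G" unfolding G_def by (simp add: matrix_transpose_mul)
  from symmetric_matrix_eigenbasis[OF this] obtain e :: "'n \<Rightarrow> real^'n" and \<mu>
    where e: "\<forall>i j. e i \<bullet> e j = (if i = j then 1 else 0)" and G: "\<forall>i. G *v e i = \<mu> i *\<^sub>R e i" by blast
  have AG: "(A *v b) \<bullet> (A *v b) = b \<bullet> (G *v b)" for b
    unfolding G_def by (metis dot_lmul_matrix matrix_vector_mul_assoc vector_transpose_matrix inner_commute)
  define xs where "xs = gram_eigs_desc A"
  have xs: "mset xs = image_mset \<mu> (mset_set UNIV)" "sorted (rev xs)"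
    using gram_eigs_desc_eq[OF e G[unfolded G_def]] unfolding xs_def by auto
  have len: "length xs = CARD('n)" using arg_cong[OF xs(1), of size] by simp
  define v where "v = xs ! (k - 1)"
  define J where "J = {j. \<mu> j \<ge> v}"
  \<comment> \<open>As an eigenvalue of the Gram matrix v has the form |A e|^2, so it is nonnegative
    and squaring undoes the square root in \<open>sv\<close>.\<close>
  have "v \<in># mset xs" unfolding v_def using k len by (simp add: in_set_conv_nth) (metis One_nat_def Suc_le_eq diff_less less_le_trans zero_less_one)
  then obtain j0 where "v = \<mu> j0" unfolding xs(1) by auto
  moreover have "\<mu> j0 = (A *v e j0) \<bullet> (A *v e j0)" using AG[of "e j0"] G e by simp
  ultimately have v0: "v \<ge> 0" by simp
  then have sv2: "(sv k A)\<^sup>2 = v" unfolding sv_def v_def xs_def by simp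
  have cJ: "card J \<ge> k"
  proof -
    have "card J = size (filter_mset (\<lambda>y. y \<ge> v) (mset xs))"
      unfolding xs(1) J_def by (simp add: filter_mset_image_mset)
    also have "\<dots> = length (filter (\<lambda>y. y \<ge> v) xs)" by (metis mset_filter size_mset)
    also have "\<dots> = card {i. i < length xs \<and> xs ! i \<ge> v}" by (rule length_filter_conv_card)
    also have "\<dots> \<ge> card {..<k}"
    proof (rule card_mono)
      show "{..<k} \<subseteq> {i. i < length xs \<and> v \<le> xs ! i}"
      proof
        fix i assume "i \<in> {..<k}"
        then have i: "i \<le> k - 1" "i < length xs" "k - 1 < length xs" using k len by auto
        have "rev xs ! (length xs - Suc (k - 1)) \<le> rev xs ! (length xs - Suc i)"
          by (rule sorted_nth_mono[OF xs(2)]) (use i in auto)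
        then have "xs ! (k - 1) \<le> xs ! i" using i by (simp add: rev_nth)
        then show "i \<in> {i. i < length xs \<and> v \<le> xs ! i}" using i by (simp add: v_def)
      qed
    qed auto
    finally show ?thesis by simp
  qed
  define T where "T = span (e ` J)"
  have inj: "inj_on e J" using e by (auto simp: inj_on_def) (metis zero_neq_one)
  have "0 \<notin> e ` J"
  proof
    assume "0 \<in> e ` J"
    then obtain i where "e i = 0" by (metis imageE)
    then show False using e[rule_format, of i i] by simp
  qed
  then have "independent (e ` J)"
    by (intro pairwise_orthogonal_independent) (use e in \<open>auto simp: pairwise_def orthogonal_def\<close>)
  then have "dim T = card J" unfolding T_def by (simp add: dim_eq_card_independent card_image[OF inj])
  moreover have "v * (b \<bullet> b) \<le> b \<bullet> (G *v b)" if b: "b \<in> T" for b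
  proof -
    have z: "e j \<bullet> b = 0" if "j \<notin> J" for j
    proof -
      have "orthogonal (e j) b"
        using b unfolding T_def by (rule orthogonal_to_span) (use e that in \<open>auto simp: orthogonal_def\<close>)
      then show ?thesis by (simp add: orthogonal_def)
    qed
    note ex = orthonormal_expansion[OF e, of b]
    have "b \<bullet> b = b \<bullet> (\<Sum>j\<in>UNIV. (e j \<bullet> b) *\<^sub>R e j)" using ex by simp
    also have "\<dots> = (\<Sum>j\<in>UNIV. (e j \<bullet> b)\<^sup>2)"
      by (simp add: inner_sum_right power2_eq_square inner_commute)
    finally have bb: "b \<bullet> b = (\<Sum>j\<in>UNIV. (e j \<bullet> b)\<^sup>2)" .
    have "G *v b = G *v (\<Sum>j\<in>UNIV. (e j \<bullet> b) *\<^sub>R e j)" using ex by simp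
    also have "\<dots> = (\<Sum>j\<in>UNIV. (e j \<bullet> b) *\<^sub>R (\<mu> j *\<^sub>R e j))"
      using G by (simp add: linear_sum[OF matrix_vector_mul_linear] linear_scale[OF matrix_vector_mul_linear] o_def)
    finally have "b \<bullet> (G *v b) = (\<Sum>j\<in>UNIV. \<mu> j * (e j \<bullet> b)\<^sup>2)"
      by (simp add: inner_sum_right power2_eq_square inner_commute mult_ac)
    moreover have "(\<Sum>j\<in>UNIV. v * (e j \<bullet> b)\<^sup>2) \<le> (\<Sum>j\<in>UNIV. \<mu> j * (e j \<bullet> b)\<^sup>2)"
    proof (rule sum_mono)
      fix j show "v * (e j \<bullet> b)\<^sup>2 \<le> \<mu> j * (e j \<bullet> b)\<^sup>2"
        by (cases "j \<in> J") (auto simp: z J_def intro!: mult_right_mono)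
    qed
    ultimately show ?thesis by (simp add: bb sum_distrib_left)
  qed
  ultimately show ?thesis using cJ sv2 AG by (intro exI[of _ T]) (auto simp: T_def subspace_span)
qed

text \<open>c minimises the form, so its first variation in the direction Q c vanishes, and that
  variation is a multiple of |Q c|^2.\<close>

lemma psd_kernel:
  fixes Q :: "real^'n^'n"
  assumes sym: "transpose Q = Q" and psd: "\<And>c. 0 \<le> c \<bullet> (Q *v c)" and z: "c \<bullet> (Q *v c) = 0"
  shows "Q *v c = 0"
proof -
  have sa: "(Q *v x) \<bullet> y = x \<bullet> (Q *v y)" for x y
    by (metis sym dot_lmul_matrix vector_transpose_matrix)
  have "- ((Q *v c) \<bullet> (Q *v c)) = 0"
  proof (rule linear_coeff_zero)
    fix t
    define y where "y = Q *v c"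
    have "0 \<le> (c + t *\<^sub>R y) \<bullet> (Q *v (c + t *\<^sub>R y))" by (rule psd)
    also have "\<dots> = 2 * t * (y \<bullet> y) + t\<^sup>2 * (y \<bullet> (Q *v y))"
      using z sa[of c y]
      by (simp add: matrix_vector_right_distrib matrix_vector_mult_scaleR inner_add y_def[symmetric]
          power2_eq_square algebra_simps)
    finally show "2 * t * - ((Q *v c) \<bullet> (Q *v c)) + t\<^sup>2 * - ((Q *v c) \<bullet> (Q *v (Q *v c))) \<le> 0"
      by (simp add: y_def)
  qed
  then show ?thesis by simp
qed

text \<open>The sum is tr (A Q A^T). On the complement B of the kernel, of dimension at least k, Q
  is bounded below by q > 0. The space T from \<open>sv_subspace\<close> has complementary dimension
  plus one, so it meets B in a unit vector b, and |A b|^2 is the sum of the squares (row . b)^2. The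
  constant q depends on Q alone, so it serves the solution matrices at all sites at once.\<close>

lemma sv_le_trace_quadratic:
  fixes Q :: "real^'n^'n"
  assumes sym: "transpose Q = Q" and psd: "\<And>c. 0 \<le> c \<bullet> (Q *v c)"
    and ker: "dim {c. Q *v c = 0} + k \<le> CARD('n)" and k: "1 \<le> k"
  shows "\<exists>q>0. \<forall>A :: real^'n^'n. q * (sv (CARD('n) - k + 1) A)\<^sup>2 \<le> (\<Sum>i\<in>UNIV. row i A \<bullet> (Q *v row i A))"
proof -
  have sa: "(Q *v x) \<bullet> y = x \<bullet> (Q *v y)" for x y
    by (metis sym dot_lmul_matrix vector_transpose_matrix)
  define K where "K = {c. Q *v c = 0}"
  have subK: "subspace K"
    unfolding K_def by (rule linear_subspace_kernel[OF matrix_vector_mul_linear])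
  define B where "B = {y. \<forall>x\<in>K. orthogonal x y}"
  have dB: "dim B + dim K = CARD('n)"
    using dim_subspace_orthogonal_to_vectors[OF subK subspace_UNIV] by (simp add: B_def)
  have subB: "subspace B" unfolding B_def by (auto simp: subspace_def orthogonal_def inner_add)
  have "dim B \<noteq> 0" using dB ker k unfolding K_def by linarith
  then obtain y where y: "y \<in> B" "y \<noteq> 0" unfolding dim_eq_0 by blast
  have ne: "sphere 0 1 \<inter> B \<noteq> {}"
  proof -
    have "(1 / norm y) *\<^sub>R y \<in> sphere 0 1 \<inter> B"
      using y subspace_scale[OF subB y(1), of "1 / norm y"] by simp
    then show ?thesis by blast
  qed
  have comp: "compact (sphere 0 1 \<inter> B)" by (intro compact_Int_closed compact_sphere closed_subspace subB)
  obtain b0 where b0: "b0 \<in> sphere 0 1 \<inter> B" and min: "\<forall>b\<in>sphere 0 1 \<inter> B. b0 \<bullet> (Q *v b0) \<le> b \<bullet> (Q *v b)"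
    using continuous_attains_inf[OF comp ne, of "\<lambda>x. x \<bullet> (Q *v x)"]
    by (force intro!: continuous_intros linear_continuous_on_compose[OF continuous_on_id matrix_vector_mul_linear, simplified])
  define q where "q = b0 \<bullet> (Q *v b0)"
  \<comment> \<open>If the minimum over the compact sphere were 0, its minimiser would lie in the
    kernel K and in the orthogonal complement of K.\<close>
  have "q \<noteq> 0"
  proof
    assume "q = 0"
    then have "b0 \<in> K" using psd_kernel[OF sym psd] by (simp add: K_def q_def)
    then have "orthogonal b0 b0" using b0 by (auto simp: B_def)
    then show False using b0 by (auto simp: orthogonal_def)
  qed
  then have q: "q > 0" using psd[of b0] by (simp add: q_def)
  have qB: "q * (b \<bullet> b) \<le> b \<bullet> (Q *v b)" if b: "b \<in> B" for b
  proof (cases "b = 0")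
    case False
    define u where "u = (1 / norm b) *\<^sub>R b"
    have "u \<in> sphere 0 1 \<inter> B" using False b subspace_scale[OF subB] by (auto simp: u_def)
    then have "q \<le> u \<bullet> (Q *v u)" using min by (simp add: q_def)
    moreover have "u \<bullet> (Q *v u) = (b \<bullet> (Q *v b)) / (norm b)\<^sup>2"
      by (simp add: u_def matrix_vector_mult_scaleR power2_eq_square)
    ultimately show ?thesis using False by (simp add: dot_square_norm field_simps)
  qed simp
  have "q * (sv (CARD('n) - k + 1) A)\<^sup>2 \<le> (\<Sum>i\<in>UNIV. row i A \<bullet> (Q *v row i A))" for A :: "real^'n^'n"
  proof -
    have kl: "k \<le> CARD('n)" using ker by simp
    obtain T where T: "subspace T" "dim T \<ge> CARD('n) - k + 1"
      "\<And>b. b \<in> T \<Longrightarrow> (sv (CARD('n) - k + 1) A)\<^sup>2 * (b \<bullet> b) \<le> (A *v b) \<bullet> (A *v b)"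
    proof -
      have "1 \<le> CARD('n) - k + 1" "CARD('n) - k + 1 \<le> CARD('n)" using k kl by linarith+
      from sv_subspace[OF this, of A] show ?thesis using that by blast
    qed
    have "dim {x + y |x y. x \<in> T \<and> y \<in> B} + dim (T \<inter> B) = dim T + dim B"
      by (rule dim_sums_Int[OF T(1) subB])
    moreover have "dim {x + y |x y. x \<in> T \<and> y \<in> B} \<le> CARD('n)"
      using dim_subset_UNIV[of "{x + y |x y. x \<in> T \<and> y \<in> B}"] by simp
    ultimately have "dim (T \<inter> B) \<noteq> 0" using T(2) dB ker kl unfolding K_def by linarith
    then obtain b' where b': "b' \<in> T" "b' \<in> B" "b' \<noteq> 0" unfolding dim_eq_0 by blast
    define b where "b = (1 / norm b') *\<^sub>R b'"
    have b: "b \<in> T" "b \<in> B" "norm b = 1" "b \<bullet> b = 1"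
      using b' subspace_scale T(1) subB by (auto simp: b_def dot_square_norm[of b', unfolded power2_eq_square])
    \<comment> \<open>The component of the row in K affects neither side, since b is orthogonal to K
      and Q kills K. For the component in B it is Cauchy-Schwarz with |b| = 1.\<close>
    have row: "q * (row i A \<bullet> b)\<^sup>2 \<le> row i A \<bullet> (Q *v row i A)" for i
    proof -
      obtain a1 a2 where a: "row i A = a1 + a2" "a1 \<in> span K" "\<And>w. w \<in> span K \<Longrightarrow> orthogonal a2 w"
        using orthogonal_subspace_decomp_exists[of K "row i A"] by metis
      have a1: "a1 \<in> K" using a(2) subK by (simp add: span_eq_iff[THEN iffD2])
      have a2: "a2 \<in> B" using a(3) by (auto simp: B_def orthogonal_commute span_base)
      have "Q *v a1 = 0" using a1 by (simp add: K_def)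
      then have "row i A \<bullet> (Q *v row i A) = a2 \<bullet> (Q *v a2)"
        using sa[of a1 a2] by (simp add: a(1) matrix_vector_right_distrib inner_add)
      moreover have "row i A \<bullet> b = a2 \<bullet> b" using a1 b(2) by (simp add: a(1) B_def inner_add orthogonal_def)
      moreover have "(a2 \<bullet> b)\<^sup>2 \<le> a2 \<bullet> a2" using Cauchy_Schwarz_ineq[of a2 b] b by simp
      then have "q * (a2 \<bullet> b)\<^sup>2 \<le> q * (a2 \<bullet> a2)" using q by (intro mult_left_mono) auto
      ultimately show ?thesis using qB[OF a2] by simp
    qed
    have "q * (sv (CARD('n) - k + 1) A)\<^sup>2 \<le> q * ((A *v b) \<bullet> (A *v b))"
      using T(3)[OF b(1)] b q by simp
    also have "(A *v b) \<bullet> (A *v b) = (\<Sum>i\<in>UNIV. (row i A \<bullet> b)\<^sup>2)"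
      by (simp add: inner_vec_def matrix_vector_mult_def row_def power2_eq_square)
    also have "q * \<dots> = (\<Sum>i\<in>UNIV. q * (row i A \<bullet> b)\<^sup>2)" by (rule sum_distrib_left)
    also have "\<dots> \<le> (\<Sum>i\<in>UNIV. row i A \<bullet> (Q *v row i A))" by (intro sum_mono row)
    finally show ?thesis .
  qed
  then show ?thesis using q by blast
qed

section \<open>Kernels of real and complex matrices\<close>

definition cm :: "real^'n^'m \<Rightarrow> complex^'n^'m" where "cm A = (\<chi> i j. of_real (A $ i $ j))"
definition cv :: "real^'n \<Rightarrow> complex^'n" where "cv c = (\<chi> i. of_real (c $ i))"
definition re_part :: "complex^'n \<Rightarrow> real^'n" where "re_part y = (\<chi> i. Re (y $ i))"
definition im_part :: "complex^'n \<Rightarrow> real^'n" where "im_part y = (\<chi> i. Im (y $ i))"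

lemma cm_nth [simp]: "cm A $ i $ j = of_real (A $ i $ j)" by (simp add: cm_def)
lemma cv_nth [simp]: "cv c $ i = of_real (c $ i)" by (simp add: cv_def)
lemma re_part_nth [simp]: "re_part y $ i = Re (y $ i)" by (simp add: re_part_def)
lemma im_part_nth [simp]: "im_part y $ i = Im (y $ i)" by (simp add: im_part_def)

lemma cm_mult_parts:
  "re_part (cm A *v y) = A *v re_part y" "im_part (cm A *v y) = A *v im_part y"
  by (simp_all add: vec_eq_iff matrix_vector_mult_def Re_sum Im_sum)

lemma cvec_eq_0_iff: "y = 0 \<longleftrightarrow> re_part y = 0 \<and> im_part y = 0"
  by (auto simp: vec_eq_iff complex_eq_iff)

lemma cm_mult_eq_0_iff: "cm A *v y = 0 \<longleftrightarrow> A *v re_part y = 0 \<and> A *v im_part y = 0"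
  unfolding cvec_eq_0_iff[of "cm A *v y"] cm_mult_parts ..

text \<open>The w_i are complex while c is real, so dimensions are counted twice. Written as pairs
  of real and imaginary parts, w_i and i w_i are 2 k real independent vectors in V x V, where V is
  the orthogonal complement of the annihilator. Hence k <= dim V.\<close>

lemma dim_annihilator_le:
  fixes w :: "nat \<Rightarrow> complex^'n"
  assumes ind: "\<And>\<beta> :: nat \<Rightarrow> complex. (\<Sum>i<k. \<beta> i *s w i) = 0 \<Longrightarrow> \<forall>i<k. \<beta> i = 0"
  shows "dim {c :: real^'n. \<forall>i<k. (\<Sum>a\<in>UNIV. of_real (c $ a) * w i $ a) = 0} + k \<le> CARD('n)"
proof -
  define K where "K = {c :: real^'n. \<forall>i<k. (\<Sum>a\<in>UNIV. of_real (c $ a) * w i $ a) = 0}"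
  have subK: "subspace K"
    unfolding K_def subspace_def
    by (auto simp: distrib_right sum.distrib mult.assoc sum_distrib_left[symmetric])
  define V where "V = {y. \<forall>x\<in>K. orthogonal x y}"
  have dV: "dim V + dim K = CARD('n)"
    using dim_subspace_orthogonal_to_vectors[OF subK subspace_UNIV] by (simp add: V_def)
  have subV: "subspace V" unfolding V_def by (auto simp: subspace_def orthogonal_def inner_add)
  have inV: "re_part (w i) \<in> V" "im_part (w i) \<in> V" if "i < k" for i
  proof -
    have *: "c \<bullet> re_part (w i) = Re (\<Sum>a\<in>UNIV. of_real (c $ a) * w i $ a)"
         "c \<bullet> im_part (w i) = Im (\<Sum>a\<in>UNIV. of_real (c $ a) * w i $ a)" for c
      by (simp_all add: inner_vec_def Re_sum Im_sum)
    have "(\<Sum>a\<in>UNIV. of_real (c $ a) * w i $ a) = 0" if "c \<in> K" for c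
      using that \<open>i < k\<close> by (simp add: K_def)
    then have "c \<bullet> re_part (w i) = 0" "c \<bullet> im_part (w i) = 0" if "c \<in> K" for c
      using that unfolding * by simp_all
    then show "re_part (w i) \<in> V" "im_part (w i) \<in> V" by (auto simp: V_def orthogonal_def)
  qed
  \<comment> \<open>The flag False stands for w_i and True for i w_i; a real combination of the two
    is a complex multiple of w_i.\<close>
  define s where "s = (\<lambda>(i, b). if b then (- im_part (w i), re_part (w i)) else (re_part (w i), im_part (w i)))"
  define X where "X = {..<k} \<times> (UNIV :: bool set)"
  have Z: "\<alpha> p = 0" if "(\<Sum>p\<in>X. \<alpha> p *\<^sub>R s p) = 0" "p \<in> X" for \<alpha> p
  proof -
    define \<beta> where "\<beta> = (\<lambda>i. Complex (\<alpha> (i, False)) (\<alpha> (i, True)))"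
    have *: "(\<Sum>i<k. \<alpha> (i, False) *\<^sub>R s (i, False) + \<alpha> (i, True) *\<^sub>R s (i, True)) = 0"
      using that(1) unfolding X_def by (simp add: sum.cartesian_product' UNIV_bool)
    have "(\<Sum>i<k. \<beta> i *s w i) $ a = 0" for a
    proof -
      have "fst (\<Sum>i<k. \<alpha> (i, False) *\<^sub>R s (i, False) + \<alpha> (i, True) *\<^sub>R s (i, True)) $ a = 0"
           "snd (\<Sum>i<k. \<alpha> (i, False) *\<^sub>R s (i, False) + \<alpha> (i, True) *\<^sub>R s (i, True)) $ a = 0"
        unfolding * by simp_all
      then show ?thesis
        by (simp add: complex_eq_iff Re_sum Im_sum \<beta>_def s_def fst_sum snd_sum sum_negf sum_subtractf sum.distrib)
    qed
    then have "\<forall>i<k. \<beta> i = 0" by (intro ind) (simp add: vec_eq_iff)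
    then show ?thesis using that(2) by (cases p; cases "snd p") (auto simp: X_def \<beta>_def complex_eq_iff)
  qed
  have fX: "finite X" by (simp add: X_def)
  have inj: "inj_on s X"
  proof (rule inj_onI, rule ccontr)
    fix p q assume pq: "p \<in> X" "q \<in> X" "s p = s q" "p \<noteq> q"
    define \<alpha> where "\<alpha> = (\<lambda>u. if u = p then 1 else if u = q then - 1 else 0 :: real)"
    have "(\<Sum>u\<in>X. \<alpha> u *\<^sub>R s u) = (\<Sum>u\<in>{p, q}. \<alpha> u *\<^sub>R s u)"
      by (rule sum.mono_neutral_right) (use pq fX in \<open>auto simp: \<alpha>_def\<close>)
    also have "\<dots> = 0" using pq by (simp add: \<alpha>_def)
    finally have "\<alpha> p = 0" using Z pq by blast
    then show False by (simp add: \<alpha>_def)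
  qed
  have "independent (s ` X)"
  proof (rule independent_if_scalars_zero)
    show "finite (s ` X)" using fX by simp
    fix f v assume "(\<Sum>v\<in>s ` X. f v *\<^sub>R v) = 0" and v: "v \<in> s ` X"
    then have "(\<Sum>p\<in>X. f (s p) *\<^sub>R s p) = 0" by (simp add: sum.reindex[OF inj])
    then show "f v = 0" using Z[of "\<lambda>p. f (s p)"] v by auto
  qed
  moreover have "s ` X \<subseteq> V \<times> V"
    using inV subspace_neg[OF subV] by (auto simp: s_def X_def split: if_splits)
  ultimately have "card (s ` X) \<le> dim (V \<times> V)" by (rule independent_card_le_dim[rotated])
  also have "dim (V \<times> V) = dim V + dim V" by (rule dim_Times[OF subV subV])
  also have "card (s ` X) = 2 * k" by (subst card_image[OF inj]) (simp add: X_def)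
  finally have "2 * k \<le> 2 * dim V" by simp
  then show ?thesis using dV unfolding K_def by simp
qed

text \<open>E mixes real and imaginary parts, so both kernels are complexified: E maps K' + i K'
  injectively into K + i K, and the real dimensions are twice those of K' and K.\<close>

lemma dim_twisted_kernel_le:
  fixes Q :: "real^'n^'n" and E E' :: "complex^'n^'n"
  assumes E: "E' ** E = mat 1"
  shows "dim {c. cm Q *v (E *v cv c) = 0} \<le> dim {c. Q *v c = 0}"
proof -
  define K where "K = {c. Q *v c = 0}"
  define K' where "K' = {c. cm Q *v (E *v cv c) = 0}"
  have cvl: "cv (a + b) = cv a + cv b" "cv (r *\<^sub>R a) = of_real r *s cv a" for a b :: "real^'n" and r
    by (simp_all add: vec_eq_iff)
  have scal: "M *v (r *s y) = r *s (M *v y)" for M :: "complex^'n^'n" and r y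
    by (simp add: vec_eq_iff matrix_vector_mult_def sum_distrib_left mult_ac)
  have subK: "subspace K" unfolding K_def by (rule linear_subspace_kernel[OF matrix_vector_mul_linear])
  have subK': "subspace K'"
    unfolding K'_def subspace_def
    by (auto simp: cvl matrix_vector_right_distrib scal) (simp add: cv_def zero_vec_def[symmetric] flip: zero_vec_def)
  define h where "h = (\<lambda>(c1, c2). let y = E *v (cv c1 + \<i> *s cv c2) in (re_part y, im_part y))"
  have lin: "linear h"
  proof (rule linearI)
    fix x y :: "(real^'n) \<times> (real^'n)"
    have "cv (fst x + fst y) + \<i> *s cv (snd x + snd y) = (cv (fst x) + \<i> *s cv (snd x)) + (cv (fst y) + \<i> *s cv (snd y))"
      by (simp add: vec_eq_iff algebra_simps)
    then have "E *v (cv (fst x + fst y) + \<i> *s cv (snd x + snd y)) = E *v (cv (fst x) + \<i> *s cv (snd x)) + E *v (cv (fst y) + \<i> *s cv (snd y))"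
      by (simp only: matrix_vector_right_distrib)
    then show "h (x + y) = h x + h y"
      by (simp add: h_def split_def Let_def vec_eq_iff)
  next
    fix r and x :: "(real^'n) \<times> (real^'n)"
    have "cv (r *\<^sub>R fst x) + \<i> *s cv (r *\<^sub>R snd x) = of_real r *s (cv (fst x) + \<i> *s cv (snd x))"
      by (simp add: vec_eq_iff algebra_simps)
    then have "E *v (cv (r *\<^sub>R fst x) + \<i> *s cv (r *\<^sub>R snd x)) = of_real r *s (E *v (cv (fst x) + \<i> *s cv (snd x)))"
      by (simp only: scal)
    then show "h (r *\<^sub>R x) = r *\<^sub>R h x"
      by (simp add: h_def split_def Let_def vec_eq_iff)
  qed
  have "inj h"
    unfolding linear_injective_0[OF lin]
  proof (intro allI impI)
    fix x assume "h x = 0"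
    then have "E *v (cv (fst x) + \<i> *s cv (snd x)) = 0"
      unfolding cvec_eq_0_iff by (simp add: h_def split_def Let_def zero_prod_def)
    then have "E' *v (E *v (cv (fst x) + \<i> *s cv (snd x))) = 0" by simp
    then have "cv (fst x) + \<i> *s cv (snd x) = 0" by (simp add: matrix_vector_mul_assoc E)
    then have "fst x = 0" "snd x = 0" by (auto simp: vec_eq_iff complex_eq_iff)
    then show "x = 0" by (simp add: prod_eq_iff)
  qed
  then have "dim (h ` (K' \<times> K')) = dim (K' \<times> K')"
    by (intro dim_image_eq[OF lin]) (auto simp: inj_on_def)
  moreover have "h ` (K' \<times> K') \<subseteq> K \<times> K"
  proof -
    have "cm Q *v (E *v (cv a + \<i> *s cv b)) = 0" if "a \<in> K'" "b \<in> K'" for a b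
      using that by (simp add: K'_def matrix_vector_right_distrib scal)
    then show ?thesis by (auto simp: h_def Let_def K_def cm_mult_eq_0_iff)
  qed
  ultimately have "dim (K' \<times> K') \<le> dim (K \<times> K)" by (metis dim_subset)
  then have "dim K' + dim K' \<le> dim K + dim K"
    by (simp add: dim_Times[OF subK subK] dim_Times[OF subK' subK'])
  then show ?thesis unfolding K_def K'_def by simp
qed

section \<open>The spectral representation\<close>

text \<open>Bilinear, without conjugation. As D and V are real, the resolvent is symmetric for this
  pairing, and Green functions formed with it are holomorphic in z. The Hermitian product is
  recovered through \<open>cjv\<close> and \<open>cj\<close>.\<close>

definition bdot :: "complex^'n \<Rightarrow> complex^'n \<Rightarrow> complex" where "bdot x y = (\<Sum>a\<in>UNIV. x $ a * y $ a)"
definition cjv :: "complex^'n \<Rightarrow> complex^'n" where "cjv x = (\<chi> a. cnj (x $ a))"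
definition bl :: "(nat \<Rightarrow> complex^'n) \<Rightarrow> (nat \<Rightarrow> complex^'n) \<Rightarrow> complex" where "bl u v = (\<Sum>n. bdot (u n) (v n))"
definition cj :: "(nat \<Rightarrow> complex^'n) \<Rightarrow> (nat \<Rightarrow> complex^'n)" where "cj u = (\<lambda>n. cjv (u n))"

section \<open>The bilinear pairing on square-summable sequences\<close>

lemma cjv_nth [simp]: "cjv x $ a = cnj (x $ a)" by (simp add: cjv_def)
lemma cjv_cjv [simp]: "cjv (cjv x) = x" by (simp add: vec_eq_iff)
lemma cj_cj [simp]: "cj (cj u) = u" by (simp add: cj_def)
lemma norm_cjv [simp]: "norm (cjv x) = norm x" by (simp add: norm_vec_def)

lemma norm_smult_vec: "norm (c *s (x :: complex^'n)) = cmod c * norm x"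
  by (simp add: norm_vec_def norm_mult L2_set_right_distrib)

lemma bdot_commute: "bdot x y = bdot y x" by (simp add: bdot_def mult.commute)
lemma bdot_lin: "bdot (c *s x + y) w = c * bdot x w + bdot y w"
  by (simp add: bdot_def distrib_right sum.distrib sum_distrib_left mult.assoc)
lemma bdot_cjv: "cnj (bdot x y) = bdot (cjv x) (cjv y)" by (simp add: bdot_def)

lemma bdot_cjv_self: "bdot x (cjv x) = of_real ((norm x)\<^sup>2)"
  by (simp add: bdot_def norm_vec_def L2_set_def complex_norm_square sum_nonneg del: of_real_power)

lemma norm_bdot_le: "cmod (bdot x y) \<le> norm x * norm y"
proof -
  have "cmod (bdot x y) \<le> (\<Sum>a\<in>UNIV. cmod (x $ a) * cmod (y $ a))"
    unfolding bdot_def by (rule order_trans[OF norm_sum]) (simp add: norm_mult)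
  also have "\<dots> \<le> norm x * norm y"
    using L2_set_mult_ineq[of "\<lambda>a. cmod (x $ a)" "\<lambda>a. cmod (y $ a)" UNIV] by (simp add: norm_vec_def)
  finally show ?thesis .
qed

lemma ell2_lin:
  assumes "u \<in> ell2" "v \<in> ell2" shows "(\<lambda>n. c *s u n + v n) \<in> ell2"
proof -
  have sm: "summable (\<lambda>n. 2 * ((cmod c)\<^sup>2 * (norm (u n))\<^sup>2) + 2 * (norm (v n))\<^sup>2)"
    using assms by (intro summable_add summable_mult) (auto simp: ell2_def)
  have le: "(norm (c *s u n + v n))\<^sup>2 \<le> 2 * ((cmod c)\<^sup>2 * (norm (u n))\<^sup>2) + 2 * (norm (v n))\<^sup>2" for n
  proof -
    have "(norm (c *s u n + v n))\<^sup>2 \<le> (cmod c * norm (u n) + norm (v n))\<^sup>2"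
      using norm_triangle_ineq[of "c *s u n" "v n"] by (intro power_mono) (auto simp: norm_smult_vec)
    also have "\<dots> \<le> 2 * ((cmod c)\<^sup>2 * (norm (u n))\<^sup>2) + 2 * (norm (v n))\<^sup>2"
      using sum_squares_ge_zero[of "cmod c * norm (u n) - norm (v n)" 0]
      by (simp add: power2_eq_square algebra_simps)
    finally show ?thesis .
  qed
  have "summable (\<lambda>n. (norm (c *s u n + v n))\<^sup>2)"
    by (rule summable_comparison_test'[OF sm, of 0]) (use le in simp)
  then show ?thesis using assms by (simp add: ell2_def)
qed

lemma ell2_zero: "(\<lambda>n. 0) \<in> ell2" by (simp add: ell2_def)

lemma ell2_cj: "u \<in> ell2 \<Longrightarrow> cj u \<in> ell2"
  by (simp add: ell2_def cj_def) (simp add: vec_eq_iff)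

lemma ell2_finite_support:
  assumes "u 0 = 0" "\<And>n. n > N \<Longrightarrow> u n = 0" shows "u \<in> ell2"
proof -
  have "summable (\<lambda>n. (norm (u n))\<^sup>2)"
    by (rule summable_finite[of "{..N}"]) (use assms(2) in \<open>auto simp: not_le\<close>)
  then show ?thesis using assms by (simp add: ell2_def)
qed

lemma bl_summable: assumes "u \<in> ell2" "v \<in> ell2" shows "summable (\<lambda>n. bdot (u n) (v n))"
proof (rule summable_norm_cancel, rule summable_comparison_test'[where N = 0])
  show "summable (\<lambda>n. (norm (u n))\<^sup>2 + (norm (v n))\<^sup>2)"
    using assms by (intro summable_add) (auto simp: ell2_def)
  fix n
  have "cmod (bdot (u n) (v n)) \<le> norm (u n) * norm (v n)" by (rule norm_bdot_le)
  also have "\<dots> \<le> (norm (u n))\<^sup>2 + (norm (v n))\<^sup>2"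
    using sum_squares_bound[of "norm (u n)" "norm (v n)"] mult_nonneg_nonneg[OF norm_ge_zero[of "u n"] norm_ge_zero[of "v n"]]
    unfolding mult.assoc by linarith
  finally show "norm (cmod (bdot (u n) (v n))) \<le> (norm (u n))\<^sup>2 + (norm (v n))\<^sup>2" by simp
qed

lemma bl_commute: "bl u v = bl v u" by (simp add: bl_def bdot_commute)

lemma bl_lin: assumes "u \<in> ell2" "v \<in> ell2" "w \<in> ell2"
  shows "bl (\<lambda>n. c *s u n + v n) w = c * bl u w + bl v w"
  unfolding bl_def bdot_lin
  using bl_summable[OF assms(1,3)] bl_summable[OF assms(2,3)]
  by (simp add: suminf_add[symmetric] suminf_mult summable_mult)

lemma bl_lin2: assumes "u \<in> ell2" "v \<in> ell2" "w \<in> ell2"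
  shows "bl w (\<lambda>n. c *s u n + v n) = c * bl w u + bl w v"
  using bl_lin[OF assms] by (simp add: bl_commute)

lemma cnj_bl: assumes "u \<in> ell2" "v \<in> ell2" shows "cnj (bl u v) = bl (cj u) (cj v)"
  using sums_unique[OF sums_cnj[THEN iffD2, OF summable_sums[OF bl_summable[OF assms]]]]
  by (simp add: bl_def cj_def bdot_cjv)

lemma bl_self: assumes "u \<in> ell2" shows "bl u (cj u) = of_real (l2norm2 u)"
proof -
  have "summable (\<lambda>n. (norm (u n))\<^sup>2)" using assms by (simp add: ell2_def)
  from sums_of_real[OF summable_sums[OF this], where ?'a = complex] show ?thesis
    unfolding bl_def cj_def bdot_cjv_self l2norm2_def by (simp add: sums_iff)
qed

lemma cj_lin: "cj (\<lambda>n. c *s u n + v n) = (\<lambda>n. cnj c *s cj u n + cj v n)"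
  by (auto simp: cj_def vec_eq_iff)

lemma l2norm2_nonneg: "u \<in> ell2 \<Longrightarrow> 0 \<le> l2norm2 u"
  unfolding l2norm2_def by (intro suminf_nonneg) (auto simp: ell2_def)

lemma norm_le_l2norm2: "u \<in> ell2 \<Longrightarrow> (norm (u n))\<^sup>2 \<le> l2norm2 u"
  unfolding l2norm2_def using sum_le_suminf[of "\<lambda>n. (norm (u n))\<^sup>2" "{n}"] by (auto simp: ell2_def)

lemma l2norm2_eq_0: "u \<in> ell2 \<Longrightarrow> l2norm2 u = 0 \<Longrightarrow> u = (\<lambda>n. 0)"
  using norm_le_l2norm2[of u] by (auto simp: fun_eq_iff)

lemma l2norm2_lin:
  assumes "u \<in> ell2" "v \<in> ell2"
  shows "l2norm2 (\<lambda>n. c *s u n + v n) = (cmod c)\<^sup>2 * l2norm2 u + l2norm2 v + 2 * Re (c * bl u (cj v))"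
proof -
  have "complex_of_real (l2norm2 (\<lambda>n. c *s u n + v n)) =
     c * (cnj c * bl u (cj u) + bl u (cj v)) + (cnj c * bl v (cj u) + bl v (cj v))"
    using assms by (simp add: bl_self[OF ell2_lin, symmetric] cj_lin bl_lin bl_lin2 ell2_lin ell2_cj)
  also have "bl v (cj u) = cnj (bl u (cj v))" using assms by (simp add: cnj_bl ell2_cj bl_commute)
  finally have "Re (complex_of_real (l2norm2 (\<lambda>n. c *s u n + v n))) = Re (c * (cnj c * bl u (cj u) + bl u (cj v)) + (cnj c * cnj (bl u (cj v)) + bl v (cj v)))"
    by simp
  then show ?thesis using assms unfolding cmod_power2 by (simp add: bl_self power2_eq_square algebra_simps)
qed

lemma cmv_lin: "cmv A (c *s x + y) = c *s cmv A x + cmv A y"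
  by (simp add: cmv_def vec_eq_iff sum_distrib_left sum.distrib distrib_left mult_ac)

lemma cmv_cjv: "cmv A (cjv x) = cjv (cmv A x)" by (simp add: cmv_def vec_eq_iff)
lemma cmv_0 [simp]: "cmv A 0 = 0" by (simp add: cmv_def vec_eq_iff)

lemma Hdir_lin: "Hdir D V (\<lambda>n. c *s u n + v n) = (\<lambda>n. c *s Hdir D V u n + Hdir D V v n)"
  unfolding Hdir_def cmv_lin by (auto simp: fun_eq_iff vec_eq_iff algebra_simps)

lemma Hdir_cj: "Hdir D V (cj u) = cj (Hdir D V u)"
  by (auto simp: Hdir_def cj_def fun_eq_iff cmv_cjv vec_eq_iff)

lemma Hdir_dom_lin: "u \<in> Hdir_dom D V \<Longrightarrow> v \<in> Hdir_dom D V \<Longrightarrow> (\<lambda>n. c *s u n + v n) \<in> Hdir_dom D V"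
  by (simp add: Hdir_dom_def Hdir_lin ell2_lin)

lemma Hdir_dom_cj: "u \<in> Hdir_dom D V \<Longrightarrow> cj u \<in> Hdir_dom D V"
  by (simp add: Hdir_dom_def Hdir_cj ell2_cj)

text \<open>This is m(H) seen in the spectral representation; m(x) = 1 / (x - z) gives the
  resolvent.\<close>

definition ds_scale :: "(real \<Rightarrow> complex) \<Rightarrow> dsel \<Rightarrow> dsel" where
  "ds_scale m F = ((\<lambda>j x. m x * fst F j x), (\<lambda>k x. m x * snd F k x))"

lemma ds_norm2_cong: "ds_eq A \<nu> F G \<Longrightarrow> ds_norm2 A \<nu> F = ds_norm2 A \<nu> G"
  unfolding ds_norm2_def ds_eq_def
  by (intro arg_cong2[where f = "(+)"] suminf_cong nn_integral_cong_AE; fastforce elim!: eventually_mono split: split_indicator)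

text \<open>Compatibility of \<open>ds_eq\<close> with pointwise operations reduces to this one
  statement, so the exceptional null sets are handled once.\<close>

lemma ds_eq_cong2:
  assumes "ds_eq A \<nu> F F'" "ds_eq A \<nu> G G'"
    and "\<And>j x. fst F j x = fst F' j x \<Longrightarrow> fst G j x = fst G' j x \<Longrightarrow> fst K j x = fst K' j x"
    and "\<And>j x. snd F j x = snd F' j x \<Longrightarrow> snd G j x = snd G' j x \<Longrightarrow> snd K j x = snd K' j x"
  shows "ds_eq A \<nu> K K'"
  unfolding ds_eq_def
proof (intro conjI allI)
  fix j
  have "AE x in lborel. x \<in> A j \<longrightarrow> fst F j x = fst F' j x" "AE x in lborel. x \<in> A j \<longrightarrow> fst G j x = fst G' j x"
    using assms(1,2) by (simp_all add: ds_eq_def)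
  then show "AE x in lborel. x \<in> A j \<longrightarrow> fst K j x = fst K' j x"
    by eventually_elim (use assms(3) in blast)
  have "AE x in \<nu> j. snd F j x = snd F' j x" "AE x in \<nu> j. snd G j x = snd G' j x"
    using assms(1,2) by (simp_all add: ds_eq_def)
  then show "AE x in \<nu> j. snd K j x = snd K' j x"
    by eventually_elim (use assms(4) in blast)
qed

lemma ds_eq_trans: "ds_eq A \<nu> F G \<Longrightarrow> ds_eq A \<nu> G K \<Longrightarrow> ds_eq A \<nu> F K"
  by (erule (1) ds_eq_cong2) auto

lemma ds_eq_refl [simp]: "ds_eq A \<nu> F F" unfolding ds_eq_def by auto

lemma ds_eq_lin: "ds_eq A \<nu> F F' \<Longrightarrow> ds_eq A \<nu> G G' \<Longrightarrow> ds_eq A \<nu> (ds_lin c F G) (ds_lin c F' G')"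
  by (erule (1) ds_eq_cong2) (auto simp: ds_lin_def)

lemma ds_eq_scale: "ds_eq A \<nu> F F' \<Longrightarrow> ds_eq A \<nu> (ds_scale m F) (ds_scale m F')"
  by (erule ds_eq_cong2[OF _ ds_eq_refl]) (auto simp: ds_scale_def)

locale acrep =
  fixes D V :: "int \<Rightarrow> real^'l^'l" and A :: "nat \<Rightarrow> real set" and \<nu> :: "nat \<Rightarrow> real measure"
    and U :: "(nat \<Rightarrow> complex^'l) \<Rightarrow> dsel"
  assumes symD: "\<And>n. sym_mat (D n)" and symV: "\<And>n. sym_mat (V n)" and invD: "\<And>n. invertible (D n)"
    and rep: "ac_sing_rep (Hdir_dom D V) (Hdir D V) A \<nu> U"
begin

abbreviation "Dom \<equiv> Hdir_dom D V"
abbreviation "H \<equiv> Hdir D V"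

section \<open>Symmetry and resolvent of H from the diagonalisation\<close>

lemma A_borel [measurable]: "A j \<in> sets borel" and A_mono: "A (Suc j) \<subseteq> A j"
  using rep by (auto simp: ac_sing_rep_def)

lemma sets_\<nu> [measurable_cong]: "sets (\<nu> k) = sets borel"
  using rep by (auto simp: ac_sing_rep_def)

lemma U_space: "u \<in> ell2 \<Longrightarrow> U u \<in> ds_space A \<nu>"
  and U_norm: "u \<in> ell2 \<Longrightarrow> ds_norm2 A \<nu> (U u) = ennreal (l2norm2 u)"
  and U_lin: "u \<in> ell2 \<Longrightarrow> v \<in> ell2 \<Longrightarrow> ds_eq A \<nu> (U (\<lambda>n. c *s u n + v n)) (ds_lin c (U u) (U v))"
  and U_surj: "F \<in> ds_space A \<nu> \<Longrightarrow> \<exists>u\<in>ell2. ds_eq A \<nu> (U u) F"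
  and U_dom: "u \<in> ell2 \<Longrightarrow> u \<in> Dom \<longleftrightarrow> ds_norm2 A \<nu> (mult_x (U u)) < \<infinity>"
  and U_H: "u \<in> Dom \<Longrightarrow> ds_eq A \<nu> (U (H u)) (mult_x (U u))"
  using rep unfolding ac_sing_rep_def by blast+

lemma dom_ell2: "u \<in> Dom \<Longrightarrow> u \<in> ell2" "u \<in> Dom \<Longrightarrow> H u \<in> ell2"
  by (auto simp: Hdir_dom_def)

lemma ds_space_meas:
  assumes "F \<in> ds_space A \<nu>"
  shows "fst F j \<in> borel_measurable borel" "snd F k \<in> borel_measurable (\<nu> k)"
  using assms by (auto simp: ds_space_def)

lemma ds_scale_le:
  assumes F: "F \<in> ds_space A \<nu>" and [measurable]: "m \<in> borel_measurable borel"
    and le: "\<And>x. (cmod (m x))\<^sup>2 \<le> B"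
  shows "ds_norm2 A \<nu> (ds_scale m F) \<le> ennreal B * ds_norm2 A \<nu> F" "ds_scale m F \<in> ds_space A \<nu>"
proof -
  note [measurable] = ds_space_meas[OF F]
  have B: "B \<ge> 0" using le[of 0] zero_le_power2 order_trans by blast
  have pt: "ennreal ((cmod (m x * y))\<^sup>2) \<le> ennreal B * ennreal ((cmod y)\<^sup>2)" for x y
    using le[of x] B by (simp add: norm_mult power_mult_distrib mult_right_mono flip: ennreal_mult)
  have "(\<integral>\<^sup>+ x. indicator (A j) x * ennreal ((cmod (m x * fst F j x))\<^sup>2) \<partial>lborel)
    \<le> ennreal B * (\<integral>\<^sup>+ x. indicator (A j) x * ennreal ((cmod (fst F j x))\<^sup>2) \<partial>lborel)" for j
    by (subst nn_integral_cmult[symmetric], measurable, intro nn_integral_mono)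
       (auto split: split_indicator intro: pt)
  moreover have "(\<integral>\<^sup>+ x. ennreal ((cmod (m x * snd F k x))\<^sup>2) \<partial>\<nu> k)
    \<le> ennreal B * (\<integral>\<^sup>+ x. ennreal ((cmod (snd F k x))\<^sup>2) \<partial>\<nu> k)" for k
    by (subst nn_integral_cmult[symmetric], measurable, intro nn_integral_mono pt)
  ultimately have "(\<Sum>j. \<integral>\<^sup>+ x. indicator (A j) x * ennreal ((cmod (m x * fst F j x))\<^sup>2) \<partial>lborel)
      + (\<Sum>k. \<integral>\<^sup>+ x. ennreal ((cmod (m x * snd F k x))\<^sup>2) \<partial>\<nu> k)
    \<le> (\<Sum>j. ennreal B * (\<integral>\<^sup>+ x. indicator (A j) x * ennreal ((cmod (fst F j x))\<^sup>2) \<partial>lborel))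
      + (\<Sum>k. ennreal B * (\<integral>\<^sup>+ x. ennreal ((cmod (snd F k x))\<^sup>2) \<partial>\<nu> k))"
    by (intro add_mono suminf_le) auto
  then show *: "ds_norm2 A \<nu> (ds_scale m F) \<le> ennreal B * ds_norm2 A \<nu> F"
    by (simp add: ds_norm2_def ds_scale_def distrib_left)
  have "ds_norm2 A \<nu> F < \<infinity>" using F by (simp add: ds_space_def)
  then have "ds_norm2 A \<nu> (ds_scale m F) < \<infinity>"
    using le_less_trans[OF *] by (simp add: ennreal_mult_less_top)
  then show "ds_scale m F \<in> ds_space A \<nu>"
    unfolding ds_space_def by (simp add: ds_scale_def)
qed

lemma U_shift:
  assumes "u \<in> Dom"
  shows "ds_eq A \<nu> (U (\<lambda>n. c *s u n + H u n)) (ds_scale (\<lambda>x. of_real x + c) (U u))"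
proof -
  have "ds_eq A \<nu> (U (\<lambda>n. c *s u n + H u n)) (ds_lin c (U u) (U (H u)))"
    using dom_ell2[OF assms] by (rule U_lin)
  also have "ds_eq A \<nu> \<dots> (ds_lin c (U u) (mult_x (U u)))"
    by (intro ds_eq_lin ds_eq_refl U_H assms)
  moreover have "ds_lin c (U u) (mult_x (U u)) = ds_scale (\<lambda>x. of_real x + c) (U u)"
    by (simp add: ds_lin_def mult_x_def ds_scale_def algebra_simps)
  ultimately show ?thesis using ds_eq_trans by metis
qed

text \<open>For real x one has |x + i| = |x - i|, so (H + i) u and (H - i) u have the same norm. The
  difference of their squared norms is, up to sign, four times this imaginary part.\<close>

lemma H_quadratic_real: assumes "u \<in> Dom" shows "Im (bl u (cj (H u))) = 0"
proof -
  have n: "ds_norm2 A \<nu> (ds_scale (\<lambda>x. of_real x + c) (U u)) = ennreal (l2norm2 (\<lambda>n. c *s u n + H u n))" for c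
    using ds_norm2_cong[OF U_shift[OF assms, of c]] U_norm[OF ell2_lin[OF dom_ell2[OF assms]]] by simp
  have "cmod (of_real x + \<i>) = cmod (of_real x - \<i>)" for x by (simp add: cmod_def)
  then have "ds_norm2 A \<nu> (ds_scale (\<lambda>x. of_real x + \<i>) (U u)) = ds_norm2 A \<nu> (ds_scale (\<lambda>x. of_real x + - \<i>) (U u))"
    by (simp add: ds_norm2_def ds_scale_def norm_mult)
  then have "l2norm2 (\<lambda>n. \<i> *s u n + H u n) = l2norm2 (\<lambda>n. (- \<i>) *s u n + H u n)"
    unfolding n by (subst (asm) ennreal_inj) (intro l2norm2_nonneg ell2_lin dom_ell2 assms)+
  then show ?thesis unfolding l2norm2_lin[OF dom_ell2[OF assms]] by simp
qed

text \<open>Polarisation with c = 1 and c = i gives Hermitian symmetry. Replacing u by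
  \<open>cj u\<close> makes it bilinear, because H commutes with conjugation.\<close>

lemma H_symmetric:
  assumes u: "u \<in> Dom" and v: "v \<in> Dom" shows "bl (H u) v = bl u (H v)"
proof -
  have *: "bl (H v) (cj u) = cnj (bl (H u) (cj v))" if u: "u \<in> Dom" and v: "v \<in> Dom" for u v
  proof -
    note e = dom_ell2[OF u] dom_ell2[OF v] ell2_cj ell2_lin
    have q: "Im (bl (H w) (cj w)) = 0" if "w \<in> Dom" for w
    proof -
      have "bl w (cj (H w)) = cnj (bl (H w) (cj w))"
        using dom_ell2[OF that] by (simp add: cnj_bl ell2_cj bl_commute)
      then show ?thesis using H_quadratic_real[OF that] by simp
    qed
    have ex: "bl (H (\<lambda>n. c *s u n + v n)) (cj (\<lambda>n. c *s u n + v n))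
       = c * (cnj c * bl (H u) (cj u) + bl (H u) (cj v)) + (cnj c * bl (H v) (cj u) + bl (H v) (cj v))" for c
      by (simp add: Hdir_lin cj_lin bl_lin bl_lin2 e)
    have "Im (c * bl (H u) (cj v) + cnj c * bl (H v) (cj u)) = 0" if "c = 1 \<or> c = \<i>" for c
    proof -
      have "Im (c * (cnj c * bl (H u) (cj u))) = 0" using q[OF u] that by auto
      then show ?thesis using q[OF Hdir_dom_lin[OF u v], of c] q[OF v] unfolding ex by (simp add: distrib_left)
    qed
    from this[of 1] this[of \<i>] show ?thesis by (simp add: complex_eq_iff)
  qed
  have "bl (H v) u = cnj (bl (H (cj u)) (cj v))"
    using *[OF Hdir_dom_cj[OF u] v] by simp
  also have "\<dots> = bl (H u) v"
    using dom_ell2[OF u] dom_ell2[OF v] by (simp add: cnj_bl Hdir_cj ell2_cj)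
  finally show ?thesis by (simp add: bl_commute)
qed

text \<open>The mixed term vanishes by \<open>H_quadratic_real\<close>, so |(H - z) u|^2 = |(H - Re
  z) u|^2 + (Im z)^2 |u|^2.\<close>

lemma resolvent_bound:
  assumes u: "u \<in> Dom"
  shows "(Im z)\<^sup>2 * l2norm2 u \<le> l2norm2 (\<lambda>n. (- z) *s u n + H u n)"
proof -
  note e = dom_ell2[OF u]
  have r: "Im (bl u (cj (H u))) = 0" by (rule H_quadratic_real[OF u])
  have "0 \<le> l2norm2 (\<lambda>n. of_real (- Re z) *s u n + H u n)"
    by (intro l2norm2_nonneg ell2_lin e)
  then have "0 \<le> (Re z)\<^sup>2 * l2norm2 u + l2norm2 (H u) - 2 * (Re z * Re (bl u (cj (H u))))"
    unfolding l2norm2_lin[OF e] by simp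
  then show ?thesis
    using r unfolding l2norm2_lin[OF e] cmod_power2 by (simp add: algebra_simps)
qed

text \<open>U is onto, so u can be a preimage of U g divided by x - z. It lies in the domain because
  x / (x - z) is bounded, and the residual (H - z) u - g is 0 because its image under U has norm
  0.\<close>

lemma resolvent_exists:
  assumes g: "g \<in> ell2" and z: "Im z \<noteq> 0"
  shows "\<exists>u\<in>Dom. H u = (\<lambda>n. z *s u n + g n) \<and> ds_eq A \<nu> (U u) (ds_scale (\<lambda>x. 1 / (of_real x - z)) (U g))"
proof -
  have nz: "of_real x - z \<noteq> 0" for x using z by (auto simp: complex_eq_iff)
  have ab: "\<bar>Im z\<bar> \<le> cmod (of_real x - z)" for x using abs_Im_le_cmod[of "of_real x - z"] by simp
  define F where "F = ds_scale (\<lambda>x. 1 / (of_real x - z)) (U g)"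
  have m1: "(cmod (1 / (of_real x - z)))\<^sup>2 \<le> (1 / \<bar>Im z\<bar>)\<^sup>2" for x
    using ab[of x] z by (intro power_mono) (auto simp: norm_divide intro!: divide_left_mono mult_pos_pos)
  have F: "F \<in> ds_space A \<nu>" unfolding F_def
    by (rule ds_scale_le(2)[OF U_space[OF g] _ m1]) measurable
  obtain u where u: "u \<in> ell2" "ds_eq A \<nu> (U u) F" using U_surj[OF F] by blast
  have "ds_eq A \<nu> (mult_x (U u)) (ds_scale (\<lambda>x. of_real x / (of_real x - z)) (U g))"
  proof -
    have "ds_eq A \<nu> (ds_scale of_real (U u)) (ds_scale of_real F)" by (rule ds_eq_scale[OF u(2)])
    then show ?thesis by (simp add: mult_x_def ds_scale_def F_def)
  qed
  from ds_norm2_cong[OF this] have mx: "ds_norm2 A \<nu> (mult_x (U u)) = ds_norm2 A \<nu> (ds_scale (\<lambda>x. of_real x / (of_real x - z)) (U g))" .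
  \<comment> \<open>From x / (x - z) = 1 + z / (x - z) and |x - z| >= |Im z|.\<close>
  have m2: "(cmod (of_real x / (of_real x - z)))\<^sup>2 \<le> (1 + cmod z / \<bar>Im z\<bar>)\<^sup>2" for x
  proof (rule power_mono)
    have "of_real x / (of_real x - z) = 1 + z / (of_real x - z)" using nz[of x] by (simp add: field_simps)
    then have "cmod (of_real x / (of_real x - z)) \<le> 1 + cmod z / cmod (of_real x - z)"
      by (metis norm_triangle_ineq norm_one norm_divide)
    also have "\<dots> \<le> 1 + cmod z / \<bar>Im z\<bar>"
      using ab[of x] z nz[of x] by (intro add_left_mono divide_left_mono) auto
    finally show "cmod (of_real x / (of_real x - z)) \<le> 1 + cmod z / \<bar>Im z\<bar>" .
  qed auto
  have "ds_scale (\<lambda>x. of_real x / (of_real x - z)) (U g) \<in> ds_space A \<nu>"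
    by (rule ds_scale_le(2)[OF U_space[OF g] _ m2]) measurable
  then have "ds_norm2 A \<nu> (mult_x (U u)) < \<infinity>" unfolding mx by (simp add: ds_space_def)
  then have uD: "u \<in> Dom" using U_dom[OF u(1)] by simp
  define d where "d = (\<lambda>n. (- z) *s u n + H u n)"
  have d: "d \<in> ell2" unfolding d_def by (intro ell2_lin dom_ell2 uD)
  have "ds_eq A \<nu> (U d) (ds_scale (\<lambda>x. of_real x + (- z)) (U u))" unfolding d_def by (rule U_shift[OF uD])
  also have "ds_eq A \<nu> \<dots> (ds_scale (\<lambda>x. of_real x + (- z)) F)" by (rule ds_eq_scale[OF u(2)])
  moreover have "ds_scale (\<lambda>x. of_real x + (- z)) F = U g"
    using nz by (simp add: ds_scale_def F_def)
  ultimately have Ud: "ds_eq A \<nu> (U d) (U g)" using ds_eq_trans by metis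
  define e where "e = (\<lambda>n. (- 1) *s g n + d n)"
  have e: "e \<in> ell2" unfolding e_def by (intro ell2_lin g d)
  have "ds_eq A \<nu> (U e) (ds_lin (- 1) (U g) (U d))" unfolding e_def by (rule U_lin[OF g d])
  then have "ds_eq A \<nu> (U e) (ds_lin (- 1) (U g) (U g))"
    using ds_eq_trans ds_eq_lin[OF ds_eq_refl Ud] by blast
  then have "ds_norm2 A \<nu> (U e) = ds_norm2 A \<nu> (ds_lin (- 1) (U g) (U g))" by (rule ds_norm2_cong)
  also have "\<dots> = 0" by (simp add: ds_norm2_def ds_lin_def)
  finally have "l2norm2 e = 0" using U_norm[OF e] l2norm2_nonneg[OF e] by simp
  then have "e = (\<lambda>n. 0)" by (rule l2norm2_eq_0[OF e])
  then have "H u n = z *s u n + g n" for n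
    by (simp add: e_def d_def fun_eq_iff) (metis add.commute add_diff_cancel_left' diff_add_cancel eq_iff_diff_eq_0 diff_minus_eq_add uminus_add_conv_diff)
  then show ?thesis using uD u(2) unfolding F_def by (intro bexI[of _ u]) auto
qed

end

section \<open>The resolvent\<close>

lemma cmv_eq: "cmv A v = cm A *v v" by (simp add: cmv_def vec_eq_iff matrix_vector_mult_def)

lemma cm_mult: "cm (A ** B) = cm A ** cm B" by (simp add: vec_eq_iff matrix_matrix_mult_def)
lemma cm_diff: "cm (A - B) = cm A - cm B" by (simp add: vec_eq_iff)
lemma cm_mat: "cm (mat x) = mat (of_real x)" by (simp add: vec_eq_iff mat_def)
lemma cm_0 [simp]: "cm 0 = 0" by (simp add: vec_eq_iff)
lemma cm_transpose: "cm (transpose A) = transpose (cm A)" by (simp add: vec_eq_iff transpose_def)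
lemma scaleR_mat: "x *\<^sub>R mat 1 = (mat x :: real^'n^'n)" by (simp add: vec_eq_iff mat_def)
lemma mat_mult_vec: "mat z *v (x :: complex^'n) = z *s x"
  by (simp add: vec_eq_iff matrix_vector_mult_def mat_def if_distrib if_distribR cong: if_cong)

lemma matrix_inv_inverse:
  fixes B :: "'a::semiring_1^'n^'n"
  assumes "invertible B" shows "matrix_inv B ** B = mat 1" "B ** matrix_inv B = mat 1"
proof -
  have "B ** matrix_inv B = mat 1 \<and> matrix_inv B ** B = mat 1"
    using assms unfolding invertible_def matrix_inv_def by (rule someI_ex)
  then show "matrix_inv B ** B = mat 1" "B ** matrix_inv B = mat 1" by auto
qed

text \<open>\<open>solseq\<close> with a complex spectral parameter, needed because real points are
  reached as limits from the upper half-plane.\<close>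

fun csol :: "(int \<Rightarrow> real^'l^'l) \<Rightarrow> (int \<Rightarrow> real^'l^'l) \<Rightarrow> complex
    \<Rightarrow> complex^'l^'l \<Rightarrow> complex^'l^'l \<Rightarrow> nat \<Rightarrow> complex^'l^'l" where
  "csol D V z a b 0 = a"
| "csol D V z a b (Suc 0) = b"
| "csol D V z a b (Suc (Suc n)) =
     cm (matrix_inv (D (int (Suc n)))) **
       ((mat z - cm (V (int (Suc n)))) ** csol D V z a b (Suc n)
        - cm (D (int n)) ** csol D V z a b n)"

lemma csol_of_real: "csol D V (of_real x) (cm a) (cm b) n = cm (solseq D V x a b n)"
  by (induction D V x a b n rule: solseq.induct) (simp_all add: cm_mult cm_diff cm_mat scaleR_mat)

lemma holomorphic_csol: "(\<lambda>z. csol D V z a b n $ i $ j) holomorphic_on S"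
proof (induction n arbitrary: i j rule: less_induct)
  case (less n)
  consider "n = 0" | "n = 1" | m where "n = Suc (Suc m)" by (metis One_nat_def not0_implies_Suc)
  then show ?case
  proof cases
    case 3
    have "(\<lambda>z. csol D V z a b (Suc m) $ i $ j) holomorphic_on S" "(\<lambda>z. csol D V z a b m $ i $ j) holomorphic_on S" for i j
      using less[of "Suc m"] less[of m] 3 by auto
    moreover have "(\<lambda>z :: complex. (mat z :: complex^'a^'a) $ i $ j) holomorphic_on S" for i j
      by (cases "i = j") (auto simp: mat_def intro: holomorphic_intros)
    ultimately show ?thesis
      unfolding 3 by (auto simp: matrix_matrix_mult_def intro!: holomorphic_intros)
  qed auto
qed

text \<open>Invertibility of D lets the values at sites 0 and 1 determine the rest. The recurrence
  is assumed strictly below n, so a source at site n leaves the formula intact up to n.\<close>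

lemma csol_representation:
  fixes u :: "nat \<Rightarrow> complex^'l"
  assumes inv: "\<And>n. invertible (D n)"
    and rec: "\<And>m. 1 \<le> m \<Longrightarrow> m < n \<Longrightarrow> cm (D (int m - 1)) *v u (m - 1) + cm (D (int m)) *v u (Suc m) + cm (V (int m)) *v u m = z *s u m"
  shows "m \<le> n \<Longrightarrow> u m = csol D V z 0 (mat 1) m *v u 1 + csol D V z (mat 1) 0 m *v u 0"
proof (induction m rule: less_induct)
  case (less m)
  consider "m = 0" | "m = 1" | k where "m = Suc (Suc k)" by (metis One_nat_def not0_implies_Suc)
  then show ?case
  proof cases
    case 3
    have li: "cm (matrix_inv (D (int (Suc k)))) ** cm (D (int (Suc k))) = mat 1"
      using matrix_inv_inverse(1)[OF inv] by (simp add: cm_mult[symmetric] cm_mat)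
    have "cm (D (int (Suc k))) *v u m = (mat z - cm (V (int (Suc k)))) *v u (Suc k) - cm (D (int k)) *v u k"
      using rec[of "Suc k"] less.prems 3 by (simp add: matrix_vector_mult_diff_rdistrib mat_mult_vec algebra_simps)
    then have "cm (matrix_inv (D (int (Suc k)))) *v (cm (D (int (Suc k))) *v u m) = cm (matrix_inv (D (int (Suc k)))) *v ((mat z - cm (V (int (Suc k)))) *v u (Suc k) - cm (D (int k)) *v u k)"
      by simp
    then have um: "u m = cm (matrix_inv (D (int (Suc k)))) *v ((mat z - cm (V (int (Suc k)))) *v u (Suc k) - cm (D (int k)) *v u k)"
      by (simp only: matrix_vector_mul_assoc li matrix_vector_mul_lid)
    have "u (Suc k) = csol D V z 0 (mat 1) (Suc k) *v u 1 + csol D V z (mat 1) 0 (Suc k) *v u 0"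
      "u k = csol D V z 0 (mat 1) k *v u 1 + csol D V z (mat 1) 0 k *v u 0"
      using less.IH[of "Suc k"] less.IH[of k] less.prems 3 by auto
    then show ?thesis
      unfolding 3 um[unfolded 3] csol.simps
      by (simp only: matrix_vector_mul_assoc[symmetric] matrix_vector_right_distrib matrix_vector_mult_diff_distrib
          matrix_vector_mult_diff_rdistrib) (simp add: algebra_simps)
  qed (simp_all add: matrix_vector_mult_def vec_eq_iff mat_def if_distrib if_distribR cong: if_cong)
qed

lemma bdot_sym_matrix: "transpose B = B \<Longrightarrow> bdot x (B *v y) = bdot (B *v x) y"
proof -
  assume "transpose B = B"
  then have s: "B $ i $ j = B $ j $ i" for i j by (metis transpose_def vec_lambda_beta)
  have "bdot x (B *v y) = (\<Sum>i\<in>UNIV. \<Sum>j\<in>UNIV. x $ i * (B $ i $ j * y $ j))"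
    by (simp add: bdot_def matrix_vector_mult_def sum_distrib_left)
  also have "\<dots> = (\<Sum>j\<in>UNIV. \<Sum>i\<in>UNIV. x $ i * (B $ i $ j * y $ j))" by (rule sum.swap)
  also have "\<dots> = bdot (B *v x) y"
    unfolding bdot_def matrix_vector_mult_def
    by (simp add: sum_distrib_right) (intro sum.cong refl, simp add: s mult_ac)
  finally show ?thesis .
qed

lemma bdot_axis [simp]: "bdot v (axis b 1) = v $ b" "bdot (axis b 1) v = v $ b"
  by (simp_all add: bdot_def axis_def if_distrib if_distribR cong: if_cong)

lemma bdot_row: "(B *v y) $ i = bdot (row i B) y"
  by (simp add: bdot_def matrix_vector_mult_def row_def)

lemma bdot_diff: "bdot x (y - w) = bdot x y - bdot x w" "bdot (y - w) x = bdot y x - bdot w x"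
  by (simp_all add: bdot_def algebra_simps sum_subtractf)

lemma bdot_0 [simp]: "bdot 0 y = 0" "bdot y 0 = 0" by (simp_all add: bdot_def)

lemma cjv_cv [simp]: "cjv (cv c) = cv c" by (simp add: vec_eq_iff)

definition dl :: "nat \<Rightarrow> complex^'n \<Rightarrow> nat \<Rightarrow> complex^'n" where "dl n v = (\<lambda>m. if m = n then v else 0)"

lemma dl_ell2: "1 \<le> n \<Longrightarrow> dl n v \<in> ell2"
  by (rule ell2_finite_support[of _ n]) (auto simp: dl_def)

lemma bl_dl: "bl u (dl n v) = bdot (u n) v"
proof -
  have "(\<lambda>m. bdot (u m) (dl n v m)) = (\<lambda>m. if m = n then bdot (u n) v else 0)"
    by (auto simp: dl_def)
  then show ?thesis
    unfolding bl_def using sums_single[of n "\<lambda>_. bdot (u n) v"] by (simp add: sums_iff)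
qed

lemma cj_dl: "cj (dl n v) = dl n (cjv v)" by (auto simp: cj_def dl_def vec_eq_iff)

context acrep begin

definition R :: "complex \<Rightarrow> (nat \<Rightarrow> complex^'l) \<Rightarrow> (nat \<Rightarrow> complex^'l)" where
  "R z g = (SOME u. u \<in> Dom \<and> H u = (\<lambda>n. z *s u n + g n) \<and> ds_eq A \<nu> (U u) (ds_scale (\<lambda>x. 1 / (of_real x - z)) (U g)))"

lemma R_props:
  assumes "g \<in> ell2" "Im z > 0"
  shows R_Dom: "R z g \<in> Dom" and H_R: "H (R z g) = (\<lambda>n. z *s R z g n + g n)"
    and U_R: "ds_eq A \<nu> (U (R z g)) (ds_scale (\<lambda>x. 1 / (of_real x - z)) (U g))"
proof -
  have "\<exists>u. u \<in> Dom \<and> H u = (\<lambda>n. z *s u n + g n) \<and> ds_eq A \<nu> (U u) (ds_scale (\<lambda>x. 1 / (of_real x - z)) (U g))"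
    using resolvent_exists[OF assms(1), of z] assms(2) by auto
  from someI_ex[OF this] show "R z g \<in> Dom" "H (R z g) = (\<lambda>n. z *s R z g n + g n)"
    "ds_eq A \<nu> (U (R z g)) (ds_scale (\<lambda>x. 1 / (of_real x - z)) (U g))"
    unfolding R_def[symmetric] by auto
qed

lemma R_ell2: "g \<in> ell2 \<Longrightarrow> Im z > 0 \<Longrightarrow> R z g \<in> ell2"
  using R_Dom dom_ell2 by blast

lemma resolvent_norm:
  assumes "u \<in> Dom" "H u = (\<lambda>n. z *s u n + g n)"
  shows "(Im z)\<^sup>2 * l2norm2 u \<le> l2norm2 g"
  using resolvent_bound[OF assms(1), of z] by (simp add: assms(2))

lemma R_bound: "g \<in> ell2 \<Longrightarrow> Im z > 0 \<Longrightarrow> (Im z)\<^sup>2 * l2norm2 (R z g) \<le> l2norm2 g"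
  by (rule resolvent_norm[OF R_Dom H_R])

text \<open>The difference of two solutions solves the equation with source 0, and
  \<open>resolvent_norm\<close> then bounds its norm by 0.\<close>

lemma R_unique:
  assumes u: "u \<in> Dom" and e: "H u = (\<lambda>n. z *s u n + g n)" and g: "g \<in> ell2" and z: "Im z > 0"
  shows "R z g = u"
proof -
  define d where "d = (\<lambda>n. (- 1) *s R z g n + u n)"
  have d: "d \<in> Dom" unfolding d_def by (intro Hdir_dom_lin R_Dom g z u)
  have "H d = (\<lambda>n. z *s d n + 0)"
    unfolding d_def Hdir_lin H_R[OF g z] e by (auto simp: fun_eq_iff vec_eq_iff algebra_simps)
  from resolvent_norm[OF d this] have "(Im z)\<^sup>2 * l2norm2 d \<le> 0" by (simp add: l2norm2_def)
  then have "l2norm2 d \<le> 0" using z by (simp add: mult_le_0_iff not_less)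
  then have "d = (\<lambda>n. 0)" using l2norm2_eq_0 l2norm2_nonneg dom_ell2(1)[OF d] by (metis order_antisym)
  then show ?thesis by (auto simp: d_def fun_eq_iff vec_eq_iff)
qed

lemma R_lin:
  assumes "g \<in> ell2" "h \<in> ell2" "Im z > 0"
  shows "R z (\<lambda>n. c *s g n + h n) = (\<lambda>n. c *s R z g n + R z h n)"
proof (rule R_unique)
  show "(\<lambda>n. c *s R z g n + R z h n) \<in> Dom" by (intro Hdir_dom_lin R_Dom assms)
  show "H (\<lambda>n. c *s R z g n + R z h n) = (\<lambda>n. z *s (c *s R z g n + R z h n) + (c *s g n + h n))"
    unfolding Hdir_lin H_R[OF assms(1,3)] H_R[OF assms(2,3)]
    by (auto simp: fun_eq_iff vec_eq_iff algebra_simps)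
qed (intro ell2_lin assms)+

lemma R_symmetric:
  assumes g: "g \<in> ell2" and h: "h \<in> ell2" and z: "Im z > 0"
  shows "bl (R z g) h = bl g (R z h)"
proof -
  have hh: "h = (\<lambda>n. (- z) *s R z h n + H (R z h) n)"
    unfolding H_R[OF h z] by (auto simp: vec_eq_iff)
  have gg: "g = (\<lambda>n. (- z) *s R z g n + H (R z g) n)"
    unfolding H_R[OF g z] by (auto simp: vec_eq_iff)
  note e = R_ell2[OF g z] R_ell2[OF h z] dom_ell2(2)[OF R_Dom[OF g z]] dom_ell2(2)[OF R_Dom[OF h z]]
  have "bl (R z g) h = - z * bl (R z g) (R z h) + bl (R z g) (H (R z h))"
    by (subst hh, rule bl_lin2) (use e in auto)
  moreover have "bl g (R z h) = - z * bl (R z g) (R z h) + bl (H (R z g)) (R z h)"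
    by (subst gg, rule bl_lin) (use e in auto)
  ultimately show ?thesis using H_symmetric[OF R_Dom[OF g z] R_Dom[OF h z]] by simp
qed

text \<open>In the pairing of u with g = (H - z) u the form of H is real, which leaves the term from
  z. All positivity of Green functions below comes from this identity.\<close>

lemma Im_bl_resolvent:
  assumes u: "u \<in> Dom" and e: "H u = (\<lambda>n. z *s u n + g n)" and g: "g \<in> ell2"
  shows "Im (bl u (cj g)) = Im z * l2norm2 u"
proof -
  have gg: "cj g = (\<lambda>n. (- cnj z) *s cj u n + cj (H u) n)"
    unfolding e by (auto simp: vec_eq_iff cj_def fun_eq_iff)
  have "bl u (cj g) = - cnj z * bl u (cj u) + bl u (cj (H u))"
    by (subst gg, rule bl_lin2) (use dom_ell2[OF u] ell2_cj in auto)
  then show ?thesis using H_quadratic_real[OF u] dom_ell2[OF u] by (simp add: bl_self)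
qed

lemma R_entry: "1 \<le> n \<Longrightarrow> 1 \<le> m \<Longrightarrow> Im z > 0 \<Longrightarrow> R z (dl m c) n $ b = bdot c (R z (dl n (axis b 1)) m)"
  using R_symmetric[of "dl m c" "dl n (axis b 1)" z] dl_ell2[of m c] dl_ell2[of n "axis b 1"]
  by (simp add: bl_dl bl_commute[of "dl m c"] bdot_commute)

lemma resolvent_identity:
  assumes g: "g \<in> ell2" and z: "Im z > 0" and w: "Im w > 0"
  shows "R z g n = (z - w) *s R z (R w g) n + R w g n"
proof -
  have "R z g = (\<lambda>n. (z - w) *s R z (R w g) n + R w g n)"
  proof (rule R_unique[OF _ _ g z])
    show "(\<lambda>n. (z - w) *s R z (R w g) n + R w g n) \<in> Dom" by (intro Hdir_dom_lin R_Dom R_ell2 g z w)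
    show "H (\<lambda>n. (z - w) *s R z (R w g) n + R w g n) = (\<lambda>n. z *s ((z - w) *s R z (R w g) n + R w g n) + g n)"
      unfolding Hdir_lin H_R[OF R_ell2[OF g w] z] H_R[OF g w]
      by (auto simp: fun_eq_iff vec_eq_iff algebra_simps)
  qed
  then show ?thesis by metis
qed

lemma R_component_bound:
  assumes "g \<in> ell2" "Im z > 0"
  shows "cmod (R z g n $ a) \<le> sqrt (l2norm2 g) / Im z"
proof -
  have "(cmod (R z g n $ a))\<^sup>2 \<le> (norm (R z g n))\<^sup>2"
    by (intro power_mono Finite_Cartesian_Product.norm_nth_le) auto
  also have "\<dots> \<le> l2norm2 (R z g)" by (rule norm_le_l2norm2[OF R_ell2[OF assms]])
  also have "\<dots> \<le> l2norm2 g / (Im z)\<^sup>2" using R_bound[OF assms] assms(2) by (simp add: field_simps)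
  finally have "cmod (R z g n $ a) \<le> sqrt (l2norm2 g / (Im z)\<^sup>2)" by (rule real_le_rsqrt)
  then show ?thesis using assms(2) by (simp add: real_sqrt_divide)
qed

text \<open>By the resolvent identity the difference quotient at w is an entry of R z (R w g). The
  identity and the norm bound, applied once more, show that it tends to R w (R w g).\<close>

lemma R_holomorphic:
  assumes g: "g \<in> ell2" shows "(\<lambda>z. R z g n $ a) holomorphic_on {z. Im z > 0}"
proof -
  have "((\<lambda>z. R z g n $ a) has_field_derivative R w (R w g) n $ a) (at w)" if w: "Im w > 0" for w
  proof -
    define h where "h = R w g"
    have h: "h \<in> ell2" unfolding h_def by (rule R_ell2[OF g w])
    \<comment> \<open>Staying above half the height of w makes the resolvent bound uniform in
      z.\<close>
    have op: "eventually (\<lambda>z. Im z > Im w / 2) (at w)"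
      by (rule eventually_at_topological[THEN iffD2], rule exI[of _ "{z. Im z > Im w / 2}"], intro conjI)
         (use w open_halfspace_Im_gt[of "Im w / 2"] in simp_all)
    define C where "C = sqrt (l2norm2 (R w h)) / (Im w / 2)"
    have "((\<lambda>z. R z h n $ a - R w h n $ a) \<longlongrightarrow> 0) (at w)"
    proof (rule Lim_null_comparison)
      show "((\<lambda>z. cmod (z - w) * C) \<longlongrightarrow> 0) (at w)"
        by (intro tendsto_eq_intros) auto
      show "eventually (\<lambda>z. cmod (R z h n $ a - R w h n $ a) \<le> cmod (z - w) * C) (at w)"
        using op
      proof eventually_elim
        case (elim z)
        then have z: "Im z > 0" using w by simp
        have "R z h n $ a - R w h n $ a = (z - w) * (R z (R w h) n $ a)"
          using arg_cong[OF resolvent_identity[OF h z w, of n], of "\<lambda>v. v $ a"] by (simp add: algebra_simps)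
        moreover have "cmod (R z (R w h) n $ a) \<le> sqrt (l2norm2 (R w h)) / Im z"
          by (rule R_component_bound[OF R_ell2[OF h w] z])
        moreover have "sqrt (l2norm2 (R w h)) / Im z \<le> C"
          unfolding C_def using elim w z l2norm2_nonneg[OF R_ell2[OF h w]] by (intro divide_left_mono) auto
        ultimately show ?case by (simp add: norm_mult mult_left_mono)
      qed
    qed
    then have "((\<lambda>z. R z h n $ a) \<longlongrightarrow> R w h n $ a) (at w)" by (simp add: LIM_zero_iff)
    moreover have "eventually (\<lambda>z. R z h n $ a = (R z g n $ a - R w g n $ a) / (z - w)) (at w)"
      using op eventually_neq_at_within[of w w UNIV]
    proof eventually_elim
      case (elim z)
      then have z: "Im z > 0" using w by simp
      show ?case using arg_cong[OF resolvent_identity[OF g z w, of n], of "\<lambda>v. v $ a"] elim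
        by (simp add: h_def field_simps)
    qed
    ultimately show ?thesis
      unfolding has_field_derivative_iff h_def by (simp add: tendsto_cong)
  qed
  then show ?thesis
    by (intro holomorphic_onI) (auto simp: field_differentiable_def intro: has_field_derivative_at_within)
qed

section \<open>The Weyl matrix and its inverse\<close>

definition M :: "complex \<Rightarrow> complex^'l^'l" where
  "M z = (\<chi> b a. R z (dl 1 (axis a 1)) 1 $ b)"

definition P :: "complex \<Rightarrow> complex^'l^'l" where "P z = matrix_inv (M z)"

lemma M_entry_sym: "Im z > 0 \<Longrightarrow> M z $ a $ b = M z $ b $ a"
  using R_entry[of 1 1 z "axis b 1" a] by (simp add: M_def)

lemma M_sym: "Im z > 0 \<Longrightarrow> transpose (M z) = M z"
  by (simp add: vec_eq_iff transpose_def M_entry_sym[symmetric])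

lemma M_mult:
  assumes z: "Im z > 0" shows "M z *v c = R z (dl 1 c) 1"
proof -
  have "(M z *v c) $ b = R z (dl 1 c) 1 $ b" for b
  proof -
    have "(M z *v c) $ b = (\<Sum>a\<in>UNIV. c $ a * M z $ a $ b)"
      unfolding matrix_vector_mult_def vec_lambda_beta
      by (intro sum.cong refl) (simp add: M_entry_sym[OF z, of b] mult.commute)
    also have "\<dots> = bdot c (R z (dl 1 (axis b 1)) 1)" by (simp add: bdot_def M_def)
    also have "\<dots> = R z (dl 1 c) 1 $ b" using R_entry[of 1 1 z c b] z by simp
    finally show ?thesis .
  qed
  then show ?thesis by (simp add: vec_eq_iff)
qed

lemma M_quadratic:
  assumes z: "Im z > 0" shows "Im (bdot (M z *v c) (cjv c)) = Im z * l2norm2 (R z (dl 1 c))"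
  using Im_bl_resolvent[OF R_Dom H_R, of "dl 1 c" z] z dl_ell2[of 1 c]
  by (simp add: cj_dl bl_dl M_mult)

lemma R_dl_eq_0:
  assumes z: "Im z > 0" and n: "1 \<le> n" and "l2norm2 (R z (dl n c)) = 0" shows "c = 0"
proof -
  note d = dl_ell2[OF n, of c]
  have "R z (dl n c) = (\<lambda>n. 0)" using l2norm2_eq_0[OF R_ell2[OF d z]] assms by blast
  then have "dl n c n = 0" using fun_cong[OF H_R[OF d z], of n] by (simp add: Hdir_def split: if_splits)
  then show ?thesis by (simp add: dl_def)
qed

text \<open>A vanishing resolvent vector would have source 0. Strictness is used for the
  invertibility of M(z) and to keep the quadratic forms off the cut of the logarithm.\<close>

lemma M_quadratic_pos:
  assumes z: "Im z > 0" and c: "c \<noteq> 0" shows "Im (bdot (M z *v c) (cjv c)) > 0"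
  using M_quadratic[OF z, of c] R_dl_eq_0[OF z, of 1 c] c z l2norm2_nonneg[OF R_ell2[OF dl_ell2[of 1 c] z]]
  by (simp add: order.order_iff_strict) (metis mult_pos_pos)

lemma M_inv:
  assumes z: "Im z > 0" shows "P z ** M z = mat 1" "M z ** P z = mat 1"
proof -
  have "inj ((*v) (M z))"
  proof (rule injI)
    fix x y assume "M z *v x = M z *v y"
    then have "M z *v (x - y) = 0" by (simp add: matrix_vector_mult_diff_distrib)
    then show "x = y" using M_quadratic_pos[OF z, of "x - y"] by fastforce
  qed
  then have "invertible (M z)"
    using matrix_left_invertible_injective invertible_left_inverse by metis
  then show "P z ** M z = mat 1" "M z ** P z = mat 1"
    unfolding P_def by (auto intro: matrix_inv_inverse)
qed

lemma P_sym: assumes z: "Im z > 0" shows "transpose (P z) = P z"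
proof -
  have "transpose (P z) = transpose (P z) ** (M z ** P z)" by (simp add: M_inv[OF z])
  also have "\<dots> = transpose (M z ** P z) ** P z"
    by (simp add: matrix_transpose_mul M_sym[OF z] matrix_mul_assoc)
  finally show ?thesis by (simp add: M_inv[OF z] transpose_mat)
qed

lemma M_holomorphic: "(\<lambda>z. M z $ i $ j) holomorphic_on {z. Im z > 0}"
  unfolding M_def using R_holomorphic[OF dl_ell2, of 1] by simp

text \<open>Cramer's rule writes the entries of the inverse as quotients of determinants with
  holomorphic entries.\<close>

lemma P_holomorphic: "(\<lambda>z. P z $ i $ j) holomorphic_on {z. Im z > 0}"
proof -
  have dh: "(\<lambda>z. det (F z)) holomorphic_on {z. Im z > 0}"
    if "\<And>i j. (\<lambda>z. F z $ i $ j) holomorphic_on {z. Im z > 0}" for F :: "complex \<Rightarrow> complex^'l^'l"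
    unfolding det_def by (intro holomorphic_intros that)
  have nz: "det (M z) \<noteq> 0" if "Im z > 0" for z
    using M_inv(1)[OF that] by (metis det_I det_mul mult_zero_right zero_neq_one)
  have "P z $ i $ j = det (\<chi> a b. if b = i then (if a = j then 1 else 0) else M z $ a $ b) / det (M z)"
    if z: "Im z > 0" for z
  proof -
    have "M z *v (P z *v axis j 1) = axis j 1" by (simp add: matrix_vector_mul_assoc M_inv[OF z])
    then have "P z *v axis j 1 = (\<chi> k. det (\<chi> a b. if b = k then axis j 1 $ a else M z $ a $ b) / det (M z))"
      using cramer[OF nz[OF z]] by blast
    moreover have "(P z *v axis j 1) $ i = P z $ i $ j"
      by (simp add: matrix_vector_mult_def axis_def if_distrib if_distribR cong: if_cong)
    ultimately show ?thesis by (simp add: axis_def eq_commute cong: if_cong)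
  qed
  moreover have "(\<lambda>z. det (\<chi> a b. if b = i then (if a = j then 1 else 0) else M z $ a $ b) / det (M z)) holomorphic_on {z. Im z > 0}"
  proof (intro holomorphic_intros dh)
    show "(\<lambda>z. (\<chi> a b. if b = i then (if a = j then 1 else 0) else M z $ a $ b) $ a $ b) holomorphic_on {z. 0 < Im z}" for a b
      using M_holomorphic[of a b] by (cases "b = i") auto
  qed (use nz M_holomorphic in auto)
  ultimately show ?thesis by (subst holomorphic_cong[OF refl]) auto
qed

end

section \<open>Green functions\<close>

lemma scale_mult_vec: "B *v (r *s y) = r *s (B *v (y :: complex^'n))"
  by (simp add: vec_eq_iff matrix_vector_mult_def sum_distrib_left mult_ac)

lemma transpose_matrix_inv:
  fixes B :: "real^'n^'n"
  assumes "transpose B = B" "invertible B" shows "transpose (matrix_inv B) = matrix_inv B"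
proof -
  note i = matrix_inv_inverse[OF assms(2)]
  have "transpose (matrix_inv B) = transpose (matrix_inv B) ** (B ** matrix_inv B)" by (simp add: i)
  also have "\<dots> = transpose (B ** matrix_inv B) ** matrix_inv B"
    by (simp add: matrix_transpose_mul assms(1) matrix_mul_assoc)
  finally show ?thesis by (simp add: i transpose_mat)
qed

context acrep begin

definition DI :: "complex^'l^'l" where "DI = cm (matrix_inv (D 0))"

lemma DI_inverse: "cm (D 0) ** DI = mat 1" "DI ** cm (D 0) = mat 1"
  unfolding DI_def using matrix_inv_inverse[OF invD[of 0]] by (simp_all add: cm_mult[symmetric] cm_mat)

lemma DI_sym: "transpose DI = DI"
  unfolding DI_def cm_transpose[symmetric]
  using transpose_matrix_inv[of "D 0"] symD[of 0] invD[of 0] by (simp add: sym_mat_def)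

abbreviation "phi z n \<equiv> csol D V z 0 (mat 1) n"
abbreviation "psi z n \<equiv> csol D V z (mat 1) 0 n"

lemma H_eq: "1 \<le> m \<Longrightarrow> H u m = cm (D (int m - 1)) *v u (m - 1) + cm (D (int m)) *v u (Suc m) + cm (V (int m)) *v u m"
  by (simp add: Hdir_def cmv_eq)

text \<open>Replacing the value 0 at site 0 by v lets D(0) v absorb the source at site 1, so the
  modified sequence solves the homogeneous recurrence up to n. At n = 1 no equation is involved,
  which explains the guard on v.\<close>

lemma resolvent_solution:
  assumes u: "u \<in> Dom" and Hu: "H u = (\<lambda>m. z *s u m + g m)"
    and g: "\<And>m. 1 < m \<Longrightarrow> m < n \<Longrightarrow> g m = 0" and v: "1 < n \<Longrightarrow> cm (D 0) *v v = - g 1" and n: "1 \<le> n"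
  shows "u n = phi z n *v u 1 + psi z n *v v"
proof -
  have u0: "u 0 = 0" using u by (simp add: Hdir_dom_def ell2_def)
  define u' where "u' = (\<lambda>m. if m = 0 then v else u m)"
  have "u' n = phi z n *v u' 1 + psi z n *v u' 0"
  proof (rule csol_representation[OF invD, of n])
    fix m assume m: "1 \<le> m" "m < n"
    have e: "cm (D (int m - 1)) *v u (m - 1) + cm (D (int m)) *v u (Suc m) + cm (V (int m)) *v u m = z *s u m + g m"
      using H_eq[OF m(1), of u] fun_cong[OF Hu, of m] by simp
    show "cm (D (int m - 1)) *v u' (m - 1) + cm (D (int m)) *v u' (Suc m) + cm (V (int m)) *v u' m = z *s u' m"
    proof (cases "m = 1")
      case True
      then show ?thesis using e u0 v m by (simp add: u'_def algebra_simps)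
    next
      case False
      then show ?thesis using e g[of m] m by (simp add: u'_def)
    qed
  qed simp
  then show ?thesis using n by (simp add: u'_def)
qed

text \<open>The boundary value - D0^-1 c compensates the source c at site 1. As a matrix this is the
  Weyl solution phi_n M - psi_n D0^-1.\<close>

lemma weyl_solution:
  assumes z: "Im z > 0" and n: "1 \<le> n"
  shows "R z (dl 1 c) n = phi z n *v (M z *v c) - psi z n *v (DI *v c)"
proof -
  have "cm (D 0) *v (- (DI *v c)) = - c"
    using DI_inverse(1) by (simp add: matrix_vector_mul_assoc matrix_vector_mult_diff_distrib[of _ 0, simplified])
  then have "R z (dl 1 c) n = phi z n *v (R z (dl 1 c) 1) + psi z n *v (- (DI *v c))"
    using n by (intro resolvent_solution[OF R_Dom H_R] dl_ell2 z) (auto simp: dl_def)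
  then show ?thesis by (simp add: M_mult[OF z] matrix_vector_mult_diff_distrib[of _ 0, simplified])
qed

text \<open>Symmetry of the Green function exchanges source and observation point, so the Weyl
  solution also gives the response at site 1 to a source at site n.\<close>

lemma resolvent_dl_first:
  assumes z: "Im z > 0" and n: "1 \<le> n"
  shows "R z (dl n (axis i 1)) 1 = M z *v row i (phi z n) - DI *v row i (psi z n)"
proof -
  have "R z (dl n (axis i 1)) 1 $ b = (M z *v row i (phi z n) - DI *v row i (psi z n)) $ b" for b
  proof -
    have "R z (dl n (axis i 1)) 1 $ b = R z (dl 1 (axis b 1)) n $ i"
      using R_entry[of 1 n z "axis i 1" b] n z by simp
    also have "\<dots> = bdot (row i (phi z n)) (M z *v axis b 1) - bdot (row i (psi z n)) (DI *v axis b 1)"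
      unfolding weyl_solution[OF z n] by (simp add: bdot_row)
    also have "\<dots> = (M z *v row i (phi z n) - DI *v row i (psi z n)) $ b"
      by (simp add: bdot_sym_matrix M_sym[OF z] DI_sym)
    finally show ?thesis .
  qed
  then show ?thesis by (simp add: vec_eq_iff)
qed

definition Fphi :: "nat \<Rightarrow> 'l \<Rightarrow> complex \<Rightarrow> complex" where
  "Fphi n i z = R z (dl n (axis i 1)) n $ i"

text \<open>The source sits at site n itself, so up to n the resolvent vector is phi times its value
  at site 1.\<close>

lemma Fphi_eq:
  assumes z: "Im z > 0" and n: "1 \<le> n"
  shows "Fphi n i z = bdot (row i (phi z n)) (M z *v row i (phi z n)) - bdot (row i (phi z n)) (DI *v row i (psi z n))"
proof -
  have "R z (dl n (axis i 1)) n = phi z n *v R z (dl n (axis i 1)) 1 + psi z n *v 0"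
    using n by (intro resolvent_solution[OF R_Dom H_R] dl_ell2 z) (auto simp: dl_def)
  then show ?thesis
    unfolding Fphi_def resolvent_dl_first[OF z n] by (simp add: bdot_row bdot_diff)
qed

text \<open>The pairing with the source returns the entry, whose imaginary part y is then Im z
  |u|^2. At z = i this dominates its own square, y^2 <= |u|^2 = y, hence y <= 1.\<close>

lemma herglotz_entry:
  fixes u :: "nat \<Rightarrow> complex^'l"
  assumes u: "u \<in> Dom" and e: "H u = (\<lambda>n. z *s u n + g n)" and g: "g \<in> ell2"
    and q: "bl u (cj g) = u n $ i" and z: "Im z > 0"
  shows "Im (u n $ i) \<ge> 0" "z = \<i> \<Longrightarrow> Im (u n $ i) \<le> 1"
proof -
  have eq: "Im (u n $ i) = Im z * l2norm2 u" using Im_bl_resolvent[OF u e g] q by simp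
  have u2: "u \<in> ell2" using dom_ell2(1)[OF u] .
  then show "Im (u n $ i) \<ge> 0" using eq z l2norm2_nonneg[OF u2] by simp
  assume "z = \<i>"
  have "(Im (u n $ i))\<^sup>2 \<le> (cmod (u n $ i))\<^sup>2" by (simp add: cmod_power2)
  also have "\<dots> \<le> (norm (u n))\<^sup>2" by (intro power_mono Finite_Cartesian_Product.norm_nth_le) auto
  also have "\<dots> \<le> l2norm2 u" by (rule norm_le_l2norm2[OF u2])
  also have "\<dots> = Im (u n $ i)" using eq \<open>z = \<i>\<close> by simp
  finally have "Im (u n $ i) * Im (u n $ i) \<le> 1 * Im (u n $ i)" by (simp add: power2_eq_square)
  then show "Im (u n $ i) \<le> 1"
    by (cases "Im (u n $ i) > 0") (auto dest: mult_right_le_imp_le)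
qed

lemma cjv_axis: "cjv (axis i 1) = axis i 1" by (simp add: vec_eq_iff axis_def)

lemma Fphi_herglotz:
  assumes n: "1 \<le> n"
  shows "Fphi n i holomorphic_on {z. Im z > 0}" "Im z > 0 \<Longrightarrow> Im (Fphi n i z) \<ge> 0" "Im (Fphi n i \<i>) \<le> 1"
proof -
  note d = dl_ell2[OF n, of "axis i 1"]
  show "Fphi n i holomorphic_on {z. Im z > 0}"
    using R_holomorphic[OF d, of n i] by (simp add: Fphi_def[abs_def])
  have q: "bl (R z (dl n (axis i 1))) (cj (dl n (axis i 1))) = R z (dl n (axis i 1)) n $ i" for z
    by (simp add: cj_dl cjv_axis bl_dl)
  show "Im z > 0 \<Longrightarrow> Im (Fphi n i z) \<ge> 0"
    unfolding Fphi_def using herglotz_entry(1)[OF R_Dom[OF d] H_R[OF d] d q] by blast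
  show "Im (Fphi n i \<i>) \<le> 1"
    unfolding Fphi_def using herglotz_entry(2)[OF R_Dom[OF d] H_R[OF d] d q, of \<i>] by simp
qed

text \<open>The source at site 1 whose response there equals the response to the unit source at site
  n. Subtracting it forces the value 0 at site 1.\<close>

definition cpsi :: "nat \<Rightarrow> 'l \<Rightarrow> complex \<Rightarrow> complex^'l" where
  "cpsi n i z = P z *v R z (dl n (axis i 1)) 1"

text \<open>\<open>upsi\<close> is the resolvent of the operator with the boundary condition \<open>u 1 = 0\<close>, obtained
  from \<open>R z\<close> by Krein's formula.\<close>

definition upsi :: "nat \<Rightarrow> 'l \<Rightarrow> complex \<Rightarrow> nat \<Rightarrow> complex^'l" where
  "upsi n i z = R z (\<lambda>m. (- 1) *s dl 1 (cpsi n i z) m + dl n (axis i 1) m)"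

definition Fpsi :: "nat \<Rightarrow> 'l \<Rightarrow> complex \<Rightarrow> complex" where
  "Fpsi n i z = upsi n i z n $ i"

lemma upsi_first:
  assumes z: "Im z > 0" and n: "1 \<le> n" shows "upsi n i z 1 = 0"
proof -
  have "upsi n i z 1 = (- 1) *s R z (dl 1 (cpsi n i z)) 1 + R z (dl n (axis i 1)) 1"
    unfolding upsi_def R_lin[OF dl_ell2[OF order_refl] dl_ell2[OF n] z] ..
  also have "R z (dl 1 (cpsi n i z)) 1 = R z (dl n (axis i 1)) 1"
    unfolding M_mult[OF z, symmetric] cpsi_def by (simp add: matrix_vector_mul_assoc M_inv[OF z])
  finally show ?thesis by (simp add: vec_eq_iff)
qed

text \<open>The value at site 1 is 0, so the phi term drops out, and the source - cpsi at site 1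
  becomes the boundary value D0^-1 cpsi at site 0, which psi carries to site n.\<close>

lemma Fpsi_eq:
  assumes z: "Im z > 0" and n: "1 \<le> n"
  shows "Fpsi n i z = bdot (row i (psi z n)) (DI *v row i (phi z n))
    - bdot (row i (psi z n)) (DI *v (P z *v (DI *v row i (psi z n))))"
proof -
  define g where "g = (\<lambda>m. (- 1) *s dl 1 (cpsi n i z) m + dl n (axis i 1) m)"
  have g: "g \<in> ell2" unfolding g_def by (intro ell2_lin dl_ell2 n order_refl)
  have uD: "upsi n i z \<in> Dom" "H (upsi n i z) = (\<lambda>m. z *s upsi n i z m + g m)"
    unfolding upsi_def g_def[symmetric] by (rule R_Dom[OF g z] H_R[OF g z])+
  have v: "cm (D 0) *v (DI *v cpsi n i z) = - g 1" if "1 < n"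
  proof -
    have "cm (D 0) *v (DI *v cpsi n i z) = cpsi n i z" by (simp add: matrix_vector_mul_assoc DI_inverse(1))
    moreover have "- g 1 = cpsi n i z" using that by (simp add: g_def dl_def vec_eq_iff)
    ultimately show ?thesis by simp
  qed
  have "upsi n i z n = phi z n *v upsi n i z 1 + psi z n *v (DI *v cpsi n i z)"
    by (rule resolvent_solution[OF uD _ v n]) (auto simp: g_def dl_def vec_eq_iff)
  then have "Fpsi n i z = bdot (row i (psi z n)) (DI *v cpsi n i z)"
    unfolding Fpsi_def upsi_first[OF z n] by (simp add: bdot_row)
  also have "cpsi n i z = row i (phi z n) - P z *v (DI *v row i (psi z n))"
    unfolding cpsi_def resolvent_dl_first[OF z n]
    by (simp add: matrix_vector_mult_diff_distrib[of "P z"] matrix_vector_mul_assoc[of "P z" "M z"] M_inv[OF z])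
  finally show ?thesis by (simp add: matrix_vector_mult_diff_distrib bdot_diff)
qed

text \<open>The source of \<open>upsi\<close> depends on z, so holomorphy is read off from the
  explicit formula instead of from \<open>R_holomorphic\<close>.\<close>

lemma Fpsi_herglotz:
  assumes n: "1 \<le> n"
  shows "Fpsi n i holomorphic_on {z. Im z > 0}" "Im z > 0 \<Longrightarrow> Im (Fpsi n i z) \<ge> 0" "Im (Fpsi n i \<i>) \<le> 1"
proof -
  have "(\<lambda>z. bdot (row i (psi z n)) (DI *v row i (phi z n))
    - bdot (row i (psi z n)) (DI *v (P z *v (DI *v row i (psi z n))))) holomorphic_on {z. Im z > 0}"
    unfolding bdot_def matrix_vector_mult_def row_def
    by (simp, intro holomorphic_intros holomorphic_csol P_holomorphic)
  then show "Fpsi n i holomorphic_on {z. Im z > 0}"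
    by (subst holomorphic_cong[OF refl]) (use Fpsi_eq[OF _ n] in auto)
  have *: "Im (upsi n i z n $ i) \<ge> 0" "z = \<i> \<Longrightarrow> Im (upsi n i z n $ i) \<le> 1" if z: "Im z > 0" for z
  proof -
    define g where "g = (\<lambda>m. (- 1) *s dl 1 (cpsi n i z) m + dl n (axis i 1) m)"
    have g: "g \<in> ell2" unfolding g_def by (intro ell2_lin dl_ell2 n order_refl)
    have uD: "upsi n i z \<in> Dom" "H (upsi n i z) = (\<lambda>m. z *s upsi n i z m + g m)"
      unfolding upsi_def g_def[symmetric] by (rule R_Dom[OF g z] H_R[OF g z])+
    \<comment> \<open>The correcting source sits at site 1, where \<open>upsi\<close> vanishes, so
      it contributes nothing to the pairing.\<close>
    have "bl (upsi n i z) (cj g) = (- 1) * bl (upsi n i z) (dl 1 (cjv (cpsi n i z))) + bl (upsi n i z) (dl n (axis i 1))"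
      unfolding g_def cj_lin cj_dl cjv_axis complex_cnj_minus complex_cnj_one
      by (rule bl_lin2) (use dl_ell2[OF order_refl] dl_ell2[OF n] dom_ell2(1)[OF uD(1)] in auto)
    also have "\<dots> = upsi n i z n $ i"
      unfolding bl_dl upsi_first[OF z n] by simp
    finally have q: "bl (upsi n i z) (cj g) = upsi n i z n $ i" .
    show "Im (upsi n i z n $ i) \<ge> 0" "z = \<i> \<Longrightarrow> Im (upsi n i z n $ i) \<le> 1"
      using herglotz_entry[OF uD g q z] by auto
  qed
  show "Im z > 0 \<Longrightarrow> Im (Fpsi n i z) \<ge> 0" "Im (Fpsi n i \<i>) \<le> 1"
    unfolding Fpsi_def using *[of z] *[of \<i>] by auto
qed

lemma M_cv_pos: "Im z > 0 \<Longrightarrow> c \<noteq> 0 \<Longrightarrow> Im (bdot (M z *v cv c) (cv c)) > 0"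
  using M_quadratic_pos[of z "cv c"] by (simp add: vec_eq_iff)

text \<open>Substituting y = P c turns the form of P at c into the conjugate of the form of M at y,
  which reverses the sign of the imaginary part.\<close>

lemma P_cv_neg:
  assumes z: "Im z > 0" and c: "c \<noteq> 0" shows "Im (bdot (P z *v cv c) (cv c)) < 0"
proof -
  define y where "y = P z *v cv c"
  have My: "M z *v y = cv c" unfolding y_def by (simp add: matrix_vector_mul_assoc M_inv[OF z])
  have "y \<noteq> 0"
  proof
    assume "y = 0"
    then have "cv c = 0" using My by simp
    then show False using c by (auto simp: vec_eq_iff)
  qed
  then have "Im (bdot (M z *v y) (cjv y)) > 0" by (rule M_quadratic_pos[OF z])
  moreover have "bdot (M z *v y) (cjv y) = cnj (bdot y (cv c))"
    unfolding My by (simp add: bdot_cjv bdot_commute)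
  ultimately show ?thesis unfolding y_def by simp
qed

text \<open>Off-diagonal entries need not be Herglotz functions, but quadratic forms at real vectors
  are. Symmetry recovers the entries from such forms.\<close>

lemma polarization_entry:
  fixes B :: "complex^'n^'n"
  assumes "transpose B = B"
  shows "B $ a $ b = (bdot (B *v cv (axis a 1 + axis b 1)) (cv (axis a 1 + axis b 1))
     - bdot (B *v cv (axis a 1)) (cv (axis a 1)) - bdot (B *v cv (axis b 1)) (cv (axis b 1))) / 2"
proof -
  have c: "cv (axis a 1) = axis a 1" for a :: 'n by (simp add: vec_eq_iff axis_def)
  have c2: "cv (axis a 1 + axis b 1) = axis a 1 + axis b 1" for a b :: 'n by (simp add: vec_eq_iff axis_def)
  have B: "(B *v axis a 1) $ b = B $ b $ a" for a b
    by (simp add: matrix_vector_mult_def axis_def if_distrib if_distribR cong: if_cong)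
  have "B $ a $ b = B $ b $ a" by (metis assms transpose_def vec_lambda_beta)
  moreover have "bdot x (axis a 1 + axis b 1) = x $ a + x $ b" for x
    using bdot_axis(1)[of x a] bdot_axis(1)[of x b] by (simp add: bdot_def distrib_left sum.distrib)
  ultimately show ?thesis
    unfolding c c2 by (simp add: matrix_vector_right_distrib B)
qed

text \<open>The forms of M and -M^-1 at the finitely many vectors of the polarisation identity are
  treated as one family, which yields the same radii for both limits.\<close>

lemma boundary_values:
  "\<exists>\<rho> :: nat \<Rightarrow> real. (\<forall>k. 0 < \<rho> k \<and> \<rho> k < 1) \<and> \<rho> \<longlonglongrightarrow> 1 \<and>
    (AE x in lborel. \<exists>M0 P0. (\<lambda>k. M (zpt (\<rho> k) x)) \<longlonglongrightarrow> M0 \<and> (\<lambda>k. P (zpt (\<rho> k) x)) \<longlonglongrightarrow> P0)"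
proof -
  define C :: "(real^'l) set" where "C = range (\<lambda>(a, b). axis a 1 + axis b 1) \<union> range (\<lambda>a. axis a 1)"
  have fC: "finite C" unfolding C_def by simp
  have C0: "c \<noteq> 0" if "c \<in> C" for c
  proof
    assume "c = 0"
    moreover obtain a b where "c = axis a 1 + axis b 1 \<or> c = axis a 1" using \<open>c \<in> C\<close> by (auto simp: C_def)
    ultimately have "(axis a 1 + axis b 1 :: real^'l) $ a = 0 \<or> (axis a 1 :: real^'l) $ a = 0" by auto
    then show False by (auto simp: axis_def split: if_splits)
  qed
  define F where "F = (\<lambda>(c, s) z. if s then bdot (M z *v cv c) (cv c) else - bdot (P z *v cv c) (cv c))"
  have hol: "F i holomorphic_on {z. Im z > 0}" for i
    unfolding F_def bdot_def matrix_vector_mult_def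
    by (cases i; cases "snd i") (auto intro!: holomorphic_intros M_holomorphic P_holomorphic)
  have pos: "Im (F i z) > 0" if "i \<in> C \<times> (UNIV :: bool set)" "Im z > 0" for i z
    using that M_cv_pos P_cv_neg C0 by (auto simp: F_def)
  obtain \<rho> :: "nat \<Rightarrow> real" where \<rho>: "\<forall>k. 0 < \<rho> k \<and> \<rho> k < 1" "\<rho> \<longlonglongrightarrow> 1"
    "AE x in lborel. \<forall>i\<in>C \<times> (UNIV :: bool set). convergent (\<lambda>k. F i (zpt (\<rho> k) x))"
    using herglotz_boundary_values[of "C \<times> (UNIV :: bool set)" F, OF _ hol pos] fC by auto
  have conv_mat: "\<exists>B0. (\<lambda>k. B (z k)) \<longlonglongrightarrow> B0"
    if B: "\<And>k. transpose (B (z k)) = B (z k)" and c: "\<And>c. c \<in> C \<Longrightarrow> convergent (\<lambda>k. bdot (B (z k) *v cv c) (cv c))"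
    for B :: "complex \<Rightarrow> complex^'l^'l" and z :: "nat \<Rightarrow> complex"
  proof -
    have inC: "axis a 1 + axis b 1 \<in> C" "axis a 1 \<in> C" for a b unfolding C_def by auto
    have "convergent (\<lambda>k. B (z k) $ a $ b)" for a b
      unfolding polarization_entry[OF B, of _ a b] divide_inverse
      by (intro convergent_mult convergent_diff convergent_const c inC)
    then have "\<forall>a b. \<exists>l. (\<lambda>k. B (z k) $ a $ b) \<longlonglongrightarrow> l" by (auto simp: convergent_def)
    then obtain B0 where "\<And>a b. (\<lambda>k. B (z k) $ a $ b) \<longlonglongrightarrow> B0 a b" by metis
    then have "(\<lambda>k. B (z k)) \<longlonglongrightarrow> (\<chi> a b. B0 a b)" by (intro vec_tendstoI) simp
    then show ?thesis by blast
  qed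
  have "AE x in lborel. \<exists>M0 P0. (\<lambda>k. M (zpt (\<rho> k) x)) \<longlonglongrightarrow> M0 \<and> (\<lambda>k. P (zpt (\<rho> k) x)) \<longlonglongrightarrow> P0"
    using \<rho>(3)
  proof eventually_elim
    case (elim x)
    have z: "Im (zpt (\<rho> k) x) > 0" for k using Im_zpt_pos[of "\<rho> k" x] \<rho>(1)[rule_format, of k] by simp
    have "convergent (\<lambda>k. bdot (M (zpt (\<rho> k) x) *v cv c) (cv c))" if "c \<in> C" for c
      using elim[rule_format, of "(c, True)"] that by (simp add: F_def)
    moreover have "convergent (\<lambda>k. bdot (P (zpt (\<rho> k) x) *v cv c) (cv c))" if "c \<in> C" for c
    proof -
      have "convergent (\<lambda>k. - (bdot (P (zpt (\<rho> k) x) *v cv c) (cv c)))"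
        using elim[rule_format, of "(c, False)"] that by (simp add: F_def)
      then show ?thesis by (rule convergent_minus_iff[THEN iffD2])
    qed
    ultimately show ?case
      using conv_mat[of M "\<lambda>k. zpt (\<rho> k) x"] conv_mat[of P "\<lambda>k. zpt (\<rho> k) x"] M_sym[OF z] P_sym[OF z] by blast
  qed
  then show ?thesis using \<rho> by blast
qed

end

section \<open>Generalised eigenfunctions\<close>

lemma bdot_scale: "bdot (c *s x) y = c * bdot x y" "bdot x (c *s y) = c * bdot x y"
  by (simp_all add: bdot_def sum_distrib_left mult_ac)

lemma bdot_add: "bdot (x + x') y = bdot x y + bdot x' y" "bdot x (y + y') = bdot x y + bdot x y'"
  by (simp_all add: bdot_def distrib_left distrib_right sum.distrib)

definition trunc :: "nat \<Rightarrow> (nat \<Rightarrow> complex^'n) \<Rightarrow> nat \<Rightarrow> complex^'n" where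
  "trunc N u = (\<lambda>m. if m \<le> N then u m else 0)"

lemma trunc_ell2: "u \<in> ell2 \<Longrightarrow> trunc N u \<in> ell2"
  by (rule ell2_finite_support[of _ N]) (auto simp: trunc_def ell2_def)

lemma trunc_tendsto:
  assumes u: "u \<in> ell2"
  shows "(\<lambda>N. l2norm2 (\<lambda>m. (- 1) *s u m + trunc N u m)) \<longlonglongrightarrow> 0"
proof -
  define f where "f = (\<lambda>m. (norm (u m))\<^sup>2)"
  have f: "summable f" using u by (simp add: ell2_def f_def)
  have "l2norm2 (\<lambda>m. (- 1) *s u m + trunc N u m) = suminf f - (\<Sum>m<Suc N. f m)" for N
  proof -
    define h where "h = (\<lambda>m. (norm ((- 1) *s u m + trunc N u m))\<^sup>2)"
    have "summable h" using ell2_lin[OF u trunc_ell2[OF u], of "- 1" N] by (simp add: ell2_def h_def)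
    moreover have "h m = 0" if "m < Suc N" for m
    proof -
      have "(- 1) *s u m + trunc N u m = 0" using that by (simp add: trunc_def vec_eq_iff)
      then show ?thesis unfolding h_def by (metis norm_zero power_zero_numeral)
    qed
    ultimately have "suminf h = (\<Sum>m. h (m + Suc N))"
      using suminf_split_initial_segment[of h "Suc N"] by simp
    also have "(\<lambda>m. h (m + Suc N)) = (\<lambda>m. f (m + Suc N))"
      by (auto simp: h_def f_def trunc_def norm_smult_vec)
    also have "(\<Sum>m. f (m + Suc N)) = suminf f - (\<Sum>m<Suc N. f m)"
      by (rule suminf_minus_initial_segment[OF f])
    finally show ?thesis by (simp add: l2norm2_def h_def)
  qed
  moreover have "(\<lambda>N. suminf f - (\<Sum>m<Suc N. f m)) \<longlonglongrightarrow> suminf f - suminf f"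
    using LIMSEQ_Suc[OF summable_LIMSEQ[OF f]] by (intro tendsto_diff tendsto_const)
  ultimately show ?thesis by simp
qed

lemma ds_eq_sym: "ds_eq A \<nu> F G \<Longrightarrow> ds_eq A \<nu> G F"
  by (erule ds_eq_cong2[OF _ ds_eq_refl]) auto

context acrep begin

text \<open>\<open>Wn 1 j\<close> is the w_j of the overview.\<close>

definition Wn :: "nat \<Rightarrow> nat \<Rightarrow> real \<Rightarrow> complex^'l" where
  "Wn n j x = (\<chi> a. fst (U (dl n (axis a 1))) j x)"

lemma U_meas: "u \<in> ell2 \<Longrightarrow> fst (U u) j \<in> borel_measurable borel"
  using ds_space_meas(1)[OF U_space] by blast

lemma U_lin_AE:
  assumes "u \<in> ell2" "v \<in> ell2"
  shows "AE x in lborel. x \<in> A j \<longrightarrow> fst (U (\<lambda>n. c *s u n + v n)) j x = c * fst (U u) j x + fst (U v) j x"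
  using U_lin[OF assms, of c] by (simp add: ds_eq_def ds_lin_def)

lemma U_zero_AE: "AE x in lborel. x \<in> A j \<longrightarrow> fst (U (\<lambda>n. 0)) j x = 0"
proof -
  have "(\<lambda>n. 1 *s (0 :: complex^'l) + 0) = (\<lambda>n :: nat. 0)" by simp
  then show ?thesis
    using U_lin_AE[OF ell2_zero ell2_zero, of j 1] by (auto elim!: eventually_mono)
qed

lemma U_dl_AE:
  assumes n: "1 \<le> n"
  shows "AE x in lborel. x \<in> A j \<longrightarrow> fst (U (dl n v)) j x = bdot v (Wn n j x)"
proof -
  have "AE x in lborel. x \<in> A j \<longrightarrow> fst (U (dl n (\<chi> a. if a \<in> S then v $ a else 0))) j x = (\<Sum>a\<in>S. v $ a * Wn n j x $ a)"
    if "finite S" for S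
    using that
  proof (induction S rule: finite_induct)
    case empty
    have "dl n (\<chi> a. if a \<in> {} then v $ a else 0) = (\<lambda>n. 0)" by (auto simp: dl_def vec_eq_iff fun_eq_iff)
    then show ?case using U_zero_AE[of j] by simp
  next
    case (insert b S)
    have eq: "dl n (\<chi> a. if a \<in> insert b S then v $ a else 0)
      = (\<lambda>m. v $ b *s dl n (axis b 1) m + dl n (\<chi> a. if a \<in> S then v $ a else 0) m)"
      using insert(2) by (auto simp: dl_def vec_eq_iff fun_eq_iff axis_def)
    show ?case
      unfolding eq
      using insert(3) U_lin_AE[OF dl_ell2[OF n] dl_ell2[OF n], of j "v $ b" "axis b 1" "\<chi> a. if a \<in> S then v $ a else 0"]
    proof eventually_elim
      case (elim x)
      then show ?case using insert(1,2) by (simp add: Wn_def)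
    qed
  qed
  from this[of UNIV] show ?thesis by (simp add: bdot_def)
qed

lemma H_dl:
  assumes n: "1 \<le> n"
  shows "H (dl n c) = (\<lambda>m. 1 *s dl (Suc n) (cm (D (int n)) *v c) m +
    (1 *s dl n (cm (V (int n)) *v c) m + (if n = 1 then 0 else dl (n - 1) (cm (D (int n - 1)) *v c) m)))"
proof
  fix m
  consider "m = 0" | "m = Suc n" | "m = n" "m \<ge> 1" | "m = n - 1" "m \<ge> 1" | "m \<ge> 1" "m \<noteq> Suc n" "m \<noteq> n" "m \<noteq> n - 1"
    by linarith
  then show "H (dl n c) m = 1 *s dl (Suc n) (cm (D (int n)) *v c) m +
    (1 *s dl n (cm (V (int n)) *v c) m + (if n = 1 then 0 else dl (n - 1) (cm (D (int n - 1)) *v c) m))"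
  proof cases
    case 4
    then have e: "n = Suc m" by simp
    show ?thesis unfolding e using \<open>m \<ge> 1\<close> by (simp add: Hdir_def cmv_eq dl_def)
  qed (use n in \<open>auto simp: Hdir_def cmv_eq dl_def\<close>)
qed

text \<open>U turns H applied to \<open>dl n c\<close> into multiplication by x, while H itself
  moves the vector to the sites n - 1, n and n + 1. At n = 1 the left neighbour is the boundary site
  and contributes 0.\<close>

lemma Wn_recurrence_AE:
  assumes n: "1 \<le> n"
  shows "AE x in lborel. x \<in> A j \<longrightarrow> of_real x * bdot c (Wn n j x) = bdot (cm (D (int n)) *v c) (Wn (Suc n) j x)
    + (bdot (cm (V (int n)) *v c) (Wn n j x) + (if n = 1 then 0 else bdot (cm (D (int n - 1)) *v c) (Wn (n - 1) j x)))"
proof -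
  define g2 where "g2 = (\<lambda>m. (if n = 1 then 0 else dl (n - 1) (cm (D (int n - 1)) *v c) m))"
  define g1 where "g1 = (\<lambda>m. 1 *s dl n (cm (V (int n)) *v c) m + g2 m)"
  have g2: "g2 \<in> ell2"
  proof (cases "n = 1")
    case True then show ?thesis by (simp add: g2_def ell2_zero)
  next
    case False
    then have "1 \<le> n - 1" using n by simp
    from dl_ell2[OF this] False show ?thesis by (simp add: g2_def)
  qed
  have g1: "g1 \<in> ell2" unfolding g1_def by (intro ell2_lin dl_ell2 n g2)
  have sn: "1 \<le> Suc n" by simp
  have Hd: "H (dl n c) = (\<lambda>m. 1 *s dl (Suc n) (cm (D (int n)) *v c) m + g1 m)"
    unfolding g1_def g2_def by (rule H_dl[OF n])
  have "dl n c \<in> Dom"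
    unfolding Hdir_dom_def mem_Collect_eq Hd by (intro conjI dl_ell2 n ell2_lin g1 sn)
  then have UH: "AE x in lborel. x \<in> A j \<longrightarrow> fst (U (H (dl n c))) j x = of_real x * fst (U (dl n c)) j x"
    using U_H[of "dl n c"] by (simp add: ds_eq_def mult_x_def)
  have U2: "AE x in lborel. x \<in> A j \<longrightarrow> fst (U g2) j x = (if n = 1 then 0 else bdot (cm (D (int n - 1)) *v c) (Wn (n - 1) j x))"
  proof (cases "n = 1")
    case True then show ?thesis using U_zero_AE[of j] by (simp add: g2_def)
  next
    case False
    then have "1 \<le> n - 1" using n by simp
    from U_dl_AE[OF this] False show ?thesis by (simp add: g2_def)
  qed
  note L1 = U_lin_AE[OF dl_ell2[OF sn] g1, of j 1 "cm (D (int n)) *v c", folded Hd]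
  note L2 = U_lin_AE[OF dl_ell2[OF n] g2, of j 1 "cm (V (int n)) *v c", folded g1_def]
  show ?thesis
    using UH U2 L1 L2 U_dl_AE[OF n, of j c] U_dl_AE[OF sn, of j "cm (D (int n)) *v c"] U_dl_AE[OF n, of j "cm (V (int n)) *v c"]
    by eventually_elim auto
qed

lemma cm_D_sym: "transpose (cm (D n)) = cm (D n)" "transpose (cm (V n)) = cm (V n)"
  using symD[of n] symV[of n] by (simp_all add: cm_transpose[symmetric] sym_mat_def)

text \<open>The recurrences hold together off one null set, a countable union over j, n and the
  coordinates. Extended by 0 at site 0, the sequence is a multiple of the Dirichlet
  solution.\<close>

lemma Wn_AE: "AE x in lborel. \<forall>j. x \<in> A j \<longrightarrow> (\<forall>n\<ge>1. Wn n j x = phi (of_real x) n *v Wn 1 j x)"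
proof -
  have "AE x in lborel. \<forall>j n a. 1 \<le> n \<longrightarrow> x \<in> A j \<longrightarrow> of_real x * bdot (axis a 1) (Wn n j x) = bdot (cm (D (int n)) *v axis a 1) (Wn (Suc n) j x)
    + (bdot (cm (V (int n)) *v axis a 1) (Wn n j x) + (if n = 1 then 0 else bdot (cm (D (int n - 1)) *v axis a 1) (Wn (n - 1) j x)))"
    unfolding AE_all_countable
  proof (intro allI)
    fix j n a show "AE x in lborel. 1 \<le> n \<longrightarrow> x \<in> A j \<longrightarrow> of_real x * bdot (axis a 1) (Wn n j x) = bdot (cm (D (int n)) *v axis a 1) (Wn (Suc n) j x)
      + (bdot (cm (V (int n)) *v axis a 1) (Wn n j x) + (if n = 1 then 0 else bdot (cm (D (int n - 1)) *v axis a 1) (Wn (n - 1) j x)))"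
      using Wn_recurrence_AE[of n j "axis a 1"] by (cases "1 \<le> n") simp_all
  qed
  then show ?thesis
  proof eventually_elim
    case (elim x)
    show ?case
    proof (intro allI impI)
      fix j n :: nat assume j: "x \<in> A j" and n: "1 \<le> n"
      define u where "u = (\<lambda>m. if m = 0 then 0 else Wn m j x)"
      have "u n = phi (of_real x) n *v u 1 + psi (of_real x) n *v u 0"
      proof (rule csol_representation[OF invD, of n])
        fix m assume m: "1 \<le> m" "m < n"
        have "(cm (D (int m - 1)) *v u (m - 1) + cm (D (int m)) *v u (Suc m) + cm (V (int m)) *v u m) $ a = (of_real x *s u m) $ a" for a
          using elim[rule_format, of m j a] m j
          by (simp add: bdot_sym_matrix[symmetric] cm_D_sym u_def add_ac)
        then show "cm (D (int m - 1)) *v u (m - 1) + cm (D (int m)) *v u (Suc m) + cm (V (int m)) *v u m = of_real x *s u m"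
          unfolding vec_eq_iff by blast
      qed simp
      then show "Wn n j x = phi (of_real x) n *v Wn 1 j x" using n by (simp add: u_def)
    qed
  qed
qed

lemma U_trunc_AE:
  assumes u: "u \<in> ell2"
  shows "AE x in lborel. x \<in> A j \<longrightarrow> fst (U (trunc N u)) j x = (\<Sum>n=1..N. bdot (u n) (Wn n j x))"
proof (induction N)
  case 0
  have "trunc 0 u = (\<lambda>n. 0)" using u by (auto simp: trunc_def ell2_def)
  then show ?case using U_zero_AE[of j] by simp
next
  case (Suc N)
  have sn: "1 \<le> Suc N" by simp
  have eq: "trunc (Suc N) u = (\<lambda>m. 1 *s dl (Suc N) (u (Suc N)) m + trunc N u m)"
    by (auto simp: trunc_def dl_def fun_eq_iff le_Suc_eq)
  show ?case
    unfolding eq using Suc U_dl_AE[OF sn, of j "u (Suc N)"] U_lin_AE[OF dl_ell2[OF sn] trunc_ell2[OF u], of j 1 "u (Suc N)" N]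
    by eventually_elim auto
qed

lemma A_antimono: "i \<le> j \<Longrightarrow> A j \<subseteq> A i"
  using lift_Suc_antimono_le[of A] A_mono by blast

lemma ds_norm2_ge_sum:
  "(\<Sum>i<k. \<integral>\<^sup>+ x. indicator (A i) x * ennreal ((cmod (fst F i x))\<^sup>2) \<partial>lborel) \<le> ds_norm2 A \<nu> F"
proof -
  have "(\<Sum>i<k. \<integral>\<^sup>+ x. indicator (A i) x * ennreal ((cmod (fst F i x))\<^sup>2) \<partial>lborel)
     \<le> (\<Sum>i. \<integral>\<^sup>+ x. indicator (A i) x * ennreal ((cmod (fst F i x))\<^sup>2) \<partial>lborel)"
    by (rule sum_le_suminf) auto
  also have "\<dots> \<le> ds_norm2 A \<nu> F" unfolding ds_norm2_def by simp
  finally show ?thesis .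
qed

text \<open>Since U is onto, the indicator of E in component j0 with zeros elsewhere is the image of
  some u. Truncations converge to u in norm, so by Fatou the lower limit of the summed squared
  errors vanishes almost everywhere; the N obtained depends on x.\<close>

lemma small_approximation_AE:
  assumes E: "E \<in> sets borel" "E \<subseteq> A j0" "emeasure lborel E < \<infinity>"
  shows "\<exists>u\<in>ell2. AE x in lborel. \<forall>\<epsilon>>0. \<exists>N. \<forall>i<k. x \<in> A i \<longrightarrow> (cmod (fst (U (trunc N u)) i x - (if i = j0 then indicator E x else 0)))\<^sup>2 < \<epsilon>"
proof -
  note [measurable] = E(1)
  define F :: dsel where "F = ((\<lambda>i x. if i = j0 then indicator E x else 0), (\<lambda>k x. 0))"
  have "ds_norm2 A \<nu> F = (\<Sum>i. if i = j0 then emeasure lborel E else 0)"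
  proof -
    have "(\<integral>\<^sup>+ x. indicator (A i) x * ennreal ((cmod (fst F i x))\<^sup>2) \<partial>lborel) = (if i = j0 then emeasure lborel E else 0)" for i
    proof (cases "i = j0")
      case True
      have "(\<integral>\<^sup>+ x. indicator (A i) x * ennreal ((cmod (fst F i x))\<^sup>2) \<partial>lborel) = (\<integral>\<^sup>+ x. indicator E x \<partial>lborel)"
        using True E(2) by (intro nn_integral_cong) (auto simp: F_def split: split_indicator)
      then show ?thesis using True by simp
    qed (simp add: F_def)
    then show ?thesis by (simp add: ds_norm2_def F_def)
  qed
  also have "\<dots> = emeasure lborel E"
    using sums_single[of j0 "\<lambda>_. emeasure lborel E"] by (simp add: sums_iff)
  finally have "F \<in> ds_space A \<nu>" using E(3) by (auto simp: ds_space_def F_def)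
  then obtain u where u: "u \<in> ell2" "ds_eq A \<nu> (U u) F" using U_surj by blast
  define T where "T = (\<lambda>N x. \<Sum>i<k. indicator (A i) x * ennreal ((cmod (fst (U (trunc N u)) i x - fst F i x))\<^sup>2))"
  have [measurable]: "fst (U (trunc N u)) i \<in> borel_measurable borel" for N i
    by (rule U_meas[OF trunc_ell2[OF u(1)]])
  have [measurable]: "fst F i \<in> borel_measurable borel" for i by (simp add: F_def)
  have Tm [measurable]: "T N \<in> borel_measurable borel" for N unfolding T_def by measurable
  have Tint: "(\<integral>\<^sup>+x. T N x \<partial>lborel) \<le> ennreal (l2norm2 (\<lambda>m. (- 1) *s u m + trunc N u m))" for N
  proof -
    have "(\<integral>\<^sup>+x. T N x \<partial>lborel) = (\<Sum>i<k. \<integral>\<^sup>+x. indicator (A i) x * ennreal ((cmod (fst (ds_lin (- 1) F (U (trunc N u))) i x))\<^sup>2) \<partial>lborel)"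
      unfolding T_def by (subst nn_integral_sum) (auto simp: ds_lin_def)
    also have "\<dots> \<le> ds_norm2 A \<nu> (ds_lin (- 1) F (U (trunc N u)))" by (rule ds_norm2_ge_sum)
    also have "\<dots> = ds_norm2 A \<nu> (U (\<lambda>m. (- 1) *s u m + trunc N u m))"
      by (rule ds_norm2_cong[OF ds_eq_trans[OF ds_eq_lin[OF ds_eq_sym ds_eq_refl] ds_eq_sym]])
         (use u U_lin trunc_ell2 in blast)+
    also have "\<dots> = ennreal (l2norm2 (\<lambda>m. (- 1) *s u m + trunc N u m))"
      by (rule U_norm[OF ell2_lin[OF u(1) trunc_ell2[OF u(1)]]])
    finally show ?thesis .
  qed
  have "(\<integral>\<^sup>+x. liminf (\<lambda>N. T N x) \<partial>lborel) \<le> liminf (\<lambda>N. \<integral>\<^sup>+x. T N x \<partial>lborel)"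
    by (rule nn_integral_liminf) measurable
  also have "\<dots> \<le> liminf (\<lambda>N. ennreal (l2norm2 (\<lambda>m. (- 1) *s u m + trunc N u m)))"
    by (intro Liminf_mono always_eventually allI Tint)
  also have "\<dots> = 0"
    using tendsto_ennrealI[OF trunc_tendsto[OF u(1)]] by (simp add: lim_imp_Liminf)
  finally have "AE x in lborel. liminf (\<lambda>N. T N x) = 0"
    by (subst (asm) le_zero_eq, subst (asm) nn_integral_0_iff_AE) auto
  then have "AE x in lborel. \<forall>\<epsilon>>0. \<exists>N. \<forall>i<k. x \<in> A i \<longrightarrow> (cmod (fst (U (trunc N u)) i x - (if i = j0 then indicator E x else 0)))\<^sup>2 < \<epsilon>"
  proof eventually_elim
    case (elim x)
    show ?case
    proof (intro allI impI)
      fix \<epsilon> :: real assume \<epsilon>: "\<epsilon> > 0"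
      have "\<exists>N. T N x < ennreal \<epsilon>"
      proof (rule ccontr)
        assume "\<not> ?thesis"
        then have "ennreal \<epsilon> \<le> liminf (\<lambda>N. T N x)"
          by (intro Liminf_bounded always_eventually) (auto simp: not_less)
        then show False using elim \<epsilon> by simp
      qed
      then obtain N where N: "T N x < ennreal \<epsilon>" by blast
      have "(cmod (fst (U (trunc N u)) i x - fst F i x))\<^sup>2 < \<epsilon>" if "i < k" "x \<in> A i" for i
      proof -
        have "indicator (A i) x * ennreal ((cmod (fst (U (trunc N u)) i x - fst F i x))\<^sup>2) \<le> T N x"
          unfolding T_def using that(1) by (intro member_le_sum) auto
        then have "ennreal ((cmod (fst (U (trunc N u)) i x - fst F i x))\<^sup>2) < ennreal \<epsilon>"
          using N that(2) by (simp add: le_less_trans)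
        then show ?thesis using \<epsilon> by (simp add: ennreal_less_iff)
      qed
      then show "\<exists>N. \<forall>i<k. x \<in> A i \<longrightarrow> (cmod (fst (U (trunc N u)) i x - (if i = j0 then indicator E x else 0)))\<^sup>2 < \<epsilon>"
        unfolding F_def fst_conv by blast
    qed
  qed
  then show ?thesis using u(1) by blast
qed

text \<open>On a finitely supported sequence the first k components of U at x are the values of one
  linear functional L at the w_i(x), so they inherit every linear relation. Approximating the
  indicator in component j then forces the j-th coefficient to be 0.\<close>

lemma Wn_independent_AE:
  "AE x in lborel. \<forall>j<k. x \<in> A j \<longrightarrow> (\<forall>i<k. x \<in> A i) \<longrightarrow>
     (\<forall>\<beta>. (\<Sum>i<k. \<beta> i *s Wn 1 i x) = 0 \<longrightarrow> \<beta> j = 0)"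
proof -
  \<comment> \<open>Bounded pieces have finite measure, as the approximation demands, and countably
    many m cover the line.\<close>
  define E where "E = (\<lambda>(j, m). A j \<inter> {- real m..real m})"
  have "\<exists>u\<in>ell2. AE x in lborel. \<forall>\<epsilon>>0. \<exists>N. \<forall>i<k. x \<in> A i \<longrightarrow> (cmod (fst (U (trunc N u)) i x - (if i = j then indicator (E (j, m)) x else 0)))\<^sup>2 < \<epsilon>" for j m
  proof (rule small_approximation_AE)
    have "emeasure lborel (E (j, m)) \<le> emeasure lborel {- real m..real m}"
      by (rule emeasure_mono) (auto simp: E_def)
    also have "\<dots> < \<infinity>" by simp
    finally show "emeasure lborel (E (j, m)) < \<infinity>" .
  qed (auto simp: E_def)
  note ex = this
  define Q where "Q = (\<lambda>j m u. AE x in lborel. \<forall>\<epsilon>>0. \<exists>N. \<forall>i<k. x \<in> A i \<longrightarrow> (cmod (fst (U (trunc N u)) i x - (if i = j then indicator (E (j, m)) x else 0)))\<^sup>2 < \<epsilon>)"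
  have "\<exists>u. u \<in> ell2 \<and> Q j m u" for j m using ex[of j m] unfolding Q_def by blast
  then obtain u where u: "\<And>j m. u j m \<in> ell2" "\<And>j m. Q j m (u j m)" by metis
  have "AE x in lborel. \<forall>j m. \<forall>\<epsilon>>0. \<exists>N. \<forall>i<k. x \<in> A i \<longrightarrow> (cmod (fst (U (trunc N (u j m))) i x - (if i = j then indicator (E (j, m)) x else 0)))\<^sup>2 < \<epsilon>"
    unfolding AE_all_countable using u(2) unfolding Q_def by blast
  moreover have "AE x in lborel. \<forall>j m i N. x \<in> A i \<longrightarrow> fst (U (trunc N (u j m))) i x = (\<Sum>n=1..N. bdot (u j m n) (Wn n i x))"
    unfolding AE_all_countable using U_trunc_AE[OF u(1)] by blast
  ultimately show ?thesis
    using Wn_AE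
  proof eventually_elim
    case (elim x)
    show ?case
    proof (intro allI impI)
      fix j and \<beta> :: "nat \<Rightarrow> complex"
      assume j: "j < k" "x \<in> A j" "\<forall>i<k. x \<in> A i" and z: "(\<Sum>i<k. \<beta> i *s Wn 1 i x) = 0"
      obtain m :: nat where m: "\<bar>x\<bar> \<le> real m" using real_arch_simple by blast
      have xE: "x \<in> E (j, m)" using j m by (auto simp: E_def)
      define L where "L = (\<lambda>N v. \<Sum>n=1..N. bdot (u j m n) (phi (of_real x) n *v v))"
      have L0: "L N 0 = 0" and L1: "L N (c *s v + w) = c * L N v + L N w" for N c v w
        unfolding L_def by (simp_all add: matrix_vector_right_distrib scale_mult_vec bdot_add bdot_scale sum.distrib sum_distrib_left)
      have Ls: "L N (\<Sum>i<k'. \<beta> i *s Wn 1 i x) = (\<Sum>i<k'. \<beta> i * L N (Wn 1 i x))" for N k'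
        by (induction k') (simp_all add: L0 L1 add.commute[of "sum _ _"])
      have y: "fst (U (trunc N (u j m))) i x = L N (Wn 1 i x)" if "i < k" for N i
      proof -
        have "fst (U (trunc N (u j m))) i x = (\<Sum>n=1..N. bdot (u j m n) (Wn n i x))"
          using elim(2) j(3) that by blast
        also have "\<dots> = L N (Wn 1 i x)"
          unfolding L_def
        proof (intro sum.cong refl)
          fix n assume "n \<in> {1..N}"
          then have "1 \<le> n" by simp
          then have "Wn n i x = phi (of_real x) n *v Wn 1 i x" using elim(3) j(3) that by blast
          then show "bdot (u j m n) (Wn n i x) = bdot (u j m n) (phi (of_real x) n *v Wn 1 i x)" by (rule arg_cong)
        qed
        finally show ?thesis .
      qed
      define B where "B = (\<Sum>i<k. cmod (\<beta> i))"
      have B: "B \<ge> 0" unfolding B_def by (simp add: sum_nonneg)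
      have small: "cmod (\<beta> j) \<le> B * \<delta>" if \<delta>: "\<delta> > 0" for \<delta>
      proof -
        obtain N where N: "\<forall>i<k. x \<in> A i \<longrightarrow> (cmod (fst (U (trunc N (u j m))) i x - (if i = j then indicator (E (j, m)) x else 0)))\<^sup>2 < \<delta>\<^sup>2"
          using elim(1)[rule_format, of "\<delta>\<^sup>2" j m] \<delta> by auto
        have d: "cmod (L N (Wn 1 i x) - (if i = j then 1 else 0)) \<le> \<delta>" if "i < k" for i
        proof -
          have "(cmod (L N (Wn 1 i x) - (if i = j then 1 else 0)))\<^sup>2 \<le> \<delta>\<^sup>2"
            using N[rule_format, OF that] j(3) that xE y[OF that, of N] by (auto simp: less_imp_le)
          then show ?thesis using \<delta> by (simp add: power2_le_iff_abs_le)
        qed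
        have "- \<beta> j = (\<Sum>i<k. \<beta> i * L N (Wn 1 i x)) - (\<Sum>i<k. \<beta> i * (if i = j then 1 else 0))"
          using j(1) Ls[of N k] z L0 by (simp add: if_distrib cong: if_cong)
        also have "\<dots> = (\<Sum>i<k. \<beta> i * (L N (Wn 1 i x) - (if i = j then 1 else 0)))"
          by (simp add: sum_subtractf right_diff_distrib)
        finally have eq: "- \<beta> j = (\<Sum>i<k. \<beta> i * (L N (Wn 1 i x) - (if i = j then 1 else 0)))" .
        have "cmod (\<beta> j) = cmod (- \<beta> j)" by (rule norm_minus_cancel[symmetric])
        also have "\<dots> \<le> (\<Sum>i<k. cmod (\<beta> i * (L N (Wn 1 i x) - (if i = j then 1 else 0))))"
          unfolding eq by (rule norm_sum)
        also have "\<dots> \<le> (\<Sum>i<k. cmod (\<beta> i) * \<delta>)"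
          unfolding norm_mult using d by (intro sum_mono mult_left_mono) auto
        finally show ?thesis by (simp add: B_def sum_distrib_right)
      qed
      show "\<beta> j = 0"
      proof (rule ccontr)
        assume b: "\<beta> j \<noteq> 0"
        \<comment> \<open>B / (B + 1) < 1, so this accuracy contradicts a nonzero
          coefficient.\<close>
        then have "cmod (\<beta> j) \<le> B * (cmod (\<beta> j) / (B + 1))" using B by (intro small) auto
        also have "\<dots> < cmod (\<beta> j)" using B b by (simp add: field_simps)
        finally show False by simp
      qed
    qed
  qed
qed

text \<open>The part of the absolutely continuous spectral density of the vector c at site 1 that
  comes from the first k components.\<close>

definition dens :: "nat \<Rightarrow> real^'l \<Rightarrow> real \<Rightarrow> real" where
  "dens k c x = (\<Sum>j<k. indicator (A j) x * (cmod (bdot (cv c) (Wn 1 j x)))\<^sup>2)"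

lemma Wn_meas [measurable]: "1 \<le> n \<Longrightarrow> (\<lambda>x. Wn n j x $ a) \<in> borel_measurable borel"
  using U_meas[OF dl_ell2, of n "axis a 1" j] by (simp add: Wn_def)

lemma dens_meas [measurable]: "dens k c \<in> borel_measurable borel"
proof -
  have [measurable]: "(\<lambda>x. Wn 1 j x $ a) \<in> borel_measurable borel" for j a by (rule Wn_meas) simp
  show ?thesis unfolding dens_def bdot_def by measurable
qed

lemma dens_nonneg: "0 \<le> dens k c x" unfolding dens_def by (intro sum_nonneg) auto

text \<open>The right side is Im z |R z (dl 1 c)|^2, which in the spectral representation is a
  Poisson integral over the whole spectrum. Dropping the singular part and the components from k on
  leaves the left side.\<close>

lemma Im_M_cv_ge:
  assumes z: "Im z > 0"
  shows "(\<integral>\<^sup>+t. ennreal (Im (1 / (of_real t - z)) * dens k c t) \<partial>lborel) \<le> ennreal (Im (bdot (M z *v cv c) (cv c)))"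
proof -
  have d: "dl 1 (cv c) \<in> ell2" by (rule dl_ell2) simp
  define F where "F = ds_scale (\<lambda>x. 1 / (of_real x - z)) (U (dl 1 (cv c)))"
  have Um [measurable]: "fst (U (dl 1 (cv c))) j \<in> borel_measurable borel" for j by (rule U_meas[OF d])
  have Fm [measurable]: "fst F j \<in> borel_measurable borel" for j
    unfolding F_def ds_scale_def fst_conv by measurable
  have I: "Im (1 / (of_real t - z)) = Im z * (cmod (1 / (of_real t - z)))\<^sup>2" for t
    by (simp add: Im_divide norm_divide power_divide cmod_power2)
  have "(\<integral>\<^sup>+t. ennreal (Im (1 / (of_real t - z)) * dens k c t) \<partial>lborel)
      = (\<integral>\<^sup>+t. (\<Sum>j<k. ennreal (Im z) * (indicator (A j) t * ennreal ((cmod (1 / (of_real t - z) * bdot (cv c) (Wn 1 j t)))\<^sup>2))) \<partial>lborel)"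
  proof (rule nn_integral_cong)
    fix t
    have eq: "Im (1 / (of_real t - z)) * dens k c t = (\<Sum>j<k. Im z * (indicator (A j) t * (cmod (1 / (of_real t - z) * bdot (cv c) (Wn 1 j t)))\<^sup>2))"
      unfolding I dens_def sum_distrib_left norm_mult power_mult_distrib
      by (intro sum.cong refl) (simp only: mult_ac)
    show "ennreal (Im (1 / (of_real t - z)) * dens k c t) = (\<Sum>j<k. ennreal (Im z) * (indicator (A j) t * ennreal ((cmod (1 / (of_real t - z) * bdot (cv c) (Wn 1 j t)))\<^sup>2)))"
    proof -
      have e: "ennreal (Im z * (indicator (A j) t * y\<^sup>2)) = ennreal (Im z) * (indicator (A j) t * ennreal (y\<^sup>2))" for j y
        using z by (auto simp: ennreal_mult split: split_indicator)
      show ?thesis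
        unfolding eq e[symmetric] using z by (intro sum_ennreal[symmetric]) simp
    qed
  qed
  also have "\<dots> = (\<integral>\<^sup>+t. (\<Sum>j<k. ennreal (Im z) * (indicator (A j) t * ennreal ((cmod (fst F j t))\<^sup>2))) \<partial>lborel)"
  proof (rule nn_integral_cong_AE)
    have "AE t in lborel. \<forall>j. t \<in> A j \<longrightarrow> fst (U (dl 1 (cv c))) j t = bdot (cv c) (Wn 1 j t)"
      unfolding AE_all_countable using U_dl_AE[of 1] by blast
    then show "AE t in lborel. (\<Sum>j<k. ennreal (Im z) * (indicator (A j) t * ennreal ((cmod (1 / (of_real t - z) * bdot (cv c) (Wn 1 j t)))\<^sup>2)))
       = (\<Sum>j<k. ennreal (Im z) * (indicator (A j) t * ennreal ((cmod (fst F j t))\<^sup>2)))"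
      by eventually_elim (auto intro!: sum.cong simp: F_def ds_scale_def split: split_indicator)
  qed
  also have "\<dots> = ennreal (Im z) * (\<Sum>j<k. \<integral>\<^sup>+t. indicator (A j) t * ennreal ((cmod (fst F j t))\<^sup>2) \<partial>lborel)"
    by (simp add: nn_integral_sum nn_integral_cmult sum_distrib_left)
  also have "\<dots> \<le> ennreal (Im z) * ds_norm2 A \<nu> F"
    by (intro mult_left_mono ds_norm2_ge_sum) simp
  also have "ds_norm2 A \<nu> F = ennreal (l2norm2 (R z (dl 1 (cv c))))"
    using ds_norm2_cong[OF U_R[OF d z]] U_norm[OF R_ell2[OF d z]] by (simp add: F_def)
  also have "ennreal (Im z) * \<dots> = ennreal (Im (bdot (M z *v cv c) (cv c)))"
    using M_quadratic[OF z, of "cv c"] z l2norm2_nonneg[OF R_ell2[OF d z]] by (simp add: ennreal_mult)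
  finally show ?thesis .
qed

text \<open>The Poisson integral of \<open>dens\<close> lies below Im M and has boundary values of
  at least pi times the density. For each c this holds off a null set; a countable dense set of c
  and continuity in c give one null set for all.\<close>

lemma Im_boundary_M_ge_AE:
  assumes \<rho>: "\<And>k. 0 < \<rho> k \<and> \<rho> k < 1" "\<rho> \<longlonglongrightarrow> 1"
  shows "AE x in lborel. \<forall>M0. (\<lambda>k. M (zpt (\<rho> k) x)) \<longlonglongrightarrow> M0 \<longrightarrow> (\<forall>c. pi * dens K c x \<le> Im (bdot (M0 *v cv c) (cv c)))"
proof -
  have z: "Im (zpt (\<rho> k) x) > 0" for k x using Im_zpt_pos[of "\<rho> k" x] \<rho>(1)[of k] by simp
  have one: "AE x in lborel. \<forall>M0. (\<lambda>k. M (zpt (\<rho> k) x)) \<longlonglongrightarrow> M0 \<longrightarrow> pi * dens K c x \<le> Im (bdot (M0 *v cv c) (cv c))" for c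
  proof -
    \<comment> \<open>\<open>poisson_boundary_ge\<close> requires a bounded density, hence the
      truncation; in the end m is taken above \<open>dens K c x\<close>.\<close>
    have "AE x in cauchyM. \<forall>m::nat. ennreal (min (real m) (dens K c x)) \<le>
      limsup (\<lambda>k. \<integral>\<^sup>+t. ennreal (Im (1 / (of_real t - zpt (\<rho> k) x)) / pi * min (real m) (dens K c t)) \<partial>lborel)"
      unfolding AE_all_countable
    proof (intro allI)
      fix m :: nat
      show "AE x in cauchyM. ennreal (min (real m) (dens K c x)) \<le>
        limsup (\<lambda>k. \<integral>\<^sup>+t. ennreal (Im (1 / (of_real t - zpt (\<rho> k) x)) / pi * min (real m) (dens K c t)) \<partial>lborel)"
        by (rule poisson_boundary_ge[where m = "real m", OF \<rho>]) (auto simp: dens_nonneg)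
    qed
    then have "AE x in lborel. \<forall>m::nat. ennreal (min (real m) (dens K c x)) \<le>
      limsup (\<lambda>k. \<integral>\<^sup>+t. ennreal (Im (1 / (of_real t - zpt (\<rho> k) x)) / pi * min (real m) (dens K c t)) \<partial>lborel)"
      by (simp only: AE_cauchyM_iff)
    then show ?thesis
    proof eventually_elim
      case (elim x)
      show ?case
      proof (intro allI impI)
        fix M0 assume M0: "(\<lambda>k. M (zpt (\<rho> k) x)) \<longlonglongrightarrow> M0"
        define I where "I = (\<lambda>k. Im (bdot (M (zpt (\<rho> k) x) *v cv c) (cv c)))"
        define I0 where "I0 = Im (bdot (M0 *v cv c) (cv c))"
        have lim: "I \<longlonglongrightarrow> I0"
          unfolding I_def I0_def bdot_def matrix_vector_mult_def vec_lambda_beta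
          by (intro tendsto_intros tendsto_vec_nth M0)
        have Ipos: "0 \<le> I k" for k unfolding I_def
          using M_quadratic[OF z, of k x "cv c"] z[of k x] l2norm2_nonneg[OF R_ell2[OF dl_ell2[of 1] z]] by simp
        have I0pos: "0 \<le> I0" using lim Ipos by (intro LIMSEQ_le_const) auto
        have "(\<integral>\<^sup>+t. ennreal (Im (1 / (of_real t - zpt (\<rho> k) x)) / pi * min (real m) (dens K c t)) \<partial>lborel) \<le> ennreal (I k / pi)" for k and m :: nat
        proof -
          have nn: "0 \<le> Im (1 / (of_real t - zpt (\<rho> k) x))" for t
            using z[of k x] by (simp add: Im_divide)
          have "(\<integral>\<^sup>+t. ennreal (Im (1 / (of_real t - zpt (\<rho> k) x)) / pi * min (real m) (dens K c t)) \<partial>lborel)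
             \<le> (\<integral>\<^sup>+t. ennreal (1 / pi) * ennreal (Im (1 / (of_real t - zpt (\<rho> k) x)) * dens K c t) \<partial>lborel)"
          proof (rule nn_integral_mono)
            fix t
            have "Im (1 / (of_real t - zpt (\<rho> k) x)) / pi * min (real m) (dens K c t) \<le> (1 / pi) * (Im (1 / (of_real t - zpt (\<rho> k) x)) * dens K c t)"
              using mult_left_mono[OF min.cobounded2[of "real m" "dens K c t"], of "Im (1 / (of_real t - zpt (\<rho> k) x)) / pi"] nn[of t]
              by simp
            then show "ennreal (Im (1 / (of_real t - zpt (\<rho> k) x)) / pi * min (real m) (dens K c t)) \<le> ennreal (1 / pi) * ennreal (Im (1 / (of_real t - zpt (\<rho> k) x)) * dens K c t)"
              by (simp add: ennreal_mult'[symmetric] ennreal_leI)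
          qed
          also have "\<dots> = ennreal (1 / pi) * (\<integral>\<^sup>+t. ennreal (Im (1 / (of_real t - zpt (\<rho> k) x)) * dens K c t) \<partial>lborel)"
            by (rule nn_integral_cmult) measurable
          also have "\<dots> \<le> ennreal (1 / pi) * ennreal (I k)"
            unfolding I_def by (intro mult_left_mono Im_M_cv_ge z) simp
          also have "\<dots> = ennreal (I k / pi)" using Ipos by (simp add: ennreal_mult'[symmetric])
          finally show ?thesis .
        qed
        then have h1: "limsup (\<lambda>k. \<integral>\<^sup>+t. ennreal (Im (1 / (of_real t - zpt (\<rho> k) x)) / pi * min (real m) (dens K c t)) \<partial>lborel) \<le> limsup (\<lambda>k. ennreal (I k / pi))" for m :: nat
          by (intro Limsup_mono always_eventually) auto
        have h2: "limsup (\<lambda>k. ennreal (I k / pi)) = ennreal (I0 / pi)"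
          by (intro lim_imp_Limsup tendsto_ennrealI tendsto_intros lim) auto
        have m: "ennreal (min (real m) (dens K c x)) \<le> ennreal (I0 / pi)" for m :: nat
          by (rule order_trans[OF elim[rule_format, of m] h1[of m, unfolded h2]])
        obtain m :: nat where "dens K c x \<le> real m" using real_arch_simple by blast
        then have "dens K c x \<le> I0 / pi" using m[of m] I0pos by (simp add: min_absorb2)
        then show "pi * dens K c x \<le> Im (bdot (M0 *v cv c) (cv c))" unfolding I0_def by (simp add: field_simps)
      qed
    qed
  qed
  obtain Q :: "(real^'l) set" where Q: "countable Q" "\<And>X. open X \<Longrightarrow> X \<noteq> {} \<Longrightarrow> \<exists>d\<in>Q. d \<in> X"
    using countable_dense_exists by blast
  have "AE x in lborel. \<forall>c\<in>Q. \<forall>M0. (\<lambda>k. M (zpt (\<rho> k) x)) \<longlonglongrightarrow> M0 \<longrightarrow> pi * dens K c x \<le> Im (bdot (M0 *v cv c) (cv c))"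
    using one Q(1) by (subst AE_ball_countable) auto
  then show ?thesis
  proof eventually_elim
    case (elim x)
    show ?case
    proof (intro allI impI)
      fix M0 c assume M0: "(\<lambda>k. M (zpt (\<rho> k) x)) \<longlonglongrightarrow> M0"
      define X where "X = {c. Im (bdot (M0 *v cv c) (cv c)) < pi * dens K c x}"
      have "open X"
        unfolding X_def dens_def bdot_def matrix_vector_mult_def vec_lambda_beta cv_nth
        by (intro open_Collect_less continuous_intros)
      moreover have "d \<notin> X" if "d \<in> Q" for d using elim that M0 by (auto simp: X_def not_less)
      ultimately have "X = {}" using Q(2) by blast
      then show "pi * dens K c x \<le> Im (bdot (M0 *v cv c) (cv c))" by (auto simp: X_def not_less)
    qed
  qed
qed

end

section \<open>Averages of the solutions\<close>

definition im_mat :: "complex^'n^'n \<Rightarrow> real^'n^'n" where "im_mat B = (\<chi> a b. Im (B $ a $ b))"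

lemma im_mat_sym: "transpose B = B \<Longrightarrow> transpose (im_mat B) = im_mat B"
  by (simp add: vec_eq_iff transpose_def im_mat_def)

text \<open>By symmetry the entrywise conjugate B' of B is its adjoint, so the entrywise imaginary
  part is (B - B') / (2 i), whose Hermitian form is the imaginary part of that of B.\<close>

lemma im_mat_form:
  fixes B :: "complex^'n^'n"
  assumes B: "transpose B = B"
  shows "Im (bdot (B *v y) (cjv y)) = re_part y \<bullet> (im_mat B *v re_part y) + im_part y \<bullet> (im_mat B *v im_part y)"
proof -
  define B' :: "complex^'n^'n" where "B' = (\<chi> a b. cnj (B $ a $ b))"
  have B': "transpose B' = B'" using B by (simp add: vec_eq_iff transpose_def B'_def)
  have "B *v y = B' *v y + (2 * \<i>) *s (cm (im_mat B) *v y)"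
  proof -
    have "B $ a $ b * y $ b = B' $ a $ b * y $ b + 2 * \<i> * (cm (im_mat B) $ a $ b * y $ b)" for a b
      by (simp add: B'_def im_mat_def complex_eq_iff algebra_simps)
    then show ?thesis
      by (simp add: vec_eq_iff matrix_vector_mult_def sum.distrib sum_distrib_left)
  qed
  then have "bdot (B *v y) (cjv y) = bdot (B' *v y) (cjv y) + 2 * \<i> * bdot (cm (im_mat B) *v y) (cjv y)"
    by (simp add: bdot_add bdot_scale)
  also have "bdot (B' *v y) (cjv y) = cnj (bdot (B *v y) (cjv y))"
  proof -
    have "cjv (B *v y) = B' *v cjv y" by (simp add: vec_eq_iff matrix_vector_mult_def B'_def)
    then have "cnj (bdot (B *v y) (cjv y)) = bdot (B' *v cjv y) y" by (simp add: bdot_cjv)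
    also have "\<dots> = bdot y (B' *v cjv y)" by (rule bdot_commute)
    also have "\<dots> = bdot (B' *v y) (cjv y)" by (rule bdot_sym_matrix[OF B'])
    finally show ?thesis ..
  qed
  finally have "Im (bdot (B *v y) (cjv y)) = Re (bdot (cm (im_mat B) *v y) (cjv y))"
    by (simp add: complex_eq_iff)
  moreover have "Re (bdot w (cjv y)) = re_part w \<bullet> re_part y + im_part w \<bullet> im_part y" for w
    by (simp add: bdot_def inner_vec_def Re_sum sum.distrib)
  ultimately show ?thesis by (simp add: cm_mult_parts inner_commute)
qed

lemma im_mat_form_real:
  assumes "transpose B = B"
  shows "c \<bullet> (im_mat B *v c) = Im (bdot (B *v cv c) (cv c))"
proof -
  have "re_part (cv c) = c" "im_part (cv c) = 0" by (simp_all add: vec_eq_iff)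
  then show ?thesis using im_mat_form[OF assms, of "cv c"] by simp
qed

lemma neg_mult_vec: "(- B) *v (w :: complex^'n) = - (B *v w)"
  by (simp add: vec_eq_iff matrix_vector_mult_def sum_negf)

lemma cm_mv: "cm B *v cv c = cv (B *v c)" by (simp add: vec_eq_iff matrix_vector_mult_def)
lemma row_cm: "row i (cm B) = cv (row i B)" by (simp add: vec_eq_iff row_def)
lemma Im_bdot_cv: "Im (bdot (cv a) (cv b)) = 0" by (simp add: bdot_def Im_sum)

lemma tendsto_mult_vec:
  fixes B :: "nat \<Rightarrow> complex^'n^'n"
  assumes "B \<longlonglongrightarrow> B0" "y \<longlonglongrightarrow> y0" shows "(\<lambda>k. B k *v y k) \<longlonglongrightarrow> B0 *v y0"
  unfolding matrix_vector_mult_def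
  by (intro vec_tendstoI) (simp, intro tendsto_intros tendsto_vec_nth assms)

lemma tendsto_bdot:
  assumes "x \<longlonglongrightarrow> x0" "y \<longlonglongrightarrow> y0" shows "(\<lambda>k. bdot (x k) (y k)) \<longlonglongrightarrow> bdot x0 y0"
  unfolding bdot_def by (intro tendsto_intros tendsto_vec_nth assms)

lemma zpt_tendsto:
  assumes \<rho>: "\<And>k. 0 < \<rho> k \<and> \<rho> k < 1" "\<rho> \<longlonglongrightarrow> 1"
  shows "(\<lambda>k. zpt (\<rho> k) x) \<longlonglongrightarrow> of_real x"
proof -
  have "(\<lambda>k. (of_real x + \<i> * of_real (rsig (\<rho> k))) / (1 - \<i> * of_real (rsig (\<rho> k)) * of_real x)) \<longlonglongrightarrow>
     (of_real x + \<i> * of_real 0) / (1 - \<i> * of_real 0 * of_real x)"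
    by (intro tendsto_intros rsig_tendsto \<rho>(2)) simp
  then show ?thesis using zpt_eq \<rho>(1) by simp
qed

lemma csol_row_tendsto:
  assumes "z \<longlonglongrightarrow> z0"
  shows "(\<lambda>k. row i (csol D V (z k) a b n)) \<longlonglongrightarrow> row i (csol D V z0 a b n)"
proof -
  have c: "isCont (\<lambda>z. csol D V z a b n $ i $ j) z0" for j
    using holomorphic_on_imp_continuous_on[OF holomorphic_csol[of D V a b n i j UNIV]]
    by (simp add: continuous_on_eq_continuous_at)
  then show ?thesis
    unfolding row_def by (intro vec_tendstoI) (simp, rule isCont_tendsto_compose[OF c assms])
qed

lemma liminf_avg_finite:
  fixes b :: "nat \<Rightarrow> real" and S :: "nat \<Rightarrow> ennreal"
  assumes q: "q > 0" and le: "\<And>L. ennreal (q * b L) \<le> S L" and S: "liminf S \<noteq> \<infinity>"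
  shows "liminf (\<lambda>L. ereal (b L)) < \<infinity>"
proof (rule ccontr)
  assume "\<not> ?thesis"
  then have inf: "liminf (\<lambda>L. ereal (b L)) = \<infinity>" by simp
  obtain C where C: "0 \<le> C" "liminf S = ennreal C" using S by (cases "liminf S") auto
  have "ereal ((C + 1) / q) < liminf (\<lambda>L. ereal (b L))" unfolding inf by simp
  from less_LiminfD[OF this] have "eventually (\<lambda>L. ennreal (C + 1) \<le> S L) sequentially"
  proof eventually_elim
    case (elim L)
    then have "C + 1 \<le> q * b L" using q by (simp add: field_simps)
    then show ?case using le[of L] by (meson ennreal_leI order_trans)
  qed
  then have "ennreal (C + 1) \<le> liminf S" by (rule Liminf_bounded)
  then show False using C by (simp add: ennreal_le_iff)
qed

context acrep begin

lemma phi_real: "phi (of_real x) n = cm (dirichlet_sol D V x n)"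
  and psi_real: "psi (of_real x) n = cm (neumann_sol D V x n)"
  using csol_of_real[of D V x 0 "mat 1" n] csol_of_real[of D V x "mat 1" 0 n]
  by (simp_all add: dirichlet_sol_def neumann_sol_def cm_mat)

text \<open>Fatou over the radii bounds each integral by the value at i, at most 2; Fatou over L
  then bounds the integral of the lower limit of the averages by 2 CARD('l). The 2 is 1 from each of
  the two Green functions.\<close>

lemma herglotz_averages_finite_AE:
  assumes \<rho>: "\<And>k :: nat. 0 < \<rho> k \<and> \<rho> k < 1"
    and F: "\<And>n i. F n i holomorphic_on {z. Im z > 0}" "\<And>n i z. Im z > 0 \<Longrightarrow> Im (F n i z) \<ge> 0"
      "\<And>n i. Im (F n i \<i>) \<le> 2"
  shows "AE x in lborel. liminf (\<lambda>L. ennreal (1 / real L) * (\<Sum>n=1..L. \<Sum>i\<in>(UNIV :: 'l set). liminf (\<lambda>k. ennreal (Im (F n i (zpt (\<rho> k) x)))))) \<noteq> \<infinity>"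
proof -
  have ab: "\<bar>\<rho> k\<bar> < 1" for k using \<rho>[of k] by simp
  have Fm [measurable]: "(\<lambda>x. F n i (zpt (\<rho> k) x)) \<in> borel_measurable borel" for n i k
    by (rule measurable_zpt[OF F(1) ab])
  define h where "h = (\<lambda>n i x. liminf (\<lambda>k. ennreal (Im (F n i (zpt (\<rho> k) x)))))"
  have hm [measurable]: "h n i \<in> borel_measurable borel" for n i unfolding h_def by measurable
  have hint: "(\<integral>\<^sup>+x. h n i x \<partial>cauchyM) \<le> ennreal 2" for n i
  proof -
    have "(\<integral>\<^sup>+x. h n i x \<partial>cauchyM) \<le> liminf (\<lambda>k. \<integral>\<^sup>+x. ennreal (Im (F n i (zpt (\<rho> k) x))) \<partial>cauchyM)"
      unfolding h_def by (rule nn_integral_liminf) measurable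
    also have "\<dots> = liminf (\<lambda>k :: nat. ennreal (Im (F n i \<i>)))"
      using herglotz_mean_value[OF F(1) F(2) ab] by simp
    also have "\<dots> \<le> ennreal 2" by (subst Liminf_const) (auto intro!: ennreal_leI F(3) simp del: ennreal_numeral)
    finally show ?thesis .
  qed
  define S where "S = (\<lambda>L x. ennreal (1 / real L) * (\<Sum>n=1..L. \<Sum>i\<in>(UNIV :: 'l set). h n i x))"
  have Sm [measurable]: "S L \<in> borel_measurable borel" for L unfolding S_def by measurable
  have Sint: "(\<integral>\<^sup>+x. S L x \<partial>cauchyM) \<le> ennreal (2 * real CARD('l))" for L
  proof -
    have "(\<integral>\<^sup>+x. S L x \<partial>cauchyM) = ennreal (1 / real L) * (\<Sum>n=1..L. \<Sum>i\<in>(UNIV :: 'l set). \<integral>\<^sup>+x. h n i x \<partial>cauchyM)"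
      unfolding S_def by (simp add: nn_integral_cmult nn_integral_sum)
    also have "\<dots> \<le> ennreal (1 / real L) * (\<Sum>n=1..L. \<Sum>i\<in>(UNIV :: 'l set). ennreal 2)"
      by (intro mult_left_mono sum_mono hint) simp
    also have "(\<Sum>n=1..L. \<Sum>i\<in>(UNIV :: 'l set). ennreal 2) = ennreal (real L * (real CARD('l) * 2))"
      by (simp add: sum_ennreal ennreal_mult' ennreal_of_nat_eq_real_of_nat del: ennreal_numeral)
    also have "ennreal (1 / real L) * \<dots> = ennreal ((1 / real L) * (real L * (real CARD('l) * 2)))"
      by (rule ennreal_mult[symmetric]) simp_all
    \<comment> \<open>At L = 0 the factor 1 / L is 0, so the bound also holds there.\<close>
    also have "\<dots> \<le> ennreal (2 * real CARD('l))" by (intro ennreal_leI) (cases "L = 0", auto)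
    finally show ?thesis .
  qed
  have "(\<integral>\<^sup>+x. liminf (\<lambda>L. S L x) \<partial>cauchyM) \<le> liminf (\<lambda>L. \<integral>\<^sup>+x. S L x \<partial>cauchyM)"
    by (rule nn_integral_liminf) measurable
  also have "\<dots> \<le> liminf (\<lambda>L :: nat. ennreal (2 * real CARD('l)))"
    by (intro Liminf_mono always_eventually allI Sint)
  also have "\<dots> < \<infinity>" by (simp add: Liminf_const ennreal_mult_less_top)
  finally have "AE x in cauchyM. liminf (\<lambda>L. S L x) \<noteq> \<infinity>"
    by (intro nn_integral_PInf_AE) auto
  then show ?thesis unfolding S_def h_def AE_cauchyM_iff .
qed

lemma DI_cv: "DI *v cv c = cv (matrix_inv (D 0) *v c)"
  unfolding DI_def by (rule cm_mv)

text \<open>\<open>A\<close> is indexed from 0 and decreasing, so x in \<open>A (k - 1)\<close>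
  means multiplicity at least k and makes the k vectors \<open>Wn 1 i x\<close> with i < k
  available.\<close>

lemma in_Sset_AE:
  assumes k: "1 \<le> k"
  shows "AE x in lborel. x \<in> A (k - 1) \<longrightarrow> x \<in> Sset D V k"
proof -
  obtain \<rho> :: "nat \<Rightarrow> real" where \<rho>': "\<forall>k. 0 < \<rho> k \<and> \<rho> k < 1" "\<rho> \<longlonglongrightarrow> 1"
    and bv: "AE x in lborel. \<exists>M0 P0. (\<lambda>k. M (zpt (\<rho> k) x)) \<longlonglongrightarrow> M0 \<and> (\<lambda>k. P (zpt (\<rho> k) x)) \<longlonglongrightarrow> P0"
    using boundary_values by (elim exE conjE)
  note \<rho> = \<rho>'(1)[rule_format] \<rho>'(2)
  have z: "Im (zpt (\<rho> m) x) > 0" for m x using Im_zpt_pos[of "\<rho> m" x] \<rho>(1)[of m] by simp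
  \<comment> \<open>\<open>max 1 n\<close> gives the Herglotz properties at every index, including
    0; the averages start at n = 1.\<close>
  define F where "F = (\<lambda>n i z. Fphi (max 1 n) i z + Fpsi (max 1 n) i z)"
  have n1: "1 \<le> max 1 n" for n :: nat by simp
  have F: "F n i holomorphic_on {z. Im z > 0}" "Im z > 0 \<Longrightarrow> Im (F n i z) \<ge> 0" "Im (F n i \<i>) \<le> 2" for n i z
  proof -
    note f = Fphi_herglotz[OF n1[of n], where i = i] and g = Fpsi_herglotz[OF n1[of n], where i = i]
    show "F n i holomorphic_on {z. Im z > 0}" unfolding F_def by (intro holomorphic_on_add f(1) g(1))
    show "Im z > 0 \<Longrightarrow> Im (F n i z) \<ge> 0" unfolding F_def using f(2) g(2) by simp
    show "Im (F n i \<i>) \<le> 2" unfolding F_def using f(3) g(3) by simp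
  qed
  have avg: "AE x in lborel. liminf (\<lambda>L. ennreal (1 / real L) * (\<Sum>n=1..L. \<Sum>i\<in>(UNIV :: 'l set). liminf (\<lambda>k. ennreal (Im (F n i (zpt (\<rho> k) x)))))) \<noteq> \<infinity>"
    by (rule herglotz_averages_finite_AE[OF \<rho>(1) F])
  show ?thesis
    using bv avg Im_boundary_M_ge_AE[OF \<rho>, of k] Wn_independent_AE[of k]
  proof eventually_elim
    case (elim x)
    obtain M0 P0 where lim: "(\<lambda>m. M (zpt (\<rho> m) x)) \<longlonglongrightarrow> M0" "(\<lambda>m. P (zpt (\<rho> m) x)) \<longlonglongrightarrow> P0"
      using elim(1) by blast
    show ?case
    proof
      assume xA: "x \<in> A (k - 1)"
      have xi: "x \<in> A i" if "i < k" for i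
      proof -
        have "i \<le> k - 1" using that by linarith
        from A_antimono[OF this] show ?thesis using xA by blast
      qed
      have ent: "M0 $ a $ b = M0 $ b $ a" "P0 $ a $ b = P0 $ b $ a" for a b
      proof -
        have e: "M (zpt (\<rho> m) x) $ a $ b = M (zpt (\<rho> m) x) $ b $ a" "P (zpt (\<rho> m) x) $ a $ b = P (zpt (\<rho> m) x) $ b $ a" for m a b
          using M_sym[OF z[of m x]] P_sym[OF z[of m x]] by (simp_all add: vec_eq_iff transpose_def)
        note l1 = tendsto_vec_nth[OF tendsto_vec_nth[OF lim(1)]] and l2 = tendsto_vec_nth[OF tendsto_vec_nth[OF lim(2)]]
        show "M0 $ a $ b = M0 $ b $ a"
          by (rule LIMSEQ_unique[OF l1]) (subst e(1), rule l1)
        show "P0 $ a $ b = P0 $ b $ a"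
          by (rule LIMSEQ_unique[OF l2]) (subst e(2), rule l2)
      qed
      have M0s: "transpose M0 = M0" and P0s: "transpose P0 = P0"
        unfolding vec_eq_iff transpose_def by (simp_all add: ent)
      \<comment> \<open>M P = 1 passes to the limit, so M0 is invertible with inverse P0.\<close>
      have MPy: "M0 *v (P0 *v y) = y" for y
      proof -
        have "(\<lambda>m. M (zpt (\<rho> m) x) *v (P (zpt (\<rho> m) x) *v y)) \<longlonglongrightarrow> M0 *v (P0 *v y)"
          by (intro tendsto_mult_vec lim tendsto_const)
        moreover have "M (zpt (\<rho> m) x) *v (P (zpt (\<rho> m) x) *v y) = y" for m
          by (simp add: matrix_vector_mul_assoc M_inv[OF z])
        ultimately have "(\<lambda>m. y) \<longlonglongrightarrow> M0 *v (P0 *v y)" by simp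
        then show ?thesis by (simp add: LIMSEQ_const_iff)
      qed
      define Q where "Q = im_mat M0"
      define QN where "QN = im_mat (- (DI ** P0 ** DI))"
      have Qs: "transpose Q = Q" unfolding Q_def by (rule im_mat_sym[OF M0s])
      have Qform: "c \<bullet> (Q *v c) = Im (bdot (M0 *v cv c) (cv c))" for c
        unfolding Q_def by (rule im_mat_form_real[OF M0s])
      have Qge: "pi * dens k c x \<le> c \<bullet> (Q *v c)" for c
        using elim(3) lim(1) unfolding Qform by blast
      have Qpsd: "0 \<le> c \<bullet> (Q *v c)" for c
        using Qge[of c] dens_nonneg[of k c x] by (meson order_trans mult_nonneg_nonneg pi_ge_zero)
      have kerQ: "dim {c. Q *v c = 0} + k \<le> CARD('l)"
      proof -
        \<comment> \<open>A real c killed by Q has density 0 at x, so it annihilates the k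
          independent vectors.\<close>
        have "{c. Q *v c = 0} \<subseteq> {c. \<forall>i<k. (\<Sum>a\<in>UNIV. of_real (c $ a) * Wn 1 i x $ a) = 0}"
        proof (clarify)
          fix c i assume c: "Q *v c = 0" and i: "i < k"
          have "dens k c x = 0" using Qge[of c] dens_nonneg[of k c x] c pi_gt_zero
            by (auto simp: mult_le_0_iff not_le[symmetric])
          then have "(cmod (bdot (cv c) (Wn 1 i x)))\<^sup>2 = 0"
            unfolding dens_def using i xi[OF i]
            by (subst (asm) sum_nonneg_eq_0_iff) (auto dest!: bspec[of _ _ i])
          then show "(\<Sum>a\<in>UNIV. of_real (c $ a) * Wn 1 i x $ a) = 0" by (simp add: bdot_def)
        qed
        then have "dim {c. Q *v c = 0} \<le> dim {c :: real^'l. \<forall>i<k. (\<Sum>a\<in>UNIV. of_real (c $ a) * Wn 1 i x $ a) = 0}"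
          by (rule dim_subset)
        moreover have "dim {c :: real^'l. \<forall>i<k. (\<Sum>a\<in>UNIV. of_real (c $ a) * Wn 1 i x $ a) = 0} + k \<le> CARD('l)"
        proof (rule dim_annihilator_le)
          fix \<beta> :: "nat \<Rightarrow> complex" assume "(\<Sum>i<k. \<beta> i *s Wn 1 i x) = 0"
          then show "\<forall>i<k. \<beta> i = 0" using elim(4) xi by blast
        qed
        ultimately show ?thesis by linarith
      qed
      have QNs0: "transpose (- (DI ** P0 ** DI)) = - (DI ** P0 ** DI)"
      proof -
        have "transpose (DI ** P0 ** DI) = DI ** P0 ** DI"
          by (simp add: matrix_transpose_mul DI_sym P0s matrix_mul_assoc)
        then show ?thesis by (simp add: vec_eq_iff transpose_def)
      qed
      have QNs: "transpose QN = QN" unfolding QN_def by (rule im_mat_sym[OF QNs0])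
      have neg: "- (DI ** P0 ** DI) *v w = - (DI *v (P0 *v (DI *v w)))" for w
        by (simp add: neg_mult_vec matrix_vector_mul_assoc[symmetric])
      have QNform0: "c \<bullet> (QN *v c) = - Im (bdot (cv c) (DI *v (P0 *v (DI *v cv c))))" for c
        unfolding QN_def im_mat_form_real[OF QNs0] neg
        by (simp add: bdot_commute[of _ "cv c"] bdot_diff(1)[of _ 0, simplified])
      \<comment> \<open>With y = P0 D0^-1 c, the vector M0 y = D0^-1 c is real. The form of - D0^-1
        P0 D0^-1 at c thus has the imaginary part of the form of M0 at the complex vector y, which
        is Q at the real and imaginary parts of y.\<close>
      have QNform: "c \<bullet> (QN *v c) = re_part (P0 *v (DI *v cv c)) \<bullet> (Q *v re_part (P0 *v (DI *v cv c)))
         + im_part (P0 *v (DI *v cv c)) \<bullet> (Q *v im_part (P0 *v (DI *v cv c)))" for c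
      proof -
        define y where "y = P0 *v (DI *v cv c)"
        have My: "M0 *v y = DI *v cv c" unfolding y_def by (rule MPy)
        have "c \<bullet> (QN *v c) = - Im (bdot (DI *v cv c) y)"
          unfolding QNform0 y_def by (simp add: bdot_sym_matrix[OF DI_sym])
        also have "\<dots> = Im (cnj (bdot (DI *v cv c) y))" by simp
        also have "cnj (bdot (DI *v cv c) y) = bdot (M0 *v y) (cjv y)"
          unfolding bdot_cjv My by (simp add: DI_cv)
        finally show ?thesis unfolding im_mat_form[OF M0s] Q_def y_def .
      qed
      have QNpsd: "0 \<le> c \<bullet> (QN *v c)" for c unfolding QNform by (intro add_nonneg_nonneg Qpsd)
      have kerQN: "dim {c. QN *v c = 0} + k \<le> CARD('l)"
      proof -
        have "{c. QN *v c = 0} \<subseteq> {c. cm Q *v ((P0 ** DI) *v cv c) = 0}"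
        proof (clarify)
          fix c assume "QN *v c = 0"
          then have s: "re_part (P0 *v (DI *v cv c)) \<bullet> (Q *v re_part (P0 *v (DI *v cv c))) +
            im_part (P0 *v (DI *v cv c)) \<bullet> (Q *v im_part (P0 *v (DI *v cv c))) = 0"
            using QNform[of c] by simp
          have "re_part (P0 *v (DI *v cv c)) \<bullet> (Q *v re_part (P0 *v (DI *v cv c))) = 0"
            "im_part (P0 *v (DI *v cv c)) \<bullet> (Q *v im_part (P0 *v (DI *v cv c))) = 0"
            using s Qpsd[of "re_part (P0 *v (DI *v cv c))"] Qpsd[of "im_part (P0 *v (DI *v cv c))"] by linarith+
          then have "Q *v re_part (P0 *v (DI *v cv c)) = 0" "Q *v im_part (P0 *v (DI *v cv c)) = 0"
            using psd_kernel[OF Qs Qpsd] by blast+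
          then show "cm Q *v ((P0 ** DI) *v cv c) = 0"
            by (simp add: cm_mult_eq_0_iff matrix_vector_mul_assoc[symmetric])
        qed
        then have "dim {c. QN *v c = 0} \<le> dim {c. cm Q *v ((P0 ** DI) *v cv c) = 0}" by (rule dim_subset)
        also have "\<dots> \<le> dim {c. Q *v c = 0}"
        proof (rule dim_twisted_kernel_le)
          \<comment> \<open>D0 M0 is a left inverse of P0 D0^-1, so the twist by P0 D0^-1 does not
            enlarge the kernel.\<close>
          have "(cm (D 0) ** M0) ** (P0 ** DI) *v y = y" for y
            by (simp only: matrix_vector_mul_assoc[symmetric] MPy) (simp add: matrix_vector_mul_assoc DI_inverse)
          then show "(cm (D 0) ** M0) ** (P0 ** DI) = mat 1"
            by (simp add: matrix_eq)
        qed
        finally show ?thesis using kerQ by simp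
      qed
      obtain q1 where q1: "q1 > 0" "\<And>B :: real^'l^'l. q1 * (sv (CARD('l) - k + 1) B)\<^sup>2 \<le> (\<Sum>i\<in>UNIV. row i B \<bullet> (Q *v row i B))"
        using sv_le_trace_quadratic[OF Qs Qpsd kerQ k] by blast
      obtain q2 where q2: "q2 > 0" "\<And>B :: real^'l^'l. q2 * (sv (CARD('l) - k + 1) B)\<^sup>2 \<le> (\<Sum>i\<in>UNIV. row i B \<bullet> (QN *v row i B))"
        using sv_le_trace_quadratic[OF QNs QNpsd kerQN k] by blast
      define q where "q = min q1 q2"
      have q: "q > 0" using q1 q2 by (simp add: q_def)
      define t where "t = (\<lambda>n i. row i (dirichlet_sol D V x n) \<bullet> (Q *v row i (dirichlet_sol D V x n))
        + row i (neumann_sol D V x n) \<bullet> (QN *v row i (neumann_sol D V x n)))"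
      have t0: "0 \<le> t n i" for n i unfolding t_def by (intro add_nonneg_nonneg Qpsd QNpsd)
      have limF: "liminf (\<lambda>m. ennreal (Im (F n i (zpt (\<rho> m) x)))) = ennreal (t n i)" if n: "1 \<le> n" for n i
      proof -
        have Feq: "F n i w = Fphi n i w + Fpsi n i w" for w using n by (simp add: F_def max_def)
        define p where "p = cv (row i (dirichlet_sol D V x n))"
        define s where "s = cv (row i (neumann_sol D V x n))"
        have pl: "(\<lambda>m. row i (phi (zpt (\<rho> m) x) n)) \<longlonglongrightarrow> p" and sl: "(\<lambda>m. row i (psi (zpt (\<rho> m) x) n)) \<longlonglongrightarrow> s"
          using csol_row_tendsto[OF zpt_tendsto[OF \<rho>, of x], where i = i and D = D and V = V and a = 0 and b = "mat 1" and n = n]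
            csol_row_tendsto[OF zpt_tendsto[OF \<rho>, of x], where i = i and D = D and V = V and a = "mat 1" and b = 0 and n = n]
          unfolding phi_real psi_real row_cm p_def s_def by auto
        have "(\<lambda>m. F n i (zpt (\<rho> m) x)) \<longlonglongrightarrow> (bdot p (M0 *v p) - bdot p (DI *v s)) + (bdot s (DI *v p) - bdot s (DI *v (P0 *v (DI *v s))))"
          unfolding Feq Fphi_eq[OF z n] Fpsi_eq[OF z n]
          by (intro tendsto_add tendsto_diff tendsto_bdot tendsto_mult_vec tendsto_const pl sl lim)
        \<comment> \<open>At the real point p, s and D0^-1 are real, so both mixed terms disappear
          from the imaginary part.\<close>
        from tendsto_Im[OF this]
        have "(\<lambda>m. Im (F n i (zpt (\<rho> m) x))) \<longlonglongrightarrow> t n i"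
          unfolding t_def Qform QNform0 p_def[symmetric] s_def[symmetric] bdot_commute[of "M0 *v p" p]
          by (simp add: p_def s_def DI_cv Im_bdot_cv)
        then show ?thesis by (intro lim_imp_Liminf tendsto_ennrealI) auto
      qed
      define b where "b = (\<lambda>L::nat. 1 / real L * (\<Sum>n=1..L. (sv (CARD('l) - k + 1) (dirichlet_sol D V x n))\<^sup>2
                      + (sv (CARD('l) - k + 1) (neumann_sol D V x n))\<^sup>2))"
      have "liminf (\<lambda>L. ereal (b L)) < \<infinity>"
      proof (rule liminf_avg_finite[OF q _ elim(2)])
        fix L :: nat
        have "q * b L = 1 / real L * (\<Sum>n=1..L. q * (sv (CARD('l) - k + 1) (dirichlet_sol D V x n))\<^sup>2
                      + q * (sv (CARD('l) - k + 1) (neumann_sol D V x n))\<^sup>2)"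
          unfolding b_def by (simp add: sum_distrib_left distrib_left)
        also have "\<dots> \<le> 1 / real L * (\<Sum>n=1..L. \<Sum>i\<in>UNIV. t n i)"
        proof (intro mult_left_mono sum_mono)
          fix n
          have "q * (sv (CARD('l) - k + 1) B)\<^sup>2 \<le> q1 * (sv (CARD('l) - k + 1) B)\<^sup>2"
            "q * (sv (CARD('l) - k + 1) B)\<^sup>2 \<le> q2 * (sv (CARD('l) - k + 1) B)\<^sup>2" for B :: "real^'l^'l"
            by (intro mult_right_mono; simp add: q_def)+
          then show "q * (sv (CARD('l) - k + 1) (dirichlet_sol D V x n))\<^sup>2 + q * (sv (CARD('l) - k + 1) (neumann_sol D V x n))\<^sup>2
            \<le> (\<Sum>i\<in>UNIV. t n i)"
            unfolding t_def sum.distrib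
            using q1(2)[of "dirichlet_sol D V x n"] q2(2)[of "neumann_sol D V x n"] by (meson add_mono order_trans)
        qed simp
        finally have "ennreal (q * b L) \<le> ennreal (1 / real L * (\<Sum>n=1..L. \<Sum>i\<in>UNIV. t n i))" by (rule ennreal_leI)
        also have "\<dots> = ennreal (1 / real L) * (\<Sum>n=1..L. \<Sum>i\<in>UNIV. ennreal (t n i))"
        proof -
          have "ennreal (1 / real L * y) = ennreal (1 / real L) * ennreal y" for y by (rule ennreal_mult') simp
          then show ?thesis using t0 by (simp only: sum_ennreal sum_nonneg)
        qed
        also have "(\<Sum>n=1..L. \<Sum>i\<in>UNIV. ennreal (t n i)) = (\<Sum>n=1..L. \<Sum>i\<in>(UNIV :: 'l set). liminf (\<lambda>m. ennreal (Im (F n i (zpt (\<rho> m) x)))))"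
          by (intro sum.cong refl limF[symmetric]) simp
        finally show "ennreal (q * b L) \<le> ennreal (1 / real L) * (\<Sum>n=1..L. \<Sum>i\<in>(UNIV :: 'l set). liminf (\<lambda>m. ennreal (Im (F n i (zpt (\<rho> m) x)))))" .
      qed
      \<comment> \<open>Needed because \<open>Sset\<close> is empty for larger k.\<close>
      moreover have "k \<le> CARD('l)" using kerQ by simp
      ultimately show "x \<in> Sset D V k" unfolding Sset_def b_def by simp
    qed
  qed
qed

text \<open>More than r indices occur exactly on \<open>A r\<close>, which by
  \<open>in_Sset_AE\<close> with k = r + 1 lies in \<open>Sset D V (r + 1)\<close> up to a null set.
  At r = CARD('l) that set is empty, and the bound holds almost everywhere.\<close>

lemma multiplicity_le_AE:
  "AE x in lborel. x \<notin> Sset D V (r + 1) \<longrightarrow> finite {j. x \<in> A j} \<and> card {j. x \<in> A j} \<le> r"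
proof -
  have "AE x in lborel. x \<in> A (r + 1 - 1) \<longrightarrow> x \<in> Sset D V (r + 1)" by (rule in_Sset_AE) simp
  then show ?thesis
  proof eventually_elim
    case (elim x)
    show ?case
    proof
      assume "x \<notin> Sset D V (r + 1)"
      then have "x \<notin> A r" using elim by auto
      then have "j < r" if "x \<in> A j" for j
        using A_antimono[of r j] that by (meson not_le subsetD)
      then have "{j. x \<in> A j} \<subseteq> {..<r}" by blast
      then show "finite {j. x \<in> A j} \<and> card {j. x \<in> A j} \<le> r"
        using card_mono[OF finite_lessThan[of r]] finite_subset[OF _ finite_lessThan[of r]] by fastforce
    qed
  qed
qed

end

theorem mainTheorem6:
  fixes D V :: "int \<Rightarrow> real^'l^'l" and r :: nat
  assumes symD: "\<And>n. sym_mat (D n)" and symV: "\<And>n. sym_mat (V n)"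
    and invD: "\<And>n. invertible (D n)"
    and bounds: "\<exists>c C. 0 < c \<and> (\<forall>n. c \<le> sv CARD('l) (D n) \<and> sv 1 (D n) \<le> C)"
    and r: "1 \<le> r" "r \<le> CARD('l)"
  shows "\<forall>A \<nu> U. ac_sing_rep (Hdir_dom D V) (Hdir D V) A \<nu> U \<longrightarrow>
           (AE x in lborel. x \<in> Sset D V r - Sset D V (r + 1) \<longrightarrow>
              finite {j. x \<in> A j} \<and> card {j. x \<in> A j} \<le> r)"
proof (intro allI impI)
  fix A \<nu> U assume rep: "ac_sing_rep (Hdir_dom D V) (Hdir D V) A \<nu> U"
  interpret acrep D V A \<nu> U by (intro acrep.intro symD symV invD rep)
  show "AE x in lborel. x \<in> Sset D V r - Sset D V (r + 1) \<longrightarrow>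
              finite {j. x \<in> A j} \<and> card {j. x \<in> A j} \<le> r"
    using multiplicity_le_AE[of r] by eventually_elim blast
qed

end
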